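(* Let $\beta,\gamma\in\mathbb R$, let $\mathcal W$ be as in the context with decay exponent $p>4$, and let $u$ be the global small-data solution of the context, with $\|u(1)\|_\Sigma\le\varepsilon\le\varepsilon_0$; assume in addition that $u(1)\in\mathcal S(\mathbb R)$. Let $A$ be its modified scattering profile and put $$\zeta_0=-\frac\gamma2,\quad A_0=A(-\gamma),\quad \alpha=\beta|A_0|^2,\quad M_0=\int_{\mathbb R}\mathcal W(x)\,dx,\quad C_\alpha=\int_0^\infty\sigma^{-5/2-i\alpha}\big(e^{i\sigma}-1-i\sigma\big)\,d\sigma .$$ There are coefficients $b_0,b_1,b_2,b_3\in\mathbb C$ such that $$\mathcal P_{u,+}(\zeta_0+r)=\sum_{j=0}^3b_jr^j+iM_0|A_0|^4A_0\,C_\alpha\,|r|^{3+2i\alpha}+o(|r|^3)\qquad\text{as }r\to0 .$$ In particular, $\mathcal P_{u,+}$ has a quadratic Peano approximation at $\zeta_0$ with an $O(|r|^3)$ remainder. If $M_0A_0\ne0$, then $\mathcal P_{u,+}$ does not admit a third-order Taylor expansion at $\zeta_0$ (i.e. there is no polynomial $q$ of degree at most $3$ with $\mathcal P_{u,+}(\zeta_0+r)=q(r)+o(|r|^3)$); hence it is not $C^3$ in any neighborhood of $\zeta_0$.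
   Context: Notation: $\langle x\rangle=(1+x^2)^{1/2}$; $\|\cdot\|_q$ is the $L^q(\mathbb R)$ norm; $C_0(\mathbb R)$ is the space of continuous functions vanishing at infinity; $\mathcal S(\mathbb R)$ is the Schwartz class; $\Sigma=\{f\in H^1(\mathbb R):xf\in L^2(\mathbb R)\}$ with $\|f\|_\Sigma=\|f\|_{H^1}+\|xf\|_2$; Fourier transform $\widehat f(\zeta)=\int_{\mathbb R}e^{-i\zeta y}f(y)\,dy$. Complex power: $|r|^{3+2i\alpha}=|r|^3e^{2i\alpha\log|r|}$ for $r\ne0$, with value $0$ at $r=0$. Assumption on $\mathcal W$: $\mathcal W:\mathbb R\to\mathbb R$ is smooth and there are constants $C_{\mathcal W,j}>0$ such that $|\partial_x^j\mathcal W(x)|\le C_{\mathcal W,j}\langle x\rangle^{-p-j}$ for all $x\in\mathbb R$ and all integers $j\ge0$ (here with $p>4$). Equation: $i\partial_tu+\partial_y^2u-\beta|u|^2u+\mathcal W(y+\gamma t)|u|^4u=0$, $t\ge1$, $y\in\mathbb R$ (mild solutions). Small-data solution and profile: $\varepsilon_0=\varepsilon_0(\beta,\mathcal W)>0$ is a sufficiently small threshold, independent of $\gamma$, and $C_\delta,C>0$ are constants such that whenever $\|u_1\|_\Sigma\le\varepsilon\le\varepsilon_0$ there is a unique global solution $u\in C([1,\infty);\Sigma)\cap C^1([1,\infty);H^{-1})$ with $u(1)=u_1$; with $\delta=C_\delta|\beta|\varepsilon^2<1/16$ it satisfies $\|u(t)\|_\infty\le C\varepsilon t^{-1/2}$,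 $\|u(t)\|_{H^1}+\|(y+2it\partial_y)u(t)\|_2\le C\varepsilon t^\delta$ for $t\ge1$, and there is a unique $A\in L^2\cap L^\infty$ (the modified scattering profile) with $\|A\|_2+\|A\|_\infty\le C\varepsilon$ and $$\Big\|u(t,y)-t^{-1/2}e^{iy^2/(4t)}A(y/t)e^{-i\beta|A(y/t)|^2\log t}\Big\|_{L^q_y}\le C\varepsilon t^{-b_q+2\delta},\quad t\ge1,\ q\in\{2,\infty\},\quad b_2=\tfrac12,\ b_\infty=\tfrac34 .$$ Moreover $A\in H^\varsigma(\mathbb R)$ for every $\varsigma<1-2\delta$; $A$ denotes its continuous representative, so $A(-\gamma)$ makes sense. Cubic-renormalized profile: $$\mathcal P_u(t,\zeta)=e^{it\zeta^2}\widehat u(t,\zeta)+i\beta\int_1^te^{is\zeta^2}\,\widehat{|u(s)|^2u(s)}(\zeta)\,ds,\qquad t\ge1;$$ as $t\to\infty$, $\mathcal P_u(t)$ converges in $L^2_\zeta$ and uniformly to a limit $\mathcal P_{u,+}\in L^2(\mathbb R)\cap C_0(\mathbb R)$. *)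

theory Defs
  imports "HOL-Analysis.Analysis" "HOL-Library.Landau_Symbols"
    "HOL-Computational_Algebra.Polynomial"
begin

section \<open>Derivatives, smooth functions, Schwartz functions\<close>

definition nth_deriv :: "nat \<Rightarrow> (real \<Rightarrow> 'a::real_normed_vector) \<Rightarrow> real \<Rightarrow> 'a" where
  "nth_deriv j f = ((\<lambda>g x. vector_derivative g (at x)) ^^ j) f"

definition C_k_on :: "nat \<Rightarrow> (real \<Rightarrow> 'a::real_normed_vector) \<Rightarrow> real set \<Rightarrow> bool" where
  "C_k_on k f U \<longleftrightarrow>
     (\<forall>j<k. \<forall>x\<in>U. nth_deriv j f differentiable (at x)) \<and>
     (\<forall>j\<le>k. continuous_on U (nth_deriv j f))"

definition smooth :: "(real \<Rightarrow> 'a::real_normed_vector) \<Rightarrow> bool" where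
  "smooth f \<longleftrightarrow> (\<forall>k. C_k_on k f UNIV)"

definition schwartz :: "(real \<Rightarrow> complex) \<Rightarrow> bool" where
  "schwartz f \<longleftrightarrow>
     smooth f \<and> (\<forall>j k. \<exists>B. \<forall>x. \<bar>x\<bar> ^ k * cmod (nth_deriv j f x) \<le> B)"

definition test_function :: "(real \<Rightarrow> complex) \<Rightarrow> bool" where
  "test_function \<phi> \<longleftrightarrow> smooth \<phi> \<and> (\<exists>R. \<forall>x. \<bar>x\<bar> > R \<longrightarrow> \<phi> x = 0)"

definition japanese_bracket :: "real \<Rightarrow> real" where
  "japanese_bracket x = sqrt (1 + x\<^sup>2)"

definition admissible_potential :: "real \<Rightarrow> (real \<Rightarrow> real) \<Rightarrow> bool" where
  "admissible_potential p W \<longleftrightarrow>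
     smooth W \<and>
     (\<forall>j. \<exists>B>0. \<forall>x. \<bar>nth_deriv j W x\<bar> \<le> B * japanese_bracket x powr (- p - real j))"

section \<open>Function spaces\<close>

text \<open>
  Elements of the Lebesgue and Sobolev spaces are represented by Borel functions; statements
  about the classes are therefore up to null sets. The real-valued norms are meaningful only
  for members of the space, so membership is always required separately.
\<close>

definition in_L2 :: "(real \<Rightarrow> complex) \<Rightarrow> bool" where
  "in_L2 f \<longleftrightarrow> f \<in> borel_measurable lborel \<and> integrable lborel (\<lambda>x. (cmod (f x))\<^sup>2)"

definition L2_norm :: "(real \<Rightarrow> complex) \<Rightarrow> real" where
  "L2_norm f = sqrt (LINT x|lborel. (cmod (f x))\<^sup>2)"

definition in_Linf :: "(real \<Rightarrow> complex) \<Rightarrow> bool" where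
  "in_Linf f \<longleftrightarrow> f \<in> borel_measurable lborel \<and> (\<exists>B. AE x in lborel. cmod (f x) \<le> B)"

definition Linf_norm :: "(real \<Rightarrow> complex) \<Rightarrow> real" where
  "Linf_norm f = Inf {B. 0 \<le> B \<and> (AE x in lborel. cmod (f x) \<le> B)}"

definition in_C0 :: "(real \<Rightarrow> complex) \<Rightarrow> bool" where
  "in_C0 f \<longleftrightarrow> continuous_on UNIV f \<and> (f \<longlongrightarrow> 0) at_infinity"

definition is_weak_deriv :: "(real \<Rightarrow> complex) \<Rightarrow> (real \<Rightarrow> complex) \<Rightarrow> bool" where
  "is_weak_deriv f g \<longleftrightarrow>
     (\<forall>\<phi>. test_function \<phi> \<longrightarrow>
        (LINT x|lborel. f x * nth_deriv 1 \<phi> x) = - (LINT x|lborel. g x * \<phi> x))"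

definition in_H1 :: "(real \<Rightarrow> complex) \<Rightarrow> bool" where
  "in_H1 f \<longleftrightarrow> in_L2 f \<and> (\<exists>g. in_L2 g \<and> is_weak_deriv f g)"

definition weak_deriv :: "(real \<Rightarrow> complex) \<Rightarrow> real \<Rightarrow> complex" where
  "weak_deriv f = (SOME g. in_L2 g \<and> is_weak_deriv f g)"

definition H1_norm :: "(real \<Rightarrow> complex) \<Rightarrow> real" where
  "H1_norm f = sqrt ((L2_norm f)\<^sup>2 + (L2_norm (weak_deriv f))\<^sup>2)"

definition in_Sigma :: "(real \<Rightarrow> complex) \<Rightarrow> bool" where
  "in_Sigma f \<longleftrightarrow> in_H1 f \<and> in_L2 (\<lambda>x. of_real x * f x)"

definition Sigma_norm :: "(real \<Rightarrow> complex) \<Rightarrow> real" where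
  "Sigma_norm f = H1_norm f + L2_norm (\<lambda>x. of_real x * f x)"

definition fourier :: "(real \<Rightarrow> complex) \<Rightarrow> real \<Rightarrow> complex" where
  "fourier f \<zeta> = (LINT y|lborel. exp (- (\<i> * of_real (\<zeta> * y))) * f y)"

text \<open>
  The Fourier transform on \<open>L\<^sup>2\<close>, as the \<open>L\<^sup>2\<close> limit of the transforms of truncations.
\<close>

definition is_L2_fourier :: "(real \<Rightarrow> complex) \<Rightarrow> (real \<Rightarrow> complex) \<Rightarrow> bool" where
  "is_L2_fourier f F \<longleftrightarrow>
     in_L2 f \<and> in_L2 F \<and>
     ((\<lambda>R. L2_norm (\<lambda>\<zeta>. F \<zeta> - fourier (\<lambda>y. if \<bar>y\<bar> \<le> R then f y else 0) \<zeta>)) \<longlongrightarrow> 0) at_top"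

text \<open>Membership of an \<open>L\<^sup>2\<close> function in the Sobolev space of real order \<open>s\<close>.\<close>

definition in_Hs :: "real \<Rightarrow> (real \<Rightarrow> complex) \<Rightarrow> bool" where
  "in_Hs s f \<longleftrightarrow>
     (\<exists>F. is_L2_fourier f F \<and> in_L2 (\<lambda>\<zeta>. of_real (japanese_bracket \<zeta> powr s) * F \<zeta>))"

text \<open>
  Elements of \<open>H\<^sup>-\<^sup>1\<close> are represented by their Fourier transforms: \<open>F\<close> represents an element iff
  \<open>\<zeta> \<mapsto> F \<zeta> / \<langle>\<zeta>\<rangle>\<close> is in \<open>L\<^sup>2\<close>, whose norm is the \<open>H\<^sup>-\<^sup>1\<close> norm up to a constant factor.
\<close>

definition in_Hm1_hat :: "(real \<Rightarrow> complex) \<Rightarrow> bool" where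
  "in_Hm1_hat F \<longleftrightarrow> in_L2 (\<lambda>\<zeta>. F \<zeta> / of_real (japanese_bracket \<zeta>))"

definition Hm1_hat_norm :: "(real \<Rightarrow> complex) \<Rightarrow> real" where
  "Hm1_hat_norm F = L2_norm (\<lambda>\<zeta>. F \<zeta> / of_real (japanese_bracket \<zeta>))"

definition C_Sigma :: "(real \<Rightarrow> real \<Rightarrow> complex) \<Rightarrow> bool" where
  "C_Sigma u \<longleftrightarrow>
     (\<forall>t\<ge>1. in_Sigma (u t)) \<and>
     (\<forall>t\<ge>1. ((\<lambda>s. Sigma_norm (\<lambda>y. u s y - u t y)) \<longlongrightarrow> 0) (at t within {1..}))"

text \<open>
  \<open>V t\<close> is the Fourier transform of the time derivative at time \<open>t\<close>. The transform of \<open>u t\<close>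
  is an absolutely convergent integral since \<open>u t\<close> is in \<open>\<Sigma>\<close>, which is contained in \<open>L\<^sup>1\<close>.
\<close>

definition C1_Hm1 :: "(real \<Rightarrow> real \<Rightarrow> complex) \<Rightarrow> bool" where
  "C1_Hm1 u \<longleftrightarrow>
     (\<forall>t\<ge>1. in_Hm1_hat (fourier (u t))) \<and>
     (\<exists>V. (\<forall>t\<ge>1. in_Hm1_hat (V t)) \<and>
        (\<forall>t\<ge>1. ((\<lambda>s. Hm1_hat_norm
            (\<lambda>\<zeta>. (fourier (u s) \<zeta> - fourier (u t) \<zeta>) / of_real (s - t) - V t \<zeta>))
            \<longlongrightarrow> 0) (at t within {1..})) \<and>
        (\<forall>t\<ge>1. ((\<lambda>s. Hm1_hat_norm (\<lambda>\<zeta>. V s \<zeta> - V t \<zeta>)) \<longlongrightarrow> 0) (at t within {1..})))"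

section \<open>The equation, its small-data solutions and their profiles\<close>

definition nonlinearity ::
  "real \<Rightarrow> real \<Rightarrow> (real \<Rightarrow> real) \<Rightarrow> (real \<Rightarrow> real \<Rightarrow> complex) \<Rightarrow> real \<Rightarrow> real \<Rightarrow> complex" where
  "nonlinearity \<beta> \<gamma> W u t y =
     of_real (\<beta> * (cmod (u t y))\<^sup>2) * u t y -
     of_real (W (y + \<gamma> * t) * (cmod (u t y)) ^ 4) * u t y"

text \<open>
  Duhamel's formula from time \<open>1\<close> for \<open>\<i> u\<^sub>t + u\<^sub>y\<^sub>y = N\<close>, read on the Fourier side, where the free
  Schroedinger group is multiplication by \<open>exp (- \<i> t \<zeta>\<^sup>2)\<close>. For \<open>u\<close> continuous into \<open>\<Sigma>\<close> all
  transforms are absolutely convergent and both sides are continuous in \<open>\<zeta>\<close>, so that requiring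
  the identity for every \<open>\<zeta>\<close> agrees with requiring it in \<open>L\<^sup>2\<close>.
\<close>

definition mild_solution ::
  "real \<Rightarrow> real \<Rightarrow> (real \<Rightarrow> real) \<Rightarrow> (real \<Rightarrow> real \<Rightarrow> complex) \<Rightarrow> bool" where
  "mild_solution \<beta> \<gamma> W u \<longleftrightarrow>
     (\<forall>t\<ge>1. \<forall>\<zeta>.
        fourier (u t) \<zeta> =
          exp (- (\<i> * of_real ((t - 1) * \<zeta>\<^sup>2))) * fourier (u 1) \<zeta> -
          \<i> * (LINT s:{1..t}|lborel.
                 exp (- (\<i> * of_real ((t - s) * \<zeta>\<^sup>2))) * fourier (nonlinearity \<beta> \<gamma> W u s) \<zeta>))"

definition global_solution ::
  "real \<Rightarrow> real \<Rightarrow> (real \<Rightarrow> real) \<Rightarrow> (real \<Rightarrow> real \<Rightarrow> complex) \<Rightarrow> bool" where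
  "global_solution \<beta> \<gamma> W u \<longleftrightarrow> C_Sigma u \<and> C1_Hm1 u \<and> mild_solution \<beta> \<gamma> W u"

definition small_data_bounds ::
  "real \<Rightarrow> real \<Rightarrow> real \<Rightarrow> (real \<Rightarrow> real \<Rightarrow> complex) \<Rightarrow> bool" where
  "small_data_bounds C \<epsilon> \<delta> u \<longleftrightarrow>
     (\<forall>t\<ge>1.
        in_Linf (u t) \<and> Linf_norm (u t) \<le> C * \<epsilon> * t powr (-1/2) \<and>
        in_H1 (u t) \<and>
        in_L2 (\<lambda>y. of_real y * u t y + 2 * \<i> * of_real t * weak_deriv (u t) y) \<and>
        H1_norm (u t) + L2_norm (\<lambda>y. of_real y * u t y + 2 * \<i> * of_real t * weak_deriv (u t) y)
          \<le> C * \<epsilon> * t powr \<delta>)"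

definition asymptotic_ansatz ::
  "real \<Rightarrow> (real \<Rightarrow> complex) \<Rightarrow> real \<Rightarrow> real \<Rightarrow> complex" where
  "asymptotic_ansatz \<beta> A t y =
     of_real (t powr (-1/2)) * exp (\<i> * of_real (y\<^sup>2 / (4 * t))) * A (y / t) *
     exp (- (\<i> * of_real (\<beta> * (cmod (A (y / t)))\<^sup>2 * ln t)))"

definition modified_scattering_profile ::
  "real \<Rightarrow> real \<Rightarrow> real \<Rightarrow> real \<Rightarrow> (real \<Rightarrow> real \<Rightarrow> complex) \<Rightarrow> (real \<Rightarrow> complex) \<Rightarrow> bool" where
  "modified_scattering_profile \<beta> C \<epsilon> \<delta> u A \<longleftrightarrow>
     in_L2 A \<and> in_Linf A \<and> L2_norm A + Linf_norm A \<le> C * \<epsilon> \<and>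
     (\<forall>t\<ge>1.
        in_L2 (\<lambda>y. u t y - asymptotic_ansatz \<beta> A t y) \<and>
        L2_norm (\<lambda>y. u t y - asymptotic_ansatz \<beta> A t y) \<le> C * \<epsilon> * t powr (-1/2 + 2 * \<delta>) \<and>
        in_Linf (\<lambda>y. u t y - asymptotic_ansatz \<beta> A t y) \<and>
        Linf_norm (\<lambda>y. u t y - asymptotic_ansatz \<beta> A t y) \<le> C * \<epsilon> * t powr (-3/4 + 2 * \<delta>))"

text \<open>
  \<open>\<epsilon>0\<close>, \<open>C\<delta>\<close>, \<open>C\<close> are admissible constants in the small-data theory for \<open>\<beta>\<close> and \<open>W\<close>: below the
  threshold \<open>\<epsilon>0\<close>, uniformly in the velocity \<open>\<gamma>\<close>, there is a unique global solution, it obeys the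
  bounds with these constants, and it has a unique modified scattering profile.
\<close>

definition small_data_constants ::
  "real \<Rightarrow> (real \<Rightarrow> real) \<Rightarrow> real \<Rightarrow> real \<Rightarrow> real \<Rightarrow> bool" where
  "small_data_constants \<beta> W \<epsilon>0 C\<delta> C \<longleftrightarrow>
     \<epsilon>0 > 0 \<and> C\<delta> > 0 \<and> C > 0 \<and>
     (\<forall>\<gamma> \<epsilon> u1. in_Sigma u1 \<and> Sigma_norm u1 \<le> \<epsilon> \<and> \<epsilon> \<le> \<epsilon>0 \<longrightarrow>
        (let \<delta> = C\<delta> * \<bar>\<beta>\<bar> * \<epsilon>\<^sup>2 in
           \<delta> < 1/16 \<and>
           (\<exists>u. global_solution \<beta> \<gamma> W u \<and> (AE y in lborel. u 1 y = u1 y) \<and>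
              (\<forall>v. global_solution \<beta> \<gamma> W v \<and> (AE y in lborel. v 1 y = u1 y) \<longrightarrow>
                 (\<forall>t\<ge>1. AE y in lborel. v t y = u t y)) \<and>
              small_data_bounds C \<epsilon> \<delta> u \<and>
              (\<exists>A. modified_scattering_profile \<beta> C \<epsilon> \<delta> u A \<and>
                 (\<forall>B. modified_scattering_profile \<beta> C \<epsilon> \<delta> u B \<longrightarrow>
                    (AE x in lborel. B x = A x)) \<and>
                 (\<forall>\<sigma>. \<sigma> < 1 - 2 * \<delta> \<longrightarrow> in_Hs \<sigma> A)))))"

definition renormalized_profile ::
  "real \<Rightarrow> (real \<Rightarrow> real \<Rightarrow> complex) \<Rightarrow> real \<Rightarrow> real \<Rightarrow> complex" where
  "renormalized_profile \<beta> u t \<zeta> =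
     exp (\<i> * of_real (t * \<zeta>\<^sup>2)) * fourier (u t) \<zeta> +
     \<i> * of_real \<beta> *
       (LINT s:{1..t}|lborel. exp (\<i> * of_real (s * \<zeta>\<^sup>2)) *
          fourier (\<lambda>y. of_real ((cmod (u s y))\<^sup>2) * u s y) \<zeta>)"

definition renormalized_profile_limit ::
  "real \<Rightarrow> (real \<Rightarrow> real \<Rightarrow> complex) \<Rightarrow> (real \<Rightarrow> complex) \<Rightarrow> bool" where
  "renormalized_profile_limit \<beta> u P \<longleftrightarrow>
     in_L2 P \<and> in_C0 P \<and>
     (\<forall>t\<ge>1. in_L2 (renormalized_profile \<beta> u t)) \<and>
     ((\<lambda>t. L2_norm (\<lambda>\<zeta>. renormalized_profile \<beta> u t \<zeta> - P \<zeta>)) \<longlongrightarrow> 0) at_top \<and>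
     uniform_limit UNIV (renormalized_profile \<beta> u) P at_top"

text \<open>The integrand is \<open>O(\<sigma> powr (-1/2))\<close> at \<open>0\<close> and \<open>O(\<sigma> powr (-3/2))\<close> at infinity.\<close>

definition C_res :: "real \<Rightarrow> complex" where
  "C_res \<alpha> =
     (LINT \<sigma>:{0<..}|lborel.
        complex_of_real \<sigma> powr (- 5/2 - \<i> * of_real \<alpha>) *
        (exp (\<i> * of_real \<sigma>) - 1 - \<i> * of_real \<sigma>))"

end

theory Submission
  imports Defs "HOL-Probability.Characteristic_Functions" "HOL-Real_Asymp.Real_Asymp"
    "HOL-Complex_Analysis.Cauchy_Integral_Theorem"
begin

text \<open>
Why the limit profile has exactly this singularity.

Subtracting the cubic term from Duhamel's formula on the Fourier side leaves
\<open>P(\<zeta>) = exp(\<i> \<zeta>\<^sup>2) F[u(1)](\<zeta>) + \<i> \<integral> exp(\<i> s \<zeta>\<^sup>2) F[W(y + \<gamma> s) |u|\<^sup>4 u](\<zeta>) ds\<close> with \<open>s\<close> running over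
\<open>[1, \<infinity>)\<close>. In the frame \<open>x = y + \<gamma> s\<close> of the potential and at the frequency \<open>\<zeta> = - \<gamma> / 2 + r\<close> the
phases of a Galilei transformation combine to \<open>exp(\<i> s r\<^sup>2) exp(- \<i> r x)\<close> (\<open>galilei\<close>), so that the only
oscillation in \<open>s\<close> has frequency \<open>r\<^sup>2\<close>: the velocity of the potential is resonant exactly at \<open>r = 0\<close>.
Since \<open>u\<close> has size \<open>s powr (-1/2)\<close>, the pairing of \<open>|u|\<^sup>4 u\<close> with a fixed observable has size
\<open>s powr (-5/2)\<close>.

The decay exponent \<open>p > 4\<close> gives \<open>W\<close> three absolute moments, hence \<open>exp(- \<i> r x)\<close> may be replaced by its
cubic Taylor polynomial with an error \<open>o(r\<^sup>3)\<close>. What remains are the integrals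
\<open>r\<^sup>k \<integral> exp(\<i> s r\<^sup>2) G\<^sub>k(s) ds\<close> with \<open>G\<^sub>k(s) = O(s powr (-5/2))\<close>. Up to \<open>o(r\<^sup>2)\<close> such an integral is
\<open>\<integral> G\<^sub>k + \<i> r\<^sup>2 \<integral> s G\<^sub>k\<close>, which settles \<open>k \<ge> 1\<close> (\<open>cubic_peano_power_osc\<close>). For \<open>k = 0\<close> one needs
the next order, where \<open>s\<^sup>2 G\<^sub>0\<close> need not be integrable. The modified scattering asymptotics give
\<open>G\<^sub>0(s) = s powr (-5/2) (g\<^sub>0 exp(- \<i> \<alpha> ln s) + o(1))\<close> with \<open>g\<^sub>0 = M\<^sub>0 |A\<^sub>0|\<^sup>4 A\<^sub>0\<close>
(\<open>leading_amplitude\<close>), and the substitution \<open>\<sigma> = s r\<^sup>2\<close> turns the remainder into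
\<open>g\<^sub>0 C_res \<alpha> |r| powr (3 + 2 \<i> \<alpha>) + o(r\<^sup>3)\<close> (\<open>osc_rem_asymp\<close>).

The phase of the modified asymptotics contains \<open>|A|\<^sup>2 ln s\<close>, so continuity of \<open>A\<close> at \<open>- \<gamma>\<close> would not be
enough to freeze it there; a Hoelder modulus is. It comes from the membership of \<open>A\<close> in a Sobolev space of
order \<open>7/8\<close> by Fourier inversion (\<open>Sobolev_holder\<close>).

The singularity is genuine. Rotating the ray of integration in \<open>C_res \<alpha>\<close> to the positive axis makes it a
nonzero multiple of \<open>Gamma (1/2 - \<i> \<alpha>)\<close> (\<open>C_res_nonzero\<close>). Adding the expansions at \<open>r\<close> and \<open>- r\<close>
eliminates odd powers, and no even polynomial differs from a nonzero multiple of
\<open>|r| powr (3 + 2 \<i> \<alpha>)\<close> by \<open>o(r\<^sup>3)\<close> (\<open>polynomial_not_resonant\<close>); this argument covers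
\<open>\<alpha> = 0\<close> as well. A function of class \<open>C\<^sup>3\<close> has a cubic Taylor polynomial (\<open>C3_Taylor\<close>).
\<close>

section \<open>Integrable weights and dominated convergence\<close>

lemma integrable_powr_near_0:
  assumes "a > -1"
  shows "integrable lborel (\<lambda>x::real. indicator {0<..1} x * x powr a)"
proof -
  have "(\<lambda>x::real. x powr a) absolutely_integrable_on {0<..1}"
    by (rule nonnegative_absolutely_integrable_1)
       (use assms integrable_on_powr_from_0'[of a 1] in auto)
  hence "integrable lebesgue (\<lambda>x::real. indicator {0<..1} x * x powr a)"
    by (simp add: set_integrable_def)
  thus ?thesis
    by (subst (asm) integrable_completion) auto
qed

lemma integrable_powr_at_top:
  assumes "a < -1" "c > 0"
  shows "integrable lborel (\<lambda>x::real. indicator {c..} x * x powr a)"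
proof -
  have "(\<lambda>x::real. x powr a) absolutely_integrable_on {c..}"
    by (rule nonnegative_absolutely_integrable_1)
       (use has_integral_powr_to_inf[OF assms] in \<open>auto simp: integrable_on_def\<close>)
  hence "integrable lebesgue (\<lambda>x::real. indicator {c..} x * x powr a)"
    by (simp add: set_integrable_def)
  thus ?thesis
    by (subst (asm) integrable_completion) auto
qed

lemma japanese_bracket_ge: "japanese_bracket x \<ge> 1" "japanese_bracket x \<ge> \<bar>x\<bar>"
proof -
  show "japanese_bracket x \<ge> 1" unfolding japanese_bracket_def by simp
  have "sqrt (x\<^sup>2) \<le> sqrt (1 + x\<^sup>2)" by (intro real_sqrt_le_mono) simp
  thus "japanese_bracket x \<ge> \<bar>x\<bar>" by (simp add: japanese_bracket_def)
qed

lemma japanese_bracket_measurable [measurable]: "japanese_bracket \<in> borel_measurable borel"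
  unfolding japanese_bracket_def by measurable

lemma integrable_japanese_bracket_powr:
  assumes "a < -1"
  shows "integrable lborel (\<lambda>x. japanese_bracket x powr a)"
proof (rule Bochner_Integration.integrable_bound)
  have 1: "integrable lborel (\<lambda>x::real. indicator {1..} x * x powr a)"
    using assms by (intro integrable_powr_at_top) auto
  have 2: "integrable lborel (\<lambda>x::real. indicator {1..} (-x) * (-x) powr a)"
    using lborel_integrable_real_affine[OF 1, of "-1" 0] by simp
  show "integrable lborel (\<lambda>x::real. indicator {-1..1} x + (indicator {1..} x * x powr a + indicator {1..} (-x) * (-x) powr a))"
    by (intro Bochner_Integration.integrable_add 1 2 integrable_real_indicator) (auto simp: emeasure_lborel_Icc_eq)
  show "AE x in lborel. norm (japanese_bracket x powr a)
      \<le> norm (indicator {-1..1} x + (indicator {1..} x * x powr a + indicator {1..} (-x) * (-x) powr a))"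
  proof (rule AE_I2)
    fix x :: real
    have b: "japanese_bracket x powr a \<le> 1"
      using japanese_bracket_ge(1)[of x] assms powr_mono2'[of a 1 "japanese_bracket x"] by simp
    have c: "japanese_bracket x powr a \<le> \<bar>x\<bar> powr a" if "x \<noteq> 0"
      using japanese_bracket_ge(2)[of x] assms that by (intro powr_mono2') auto
    show "norm (japanese_bracket x powr a)
      \<le> norm (indicator {-1..1} x + (indicator {1..} x * x powr a + indicator {1..} (-x) * (-x) powr a))"
    proof (cases "\<bar>x\<bar> \<le> 1")
      case True
      have "1 \<le> (indicator {-1..1} x :: real) + (indicator {1..} x * x powr a + indicator {1..} (-x) * (-x) powr a)"
        using True by (auto simp: indicator_def)
      thus ?thesis using b by simp
    next
      case False
      have "\<bar>x\<bar> powr a \<le> (indicator {-1..1} x :: real) + (indicator {1..} x * x powr a + indicator {1..} (-x) * (-x) powr a)"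
        using False by (auto simp: indicator_def abs_if)
      moreover have "x \<noteq> 0" using False by auto
      ultimately show ?thesis using c by simp
    qed
  qed
qed measurable

lemma dominated_convergence_at:
  fixes f :: "real \<Rightarrow> 'a \<Rightarrow> 'b::{banach,second_countable_topology}"
  assumes f: "\<And>r. f r \<in> borel_measurable M" and g: "g \<in> borel_measurable M"
    and w: "integrable M w"
    and lim: "AE x in M. ((\<lambda>r. f r x) \<longlongrightarrow> g x) (at a)"
    and bd: "\<And>r. r \<noteq> a \<Longrightarrow> AE x in M. norm (f r x) \<le> w x"
  shows "((\<lambda>r. integral\<^sup>L M (f r)) \<longlongrightarrow> integral\<^sup>L M g) (at a)"
  unfolding tendsto_at_iff_sequentially
proof (intro allI impI)
  fix X :: "nat \<Rightarrow> real" assume X: "\<forall>i. X i \<in> UNIV - {a}" "X \<longlonglongrightarrow> a"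
  have "(\<lambda>i. integral\<^sup>L M (f (X i))) \<longlonglongrightarrow> integral\<^sup>L M g"
  proof (rule integral_dominated_convergence)
    show "AE x in M. (\<lambda>i. f (X i) x) \<longlonglongrightarrow> g x"
      using lim
    proof eventually_elim
      case (elim x)
      with X show ?case
        unfolding tendsto_at_iff_sequentially by (auto simp: o_def)
    qed
    show "AE x in M. norm (f (X i) x) \<le> w x" for i using bd X by auto
  qed (use f g w in auto)
  thus "((\<lambda>r. integral\<^sup>L M (f r)) \<circ> X) \<longlonglongrightarrow> integral\<^sup>L M g" by (simp add: o_def)
qed

section \<open>Cubic Peano expansions\<close>

abbreviation o_cube :: "(real \<Rightarrow> complex) set" where
  "o_cube \<equiv> o[at 0](\<lambda>r. of_real (\<bar>r\<bar> ^ 3))"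

abbreviation resonant :: "real \<Rightarrow> real \<Rightarrow> complex" where
  "resonant \<alpha> r \<equiv> complex_of_real \<bar>r\<bar> powr (3 + 2 * \<i> * of_real \<alpha>)"

text \<open>
The degree of the polynomial is left free, which makes the notion closed under products; terms of degree above
three are negligible anyway.
\<close>

definition cubic_peano :: "(real \<Rightarrow> complex) \<Rightarrow> bool" where
  "cubic_peano f \<longleftrightarrow>
     (\<exists>q :: complex poly. (\<lambda>r. f r - poly q (of_real r)) \<in> o_cube)"

lemma smallo_cube_iff:
  fixes f :: "real \<Rightarrow> complex"
  shows "f \<in> o_cube \<longleftrightarrow> ((\<lambda>r. f r / of_real (\<bar>r\<bar> ^ 3)) \<longlongrightarrow> 0) (at 0)"
proof
  assume "f \<in> o_cube"
  thus "((\<lambda>r. f r / of_real (\<bar>r\<bar> ^ 3)) \<longlongrightarrow> 0) (at 0)" by (rule smalloD_tendsto)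
next
  assume "((\<lambda>r. f r / of_real (\<bar>r\<bar> ^ 3)) \<longlongrightarrow> 0) (at 0)"
  thus "f \<in> o_cube"
    by (rule smalloI_tendsto) (auto simp: eventually_at_filter)
qed

lemma bounded_poly_at_0:
  fixes q :: "complex poly"
  shows "(\<lambda>r. poly q (complex_of_real r)) \<in> O[at 0](\<lambda>_. 1)"
proof (rule bigoI_tendsto)
  show "((\<lambda>r. poly q (complex_of_real r) / 1) \<longlongrightarrow> poly q 0) (at 0)"
    by (auto intro!: tendsto_eq_intros)
qed auto

text \<open>
Monomials of degree four and more are \<open>o(r\<^sup>3)\<close>, so that the polynomial of an expansion can be truncated.
\<close>

lemma poly_mod_cube:
  fixes q :: "complex poly"
  shows "\<exists>b::nat\<Rightarrow>complex. (\<lambda>r. poly q (of_real r) - (\<Sum>j\<le>3. b j * of_real r ^ j))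
            \<in> o_cube"
proof -
  obtain a0 a1 a2 a3 s where q: "q = pCons a0 (pCons a1 (pCons a2 (pCons a3 s)))"
    by (metis pCons_cases)
  define b where "b = (\<lambda>j::nat. [a0,a1,a2,a3] ! j)"
  have S: "{..3::nat} = {0,1,2,3}" by auto
  have eq: "poly q (of_real r) - (\<Sum>j\<le>3. b j * of_real r ^ j) = of_real r ^ 4 * poly s (of_real r)"
    for r :: real
    unfolding q b_def S by (simp add: algebra_simps power_numeral_reduce eval_nat_numeral)
  have "((\<lambda>r. complex_of_real r ^ 4 / of_real (\<bar>r\<bar> ^ 3)) \<longlongrightarrow> 0) (at 0)"
  proof (rule tendsto_norm_zero_cancel, rule Lim_transform_eventually)
    show "((\<lambda>r::real. \<bar>r\<bar>) \<longlongrightarrow> 0) (at 0)" by (auto intro!: tendsto_eq_intros)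
    show "\<forall>\<^sub>F r::real in at 0. \<bar>r\<bar> = norm (complex_of_real r ^ 4 / of_real (\<bar>r\<bar> ^ 3))"
      unfolding eventually_at_filter norm_divide norm_power norm_of_real
      by (intro always_eventually) (auto simp: eval_nat_numeral)
  qed
  hence "(\<lambda>r. complex_of_real r ^ 4) \<in> o_cube"
    by (simp only: smallo_cube_iff)
  from landau_o.small_big_mult[OF this bounded_poly_at_0[of s]]
  have "(\<lambda>r. poly q (of_real r) - (\<Sum>j\<le>3. b j * of_real r ^ j)) \<in> o_cube"
    by (simp add: eq)
  thus ?thesis by blast
qed

lemma cubic_peano_add:
  assumes "cubic_peano f" "cubic_peano g"
  shows "cubic_peano (\<lambda>r. f r + g r)"
proof -
  obtain p q where "(\<lambda>r. f r - poly p (of_real r)) \<in> o_cube"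
    and "(\<lambda>r. g r - poly q (of_real r)) \<in> o_cube"
    using assms by (auto simp: cubic_peano_def)
  from sum_in_smallo(1)[OF this] show ?thesis
    unfolding cubic_peano_def by (intro exI[of _ "p + q"]) (simp add: algebra_simps)
qed

lemma cubic_peano_mult:
  assumes "cubic_peano f" "cubic_peano g"
  shows "cubic_peano (\<lambda>r. f r * g r)"
proof -
  obtain p q where p: "(\<lambda>r. f r - poly p (of_real r)) \<in> o_cube"
    and q: "(\<lambda>r. g r - poly q (of_real r)) \<in> o_cube"
    using assms by (auto simp: cubic_peano_def)
  have "(\<lambda>r. complex_of_real (\<bar>r\<bar> ^ 3)) \<in> O[at 0](\<lambda>_. 1)"
    by (rule bigoI_tendsto[where c = 0]) (auto intro!: tendsto_eq_intros)
  hence "(\<lambda>r. g r - poly q (of_real r)) \<in> O[at 0](\<lambda>_. 1)"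
    using q by (rule landau_o.big_trans[rotated, OF _ landau_o.small_imp_big])
  from sum_in_bigo(1)[OF this bounded_poly_at_0[of q]] have "g \<in> O[at 0](\<lambda>_. 1)" by simp
  from landau_o.small_big_mult[OF p this]
    landau_o.small_big_mult[OF q bounded_poly_at_0[of p]]
  have "(\<lambda>r. (f r - poly p (of_real r)) * g r + (g r - poly q (of_real r)) * poly p (of_real r))
          \<in> o_cube"
    by (intro sum_in_smallo(1)) simp_all
  thus ?thesis
    unfolding cubic_peano_def by (intro exI[of _ "p * q"]) (simp add: algebra_simps)
qed

lemma cubic_peano_poly:
  assumes "\<And>r. f r = poly q (of_real r)"
  shows "cubic_peano f"
  unfolding cubic_peano_def by (rule exI[of _ q]) (simp add: assms)

lemma cubic_peano_const: "cubic_peano (\<lambda>_. c)"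
  by (rule cubic_peano_poly[of _ "[:c:]"]) simp

lemma cubic_peano_sum:
  assumes "\<And>k. k \<in> S \<Longrightarrow> cubic_peano (f k)"
  shows "cubic_peano (\<lambda>r. \<Sum>k\<in>S. f k r)"
  using assms
  by (induction S rule: infinite_finite_induct) (auto intro: cubic_peano_const cubic_peano_add)

lemma cubic_peano_transfer:
  assumes "cubic_peano g" "((\<lambda>r. (f r - g r) / of_real (\<bar>r\<bar> ^ 3)) \<longlongrightarrow> 0) (at 0)"
  shows "cubic_peano f"
proof -
  obtain q where "(\<lambda>r. g r - poly q (of_real r)) \<in> o_cube"
    using assms by (auto simp: cubic_peano_def)
  moreover have "(\<lambda>r. f r - g r) \<in> o_cube"
    using assms(2) by (simp only: smallo_cube_iff)
  ultimately have "(\<lambda>r. (g r - poly q (of_real r)) + (f r - g r)) \<in> o_cube"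
    by (intro sum_in_smallo(1))
  thus ?thesis unfolding cubic_peano_def by (intro exI[of _ q]) simp
qed

definition iexp_rem :: "real \<Rightarrow> complex" where
  "iexp_rem x = iexp x - (\<Sum>k\<le>3. (\<i> * of_real x) ^ k / fact k)"

lemma iexp_rem_bound1: "cmod (iexp_rem x) \<le> \<bar>x\<bar> ^ 4"
proof -
  have "cmod (iexp_rem x) \<le> \<bar>x\<bar> ^ 4 / 24"
    using iexp_approx1[of x 3] by (simp add: iexp_rem_def fact_numeral)
  also have "\<dots> \<le> \<bar>x\<bar> ^ 4 / 1" by (intro divide_left_mono) auto
  finally show ?thesis by simp
qed

lemma iexp_rem_bound2: "cmod (iexp_rem x) \<le> \<bar>x\<bar> ^ 3"
proof -
  have "cmod (iexp_rem x) \<le> \<bar>x\<bar> ^ 3 / 3"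
    using iexp_approx2[of x 3] by (simp add: iexp_rem_def fact_numeral)
  also have "\<dots> \<le> \<bar>x\<bar> ^ 3 / 1" by (intro divide_left_mono) auto
  finally show ?thesis by simp
qed

lemma continuous_iexp_rem [continuous_intros]:
  assumes "continuous_on S f"
  shows "continuous_on S (\<lambda>x. iexp_rem (f x))"
  unfolding iexp_rem_def using assms by (intro continuous_intros) auto

lemma borel_measurable_iexp_rem [measurable]: "iexp_rem \<in> borel_measurable borel"
  by (intro borel_measurable_continuous_onI continuous_intros)

lemma iexp_expand:
  "iexp (- (r * x)) = iexp_rem (- (r * x)) + (\<Sum>k\<le>3. of_real r ^ k * ((- (\<i> * of_real x)) ^ k / fact k))"
proof -
  have "(\<i> * of_real (- (r * x))) ^ k / fact k = of_real r ^ k * ((- (\<i> * of_real x)) ^ k / fact k)"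
    for k :: nat
  proof -
    have "\<i> * of_real (- (r * x)) = of_real r * (- (\<i> * of_real x))" by simp
    thus ?thesis by (simp only: power_mult_distrib times_divide_eq_right)
  qed
  thus ?thesis by (simp add: iexp_rem_def)
qed

text \<open>
The remainder is bounded both by \<open>|r x|\<^sup>3\<close> and by \<open>|r x|\<^sup>4\<close>. After division by \<open>|r|\<^sup>3\<close> the first bound
is an integrable majorant and the second one gives pointwise convergence to \<open>0\<close>; a fourth moment is therefore
avoided.
\<close>

lemma iexp_rem_moment:
  fixes f :: "real \<Rightarrow> real"
  assumes [measurable]: "f \<in> borel_measurable borel"
    and int: "integrable lborel (\<lambda>x. \<bar>x\<bar> ^ 3 * f x)" and nn: "\<And>x. f x \<ge> 0"
  shows "((\<lambda>r. (LINT x|lborel. cmod (iexp_rem (- (r * x))) * f x) / \<bar>r\<bar> ^ 3) \<longlongrightarrow> 0) (at 0)"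
proof -
  have "((\<lambda>r. LINT x|lborel. cmod (iexp_rem (- (r * x))) * f x / \<bar>r\<bar> ^ 3)
          \<longlongrightarrow> (LINT x::real|lborel. (0::real))) (at 0)"
  proof (rule dominated_convergence_at[where w = "\<lambda>x. \<bar>x\<bar> ^ 3 * f x"
        and f = "\<lambda>r x. cmod (iexp_rem (- (r * x))) * f x / \<bar>r\<bar> ^ 3"])
    show "integrable lborel (\<lambda>x. \<bar>x\<bar> ^ 3 * f x)" by fact
    show "AE x in lborel. ((\<lambda>r. cmod (iexp_rem (- (r * x))) * f x / \<bar>r\<bar> ^ 3) \<longlongrightarrow> 0) (at 0)"
    proof (rule AE_I2, rule tendsto_sandwich)
      fix x :: real
      show "\<forall>\<^sub>F r in at 0. 0 \<le> cmod (iexp_rem (- (r * x))) * f x / \<bar>r\<bar> ^ 3"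
        using nn by auto
      show "\<forall>\<^sub>F r in at 0. cmod (iexp_rem (- (r * x))) * f x / \<bar>r\<bar> ^ 3 \<le> \<bar>r\<bar> * (\<bar>x\<bar> ^ 4 * f x)"
      proof (unfold eventually_at_filter, rule always_eventually, intro allI impI)
        fix r :: real assume r: "r \<noteq> 0"
        have "cmod (iexp_rem (- (r * x))) \<le> \<bar>r * x\<bar> ^ 4"
          using iexp_rem_bound1[of "- (r * x)"] by simp
        also have "\<dots> \<le> \<bar>r\<bar> ^ 4 * \<bar>x\<bar> ^ 4"
          by (simp add: abs_mult power_mult_distrib)
        finally have "cmod (iexp_rem (- (r * x))) * f x \<le> \<bar>r\<bar> ^ 4 * \<bar>x\<bar> ^ 4 * f x"
          using nn by (rule mult_right_mono)
        thus "cmod (iexp_rem (- (r * x))) * f x / \<bar>r\<bar> ^ 3 \<le> \<bar>r\<bar> * (\<bar>x\<bar> ^ 4 * f x)"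
          using r by (subst pos_divide_le_eq) (simp_all add: power_Suc eval_nat_numeral mult_ac del: abs_mult_self_eq)
      qed
      show "((\<lambda>r. \<bar>r\<bar> * (\<bar>x\<bar> ^ 4 * f x)) \<longlongrightarrow> 0) (at 0)"
        by (auto intro!: tendsto_eq_intros)
    qed auto
    show "AE x in lborel. norm (cmod (iexp_rem (- (r * x))) * f x / \<bar>r\<bar> ^ 3) \<le> \<bar>x\<bar> ^ 3 * f x"
      if r: "r \<noteq> 0" for r
    proof (rule AE_I2)
      fix x :: real
      have "cmod (iexp_rem (- (r * x))) \<le> \<bar>r * x\<bar> ^ 3"
        using iexp_rem_bound2[of "- (r * x)"] by simp
      also have "\<dots> \<le> \<bar>r\<bar> ^ 3 * \<bar>x\<bar> ^ 3"
        by (simp add: abs_mult power_mult_distrib)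
      finally have "cmod (iexp_rem (- (r * x))) * f x \<le> \<bar>r\<bar> ^ 3 * \<bar>x\<bar> ^ 3 * f x"
        using nn by (rule mult_right_mono)
      thus "norm (cmod (iexp_rem (- (r * x))) * f x / \<bar>r\<bar> ^ 3) \<le> \<bar>x\<bar> ^ 3 * f x"
        using r nn[of x] by (simp add: divide_le_eq mult_ac)
    qed
  qed (auto)
  thus ?thesis by simp
qed

text \<open>
Applied to the initial datum, whose moments are finite.
\<close>

lemma cubic_peano_fourier:
  assumes [measurable]: "f \<in> borel_measurable borel"
    and int: "\<And>k. k \<le> 3 \<Longrightarrow> integrable lborel (\<lambda>x. \<bar>x\<bar> ^ k * cmod (f x))"
  shows "cubic_peano (\<lambda>r. LINT x|lborel. iexp (- (r * x)) * f x)"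
proof -
  define m where "m k = (LINT x|lborel. (- (\<i> * of_real x)) ^ k / fact k * f x)" for k :: nat
  have mint: "integrable lborel (\<lambda>x. (- (\<i> * of_real x)) ^ k / fact k * f x)" if "k \<le> 3" for k
    by (rule Bochner_Integration.integrable_bound[OF integrable_divide[OF int[OF that], of "fact k"]])
       (auto simp: norm_mult norm_power norm_divide)
  have rint: "integrable lborel (\<lambda>x. iexp_rem (- (r * x)) * f x)" for r
  proof (rule Bochner_Integration.integrable_bound)
    show "integrable lborel (\<lambda>x. \<bar>r\<bar> ^ 3 * (\<bar>x\<bar> ^ 3 * cmod (f x)))" using int[of 3] by simp
    have "cmod (iexp_rem (- (r * x))) \<le> \<bar>r\<bar> ^ 3 * \<bar>x\<bar> ^ 3" for x
      using iexp_rem_bound2[of "- (r * x)"] by (simp add: abs_mult power_mult_distrib)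
    thus "AE x in lborel. norm (iexp_rem (- (r * x)) * f x) \<le> norm (\<bar>r\<bar> ^ 3 * (\<bar>x\<bar> ^ 3 * cmod (f x)))"
      by (intro AE_I2) (simp add: norm_mult abs_mult mult.assoc[symmetric] mult_right_mono)
  qed simp
  have eq: "(LINT x|lborel. iexp (- (r * x)) * f x) - (\<Sum>k\<le>3. of_real r ^ k * m k)
              = (LINT x|lborel. iexp_rem (- (r * x)) * f x)" for r
  proof -
    have "(LINT x|lborel. iexp (- (r * x)) * f x)
        = (LINT x|lborel. iexp_rem (- (r * x)) * f x +
             (\<Sum>k\<le>3. of_real r ^ k * ((- (\<i> * of_real x)) ^ k / fact k * f x)))"
      by (intro Bochner_Integration.integral_cong refl)
         (simp only: iexp_expand[of r] distrib_right sum_distrib_right mult.assoc)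
    also have "\<dots> = (LINT x|lborel. iexp_rem (- (r * x)) * f x) + (\<Sum>k\<le>3. of_real r ^ k * m k)"
      using mint rint
      by (subst Bochner_Integration.integral_add)
         (auto simp: m_def Bochner_Integration.integral_sum simp del: times_divide_eq_left times_divide_eq_right
            intro!: Bochner_Integration.integrable_sum integrable_mult_right)
    finally show ?thesis by simp
  qed
  show ?thesis
  proof (rule cubic_peano_transfer)
    show "cubic_peano (\<lambda>r. \<Sum>k\<le>3. of_real r ^ k * m k)"
      by (intro cubic_peano_sum, rule_tac q = "monom (m k) k" in cubic_peano_poly) (simp add: poly_monom)
    show "((\<lambda>r. ((LINT x|lborel. iexp (- (r * x)) * f x) - (\<Sum>k\<le>3. of_real r ^ k * m k))
             / of_real (\<bar>r\<bar> ^ 3)) \<longlongrightarrow> 0) (at 0)"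
    proof (rule Lim_null_comparison)
      show "((\<lambda>r. (LINT x|lborel. cmod (iexp_rem (- (r * x))) * cmod (f x)) / \<bar>r\<bar> ^ 3) \<longlongrightarrow> 0) (at 0)"
        using int[of 3] by (intro iexp_rem_moment) auto
      have "cmod (LINT x|lborel. iexp_rem (- (r * x)) * f x)
              \<le> (LINT x|lborel. cmod (iexp_rem (- (r * x))) * cmod (f x))" for r
        using integral_norm_bound[of lborel "\<lambda>x. iexp_rem (- (r * x)) * f x"] by (simp add: norm_mult)
      thus "\<forall>\<^sub>F r in at 0. norm (((LINT x|lborel. iexp (- (r * x)) * f x) - (\<Sum>k\<le>3. of_real r ^ k * m k))
             / of_real (\<bar>r\<bar> ^ 3)) \<le> (LINT x|lborel. cmod (iexp_rem (- (r * x))) * cmod (f x)) / \<bar>r\<bar> ^ 3"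
        by (intro always_eventually allI, unfold eq norm_divide) (simp add: divide_right_mono norm_power)
    qed
  qed
qed

section \<open>Oscillatory integrals with an amplitude of size \<open>s powr (-5/2)\<close>\<close>

definition iexp_rem1 :: "real \<Rightarrow> complex" where
  "iexp_rem1 x = iexp x - 1 - \<i> * of_real x"

lemma iexp_rem1_sq: "cmod (iexp_rem1 x) \<le> x\<^sup>2"
proof -
  have "cmod (iexp_rem1 x) \<le> x\<^sup>2 / 2"
    using iexp_approx1[of x 1] by (simp add: iexp_rem1_def numeral_2_eq_2 diff_diff_eq)
  also have "\<dots> \<le> x\<^sup>2" by simp
  finally show ?thesis .
qed

lemma iexp_rem1_linear: "cmod (iexp_rem1 x) \<le> 2 * \<bar>x\<bar>"
  using iexp_approx2[of x 1] by (simp add: iexp_rem1_def diff_diff_eq)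

lemma borel_measurable_iexp_rem1 [measurable]: "iexp_rem1 \<in> borel_measurable borel"
  unfolding iexp_rem1_def by (intro borel_measurable_continuous_onI continuous_intros)

text \<open>
After the substitution \<open>\<sigma> = s r\<^sup>2\<close> the kernel is \<open>\<sigma> powr (-5/2) (exp(\<i> \<sigma>) - 1 - \<i> \<sigma>)\<close>. Its quadratic
bound near \<open>0\<close> and its linear bound near infinity yield this integrable function of \<open>\<sigma>\<close>, which is independent
of \<open>r\<close>.
\<close>

definition kernel_majorant :: "real \<Rightarrow> real" where
  "kernel_majorant \<sigma> =
     indicator {0<..1} \<sigma> * \<sigma> powr (-1/2) + 2 * (indicator {1..} \<sigma> * \<sigma> powr (-3/2))"

lemma integrable_kernel_majorant: "integrable lborel kernel_majorant"
  unfolding kernel_majorant_def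
  by (intro Bochner_Integration.integrable_add integrable_powr_near_0 integrable_mult_right
        integrable_powr_at_top) auto

lemma kernel_majorant_nonneg: "kernel_majorant \<sigma> \<ge> 0"
  by (auto simp: kernel_majorant_def indicator_def)

lemma kernel_bound:
  assumes "\<sigma> > 0"
  shows "\<sigma> powr (-5/2) * cmod (iexp_rem1 \<sigma>) \<le> kernel_majorant \<sigma>"
proof (cases "\<sigma> \<le> 1")
  case True
  have "\<sigma> powr (-5/2) * cmod (iexp_rem1 \<sigma>) \<le> \<sigma> powr (-5/2) * \<sigma> powr 2"
    using iexp_rem1_sq[of \<sigma>] assms by (intro mult_left_mono) auto
  also have "\<dots> = \<sigma> powr (-1/2)" by (simp add: powr_add[symmetric])
  also have "\<dots> \<le> kernel_majorant \<sigma>"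
    using True assms by (auto simp: kernel_majorant_def indicator_def)
  finally show ?thesis .
next
  case False
  have "\<sigma> powr (-5/2) * cmod (iexp_rem1 \<sigma>) \<le> \<sigma> powr (-5/2) * (2 * \<sigma> powr 1)"
    using iexp_rem1_linear[of \<sigma>] assms by (intro mult_left_mono) auto
  also have "\<dots> = 2 * (\<sigma> powr (-5/2) * \<sigma> powr 1)" by simp
  also have "\<dots> = 2 * \<sigma> powr (-3/2)" by (simp only: powr_add[symmetric]) simp
  also have "\<dots> = kernel_majorant \<sigma>"
    using False by (auto simp: kernel_majorant_def indicator_def)
  finally show ?thesis by simp
qed

lemma C_res_kernel:
  "C_res \<alpha> = (LINT \<sigma>|lborel. indicator {0<..} \<sigma> *\<^sub>R
      (of_real (\<sigma> powr (-5/2)) * iexp_rem1 \<sigma> * iexp (- (\<alpha> * ln \<sigma>))))"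
  unfolding C_res_def set_lebesgue_integral_def
proof (rule Bochner_Integration.integral_cong[OF refl])
  fix \<sigma> :: real
  show "indicator {0<..} \<sigma> *\<^sub>R (complex_of_real \<sigma> powr (- 5/2 - \<i> * of_real \<alpha>) *
          (iexp \<sigma> - 1 - \<i> * of_real \<sigma>)) =
        indicator {0<..} \<sigma> *\<^sub>R (of_real (\<sigma> powr (-5/2)) * iexp_rem1 \<sigma> * iexp (- (\<alpha> * ln \<sigma>)))"
  proof (cases "\<sigma> > 0")
    case True
    have "complex_of_real \<sigma> powr (- 5/2 - \<i> * of_real \<alpha>) =
            exp (of_real ((-5/2) * ln \<sigma>) + \<i> * of_real (- (\<alpha> * ln \<sigma>)))"
    proof -
      have "(- 5/2 - \<i> * of_real \<alpha>) * complex_of_real (ln \<sigma>)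
              = of_real ((-5/2) * ln \<sigma>) + \<i> * of_real (- (\<alpha> * ln \<sigma>))"
        by (simp add: algebra_simps)
      thus ?thesis using True by (simp add: powr_def Ln_of_real)
    qed
    also have "\<dots> = of_real (\<sigma> powr (-5/2)) * iexp (- (\<alpha> * ln \<sigma>))"
      unfolding exp_add exp_of_real using True by (simp add: powr_def)
    finally show ?thesis by (simp add: iexp_rem1_def mult_ac)
  qed auto
qed

text \<open>
The decay is the borderline at which \<open>g\<close> and \<open>s g\<close> are integrable while \<open>s\<^sup>2 g\<close> need not be; the expansion of
\<open>\<integral> exp(\<i> s r\<^sup>2) g(s) ds\<close> in \<open>r\<^sup>2\<close> therefore breaks off after its linear term in general.
\<close>

locale decaying_amplitude =
  fixes g :: "real \<Rightarrow> complex" and K :: real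
  assumes meas: "set_borel_measurable lborel {1..} g"
    and decay: "\<And>s. s \<ge> 1 \<Longrightarrow> cmod (g s) \<le> K * s powr (-5/2)"
begin

lemma K_nonneg: "K \<ge> 0"
  using order_trans[OF norm_ge_zero decay[of 1]] by simp

lemma meas_indicator [measurable]: "(\<lambda>s. indicator {1..} s *\<^sub>R g s) \<in> borel_measurable borel"
  using meas by (simp add: set_borel_measurable_def)

lemma integrable_weighted:
  assumes [measurable]: "h \<in> borel_measurable borel" and h: "\<And>s. s \<ge> 1 \<Longrightarrow> cmod (h s) \<le> c * s"
  shows "set_integrable lborel {1..} (\<lambda>s. h s * g s)"
  unfolding set_integrable_def
proof (rule Bochner_Integration.integrable_bound)
  show "integrable lborel (\<lambda>s. (c * K) * (indicator {1..} s * s powr (-3/2)))"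
    by (intro integrable_mult_right integrable_powr_at_top) auto
  have "(\<lambda>s. h s * (indicator {1..} s *\<^sub>R g s)) \<in> borel_measurable borel" by measurable
  thus "(\<lambda>s. indicator {1..} s *\<^sub>R (h s * g s)) \<in> borel_measurable lborel" by simp
  show "AE s in lborel. norm (indicator {1..} s *\<^sub>R (h s * g s))
          \<le> norm ((c * K) * (indicator {1..} s * s powr (-3/2)))"
  proof (rule AE_I2)
    fix s :: real
    show "norm (indicator {1..} s *\<^sub>R (h s * g s))
          \<le> norm ((c * K) * (indicator {1..} s * s powr (-3/2)))"
    proof (cases "s \<ge> 1")
      case True
      have "cmod (h s) * cmod (g s) \<le> (c * s) * (K * s powr (-5/2))"
        using h decay True by (intro mult_mono order_trans[OF norm_ge_zero h]) auto
      also have "\<dots> = c * K * (s powr 1 * s powr (-5/2))" using True by simp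
      also have "s powr 1 * s powr (-5/2) = s powr (-3/2)"
        by (simp only: powr_add[symmetric]) simp
      finally show ?thesis using True by (simp add: norm_mult)
    qed auto
  qed
qed

definition osc :: "real \<Rightarrow> complex" where
  "osc r = (LINT s:{1..}|lborel. iexp (s * r\<^sup>2) * g s)"

definition osc_rem :: "real \<Rightarrow> complex" where
  "osc_rem r = (LINT s:{1..}|lborel. iexp_rem1 (s * r\<^sup>2) * g s)"

lemma osc_split:
  "osc r = (LINT s:{1..}|lborel. g s) + of_real r ^ 2 * (\<i> * (LINT s:{1..}|lborel. of_real s * g s))
            + osc_rem r"
proof -
  have 1: "set_integrable lborel {1..} g"
    using integrable_weighted[of "\<lambda>_. 1" 1] by simp
  have 2: "set_integrable lborel {1..} (\<lambda>s. of_real s * g s)"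
    by (rule integrable_weighted[of _ 1]) auto
  have 3: "set_integrable lborel {1..} (\<lambda>s. iexp_rem1 (s * r\<^sup>2) * g s)"
  proof (rule integrable_weighted[of _ "2 * r\<^sup>2"])
    show "cmod (iexp_rem1 (s * r\<^sup>2)) \<le> 2 * r\<^sup>2 * s" if "s \<ge> 1" for s
      using iexp_rem1_linear[of "s * r\<^sup>2"] that by (simp add: abs_mult mult_ac)
  qed simp
  have "osc r = (LINT s:{1..}|lborel. (g s + of_real r ^ 2 * \<i> * (of_real s * g s))
                    + iexp_rem1 (s * r\<^sup>2) * g s)"
    unfolding osc_def by (simp add: iexp_rem1_def algebra_simps)
  also have "\<dots> = (LINT s:{1..}|lborel. g s)
        + (LINT s:{1..}|lborel. of_real r ^ 2 * \<i> * (of_real s * g s)) + osc_rem r"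
    unfolding osc_rem_def using 1 2 3 by (simp add: set_integral_add set_integrable_mult_right)
  finally show ?thesis by simp
qed

text \<open>
The integrand divided by \<open>r\<^sup>2\<close> is dominated by \<open>2 s |g|\<close> and tends to \<open>0\<close> pointwise.
\<close>

lemma osc_rem_small: "((\<lambda>r. osc_rem r / of_real (r\<^sup>2)) \<longlongrightarrow> 0) (at 0)"
proof -
  have "((\<lambda>r. LINT s|lborel. (indicator {1..} s *\<^sub>R (iexp_rem1 (s * r\<^sup>2) * g s)) / of_real (r\<^sup>2))
          \<longlongrightarrow> (LINT s::real|lborel. (0::complex))) (at 0)"
  proof (rule dominated_convergence_at)
    show "integrable lborel (\<lambda>s. (2 * K) * (indicator {1..} s * s powr (-3/2)))"
      by (intro integrable_mult_right integrable_powr_at_top) auto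
    have "(\<lambda>s. iexp_rem1 (s * r\<^sup>2) * (indicator {1..} s *\<^sub>R g s) / of_real (r\<^sup>2))
            \<in> borel_measurable borel" for r :: real by measurable
    thus "(\<lambda>s. (indicator {1..} s *\<^sub>R (iexp_rem1 (s * r\<^sup>2) * g s)) / of_real (r\<^sup>2))
            \<in> borel_measurable lborel" for r :: real by simp
    show "AE s in lborel. norm ((indicator {1..} s *\<^sub>R (iexp_rem1 (s * r\<^sup>2) * g s)) / of_real (r\<^sup>2))
            \<le> (2 * K) * (indicator {1..} s * s powr (-3/2))" if "r \<noteq> 0" for r
    proof (rule AE_I2)
      fix s :: real
      show "norm ((indicator {1..} s *\<^sub>R (iexp_rem1 (s * r\<^sup>2) * g s)) / of_real (r\<^sup>2))
            \<le> (2 * K) * (indicator {1..} s * s powr (-3/2))"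
      proof (cases "s \<ge> 1")
        case True
        have "cmod (iexp_rem1 (s * r\<^sup>2)) * cmod (g s) \<le> (2 * (s * r\<^sup>2)) * (K * s powr (-5/2))"
          using decay True iexp_rem1_linear[of "s * r\<^sup>2"] by (intro mult_mono) (auto simp: abs_mult)
        also have "\<dots> = r\<^sup>2 * (2 * K * (s powr 1 * s powr (-5/2)))" using True by simp
        also have "s powr 1 * s powr (-5/2) = s powr (-3/2)"
          by (simp only: powr_add[symmetric]) simp
        finally show ?thesis using True that
          by (simp add: norm_mult norm_divide norm_power divide_le_eq mult_ac)
      qed auto
    qed
    show "AE s in lborel. ((\<lambda>r. (indicator {1..} s *\<^sub>R (iexp_rem1 (s * r\<^sup>2) * g s)) / of_real (r\<^sup>2))
            \<longlongrightarrow> 0) (at 0)"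
    proof (rule AE_I2, rule Lim_null_comparison)
      fix s :: real
      show "((\<lambda>r. s\<^sup>2 * r\<^sup>2 * cmod (g s)) \<longlongrightarrow> 0) (at 0)"
        by (auto intro!: tendsto_eq_intros)
      show "\<forall>\<^sub>F r in at 0. norm ((indicator {1..} s *\<^sub>R (iexp_rem1 (s * r\<^sup>2) * g s)) / of_real (r\<^sup>2))
              \<le> s\<^sup>2 * r\<^sup>2 * cmod (g s)"
      proof (unfold eventually_at_filter, rule always_eventually, intro allI impI)
        fix r :: real assume r: "r \<noteq> 0"
        have "cmod (iexp_rem1 (s * r\<^sup>2)) * cmod (g s) \<le> (s * r\<^sup>2)\<^sup>2 * cmod (g s)"
          by (intro mult_right_mono iexp_rem1_sq) auto
        thus "norm ((indicator {1..} s *\<^sub>R (iexp_rem1 (s * r\<^sup>2) * g s)) / of_real (r\<^sup>2))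
              \<le> s\<^sup>2 * r\<^sup>2 * cmod (g s)"
          using r mult_nonneg_nonneg[of "s\<^sup>2 * r\<^sup>2" "cmod (g s)"]
          by (cases "s \<ge> 1") (simp_all add: norm_mult norm_divide norm_power divide_le_eq
                power_mult_distrib power2_eq_square[of "r\<^sup>2"] mult_ac)
      qed
    qed
  qed auto
  moreover have "(LINT s|lborel. (indicator {1..} s *\<^sub>R (iexp_rem1 (s * r\<^sup>2) * g s)) / of_real (r\<^sup>2))
      = osc_rem r / of_real (r\<^sup>2)" for r
    unfolding osc_rem_def set_lebesgue_integral_def by simp
  ultimately show ?thesis by (simp only: Bochner_Integration.integral_zero)
qed

text \<open>
The power \<open>r\<^sup>k\<close> supplies what the error \<open>o(r\<^sup>2)\<close> of the oscillatory integral misses.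
\<close>

lemma cubic_peano_power_osc:
  assumes "k \<ge> 1"
  shows "cubic_peano (\<lambda>r. of_real r ^ k * osc r)"
proof (rule cubic_peano_transfer)
  let ?c = "LINT s:{1..}|lborel. g s" and ?d = "\<i> * (LINT s:{1..}|lborel. of_real s * g s)"
  show "cubic_peano (\<lambda>r. of_real r ^ k * (?c + of_real r ^ 2 * ?d))"
    by (rule cubic_peano_poly[of _ "monom 1 k * ([:?c:] + monom ?d 2)"])
       (simp add: poly_monom algebra_simps)
  obtain j where k: "k = Suc j" using assms by (cases k) auto
  show "((\<lambda>r. (of_real r ^ k * osc r - of_real r ^ k * (?c + of_real r ^ 2 * ?d)) / of_real (\<bar>r\<bar> ^ 3))
          \<longlongrightarrow> 0) (at 0)"
  proof (rule Lim_null_comparison)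
    have "((\<lambda>r. \<bar>r\<bar> ^ j * cmod (osc_rem r / of_real (r\<^sup>2))) \<longlongrightarrow> \<bar>0\<bar> ^ j * 0) (at 0)"
      by (intro tendsto_mult tendsto_power tendsto_rabs tendsto_ident_at
            tendsto_norm_zero osc_rem_small)
    thus "((\<lambda>r. \<bar>r\<bar> ^ j * cmod (osc_rem r / of_real (r\<^sup>2))) \<longlongrightarrow> 0) (at 0)" by simp
    have "norm ((of_real r ^ k * osc r - of_real r ^ k * (?c + of_real r ^ 2 * ?d)) / of_real (\<bar>r\<bar> ^ 3))
            \<le> \<bar>r\<bar> ^ j * cmod (osc_rem r / of_real (r\<^sup>2))" if "r \<noteq> 0" for r
    proof -
      have "of_real r ^ k * osc r - of_real r ^ k * (?c + of_real r ^ 2 * ?d) = of_real r ^ k * osc_rem r"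
        by (simp add: osc_split algebra_simps)
      thus ?thesis using that
        by (simp add: k norm_mult norm_divide norm_power power2_eq_square power3_eq_cube field_simps
              abs_mult[symmetric])
    qed
    thus "\<forall>\<^sub>F r in at 0. norm ((of_real r ^ k * osc r - of_real r ^ k * (?c + of_real r ^ 2 * ?d))
            / of_real (\<bar>r\<bar> ^ 3)) \<le> \<bar>r\<bar> ^ j * cmod (osc_rem r / of_real (r\<^sup>2))"
      by (simp add: eventually_at_filter)
  qed
qed

text \<open>
All of the singularity is created at times \<open>s\<close> of order \<open>1 / r\<^sup>2\<close>. With \<open>s = \<sigma> / r\<^sup>2\<close> the integral
becomes \<open>|r|\<^sup>3\<close> times an integral in \<open>\<sigma>\<close> against the fixed kernel, in which the rescaled amplitude
\<open>m (\<sigma> / r\<^sup>2)\<close> may be replaced by its asymptotic form because the kernel is integrable; the factor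
\<open>exp(- \<i> \<alpha> ln s)\<close> splits off \<open>exp(2 \<i> \<alpha> ln |r|)\<close>.
\<close>

lemma osc_rem_asymp:
  assumes lim: "((\<lambda>s. of_real (s powr (5/2)) * g s - g0 * iexp (- (\<alpha> * ln s))) \<longlongrightarrow> 0) at_top"
  shows "((\<lambda>r. (osc_rem r - g0 * C_res \<alpha> * resonant \<alpha> r)
            / of_real (\<bar>r\<bar> ^ 3)) \<longlongrightarrow> 0) (at 0)"
proof -
  define m where "m s = (if s \<ge> 1 then of_real (s powr (5/2)) * g s else 0)" for s
  have [measurable]: "m \<in> borel_measurable borel"
  proof -
    have "(\<lambda>s. of_real (s powr (5/2)) * (indicator {1..} s *\<^sub>R g s)) \<in> borel_measurable borel"
      by measurable
    moreover have "m = (\<lambda>s. of_real (s powr (5/2)) * (indicator {1..} s *\<^sub>R g s))"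
      by (auto simp: m_def fun_eq_iff indicator_def)
    ultimately show ?thesis by simp
  qed
  have m_bound: "cmod (m s) \<le> K" for s
  proof (cases "s \<ge> 1")
    case True
    have "s powr (5/2) * cmod (g s) \<le> s powr (5/2) * (K * s powr (-5/2))"
      using decay[OF True] by (intro mult_left_mono) auto
    also have "\<dots> = K * (s powr (5/2) * s powr (-5/2))" by simp
    also have "s powr (5/2) * s powr (-5/2) = 1" using True by (simp add: powr_add[symmetric])
    finally show ?thesis using True by (simp add: m_def norm_mult)
  qed (use K_nonneg in \<open>auto simp: m_def\<close>)
  \<comment> \<open>the integral of \<open>H r\<close> is the remainder divided by \<open>|r|\<^sup>3\<close>; the constant \<open>C_res\<close> absorbs
    the part of \<open>(0, r\<^sup>2)\<close>, where the original integral has no mass and \<open>m\<close> vanishes\<close>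
  define H where "H r \<sigma> = indicator {0<..} \<sigma> *\<^sub>R (of_real (\<sigma> powr (-5/2)) * iexp_rem1 \<sigma> *
      (m (\<sigma> / r\<^sup>2) - g0 * iexp (- (\<alpha> * ln (\<sigma> / r\<^sup>2)))))" for r \<sigma>
  have H_lim: "((\<lambda>r. LINT \<sigma>|lborel. H r \<sigma>) \<longlongrightarrow> (LINT \<sigma>::real|lborel. (0::complex))) (at 0)"
  proof (rule dominated_convergence_at)
    show "integrable lborel (\<lambda>\<sigma>. kernel_majorant \<sigma> * (K + cmod g0))"
      by (intro integrable_mult_left integrable_kernel_majorant)
    show "H r \<in> borel_measurable lborel" for r unfolding H_def by measurable
    show "AE \<sigma> in lborel. norm (H r \<sigma>) \<le> kernel_majorant \<sigma> * (K + cmod g0)" if "r \<noteq> 0" for r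
    proof (rule AE_I2)
      fix \<sigma> :: real
      have b: "cmod (m (\<sigma> / r\<^sup>2) - g0 * iexp (- (\<alpha> * ln (\<sigma> / r\<^sup>2)))) \<le> K + cmod g0"
        by (rule order_trans[OF norm_triangle_ineq4])
           (auto intro!: add_mono m_bound simp: norm_mult simp del: of_real_minus of_real_mult)
      show "norm (H r \<sigma>) \<le> kernel_majorant \<sigma> * (K + cmod g0)"
      proof (cases "\<sigma> > 0")
        case True
        have "norm (H r \<sigma>) = (\<sigma> powr (-5/2) * cmod (iexp_rem1 \<sigma>)) *
                 cmod (m (\<sigma> / r\<^sup>2) - g0 * iexp (- (\<alpha> * ln (\<sigma> / r\<^sup>2))))"
          using True by (simp add: H_def norm_mult)
        also have "\<dots> \<le> kernel_majorant \<sigma> * (K + cmod g0)"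
          by (intro mult_mono kernel_bound True b kernel_majorant_nonneg) auto
        finally show ?thesis .
      next
        case False
        thus ?thesis using kernel_majorant_nonneg K_nonneg by (simp add: H_def)
      qed
    qed
    show "AE \<sigma> in lborel. ((\<lambda>r. H r \<sigma>) \<longlongrightarrow> 0) (at 0)"
    proof (rule AE_I2)
      fix \<sigma> :: real
      show "((\<lambda>r. H r \<sigma>) \<longlongrightarrow> 0) (at 0)"
      proof (cases "\<sigma> > 0")
        case True
        have top: "filterlim (\<lambda>r::real. \<sigma> / r\<^sup>2) at_top (at 0)"
          using True by (intro filterlim_divide_at_infinity[where c = \<sigma>, THEN filterlim_at_infinity_imp_filterlim_at_top]
              tendsto_eq_intros) (auto simp: eventually_at_filter filterlim_at intro!: tendsto_eq_intros)
        have "((\<lambda>s. m s - g0 * iexp (- (\<alpha> * ln s))) \<longlongrightarrow> 0) at_top"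
          by (rule Lim_transform_eventually[OF lim])
             (auto simp: m_def intro: eventually_mono[OF eventually_ge_at_top[of 1]])
        from filterlim_compose[OF this top]
        have "((\<lambda>r. m (\<sigma> / r\<^sup>2) - g0 * iexp (- (\<alpha> * ln (\<sigma> / r\<^sup>2)))) \<longlongrightarrow> 0) (at 0)" .
        hence "((\<lambda>r. (of_real (\<sigma> powr (-5/2)) * iexp_rem1 \<sigma>) *
                (m (\<sigma> / r\<^sup>2) - g0 * iexp (- (\<alpha> * ln (\<sigma> / r\<^sup>2))))) \<longlongrightarrow> 0) (at 0)"
          by (rule tendsto_mult_right_zero)
        thus ?thesis using True by (simp add: H_def)
      qed (auto simp: H_def)
    qed
  qed auto
  have H_int: "(LINT \<sigma>|lborel. H r \<sigma>) =
      (osc_rem r - g0 * C_res \<alpha> * resonant \<alpha> r) / of_real (\<bar>r\<bar> ^ 3)"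
    if r: "r \<noteq> 0" for r
  proof -
    define F1 where "F1 \<sigma> = indicator {0<..} \<sigma> *\<^sub>R (of_real (\<sigma> powr (-5/2)) * iexp_rem1 \<sigma> * m (\<sigma> / r\<^sup>2))" for \<sigma>
    define F2 where "F2 \<sigma> = indicator {0<..} \<sigma> *\<^sub>R (of_real (\<sigma> powr (-5/2)) * iexp_rem1 \<sigma> * iexp (- (\<alpha> * ln \<sigma>)))" for \<sigma>
    have int: "integrable lborel (\<lambda>\<sigma>. indicator {0<..} \<sigma> *\<^sub>R (of_real (\<sigma> powr (-5/2)) * iexp_rem1 \<sigma> * f \<sigma>))"
      if [measurable]: "f \<in> borel_measurable borel" and f: "\<And>\<sigma>. cmod (f \<sigma>) \<le> c" for f c
    proof (rule Bochner_Integration.integrable_bound)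
      show "integrable lborel (\<lambda>\<sigma>. kernel_majorant \<sigma> * c)"
        by (intro integrable_mult_left integrable_kernel_majorant)
      have "norm (indicator {0<..} \<sigma> *\<^sub>R (of_real (\<sigma> powr (-5/2)) * iexp_rem1 \<sigma> * f \<sigma>))
              \<le> kernel_majorant \<sigma> * c" for \<sigma>
      proof (cases "\<sigma> > 0")
        case True
        have "(\<sigma> powr (-5/2) * cmod (iexp_rem1 \<sigma>)) * cmod (f \<sigma>) \<le> kernel_majorant \<sigma> * c"
          by (intro mult_mono kernel_bound True f kernel_majorant_nonneg) auto
        thus ?thesis using True by (simp add: norm_mult)
      next
        case False
        thus ?thesis using kernel_majorant_nonneg order_trans[OF norm_ge_zero f] by simp
      qed
      thus "AE \<sigma> in lborel. norm (indicator {0<..} \<sigma> *\<^sub>R (of_real (\<sigma> powr (-5/2)) * iexp_rem1 \<sigma> * f \<sigma>))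
              \<le> norm (kernel_majorant \<sigma> * c)"
        unfolding real_norm_def by (intro AE_I2 order_trans[OF _ abs_ge_self])
    qed measurable
    have i1: "integrable lborel F1"
      unfolding F1_def by (rule int[where c = K]) (auto intro: m_bound)
    have i2: "integrable lborel F2"
      unfolding F2_def by (rule int[where c = 1]) (auto simp del: of_real_minus of_real_mult)
    define ph where "ph = iexp (2 * \<alpha> * ln \<bar>r\<bar>)"
    have Hsplit: "H r \<sigma> = F1 \<sigma> - g0 * ph * F2 \<sigma>" for \<sigma>
    proof (cases "\<sigma> > 0")
      case True
      have L: "ln (\<sigma> / r\<^sup>2) = ln \<sigma> - 2 * ln \<bar>r\<bar>"
        using True r by (simp add: ln_div ln_realpow[of "\<bar>r\<bar>" 2, simplified])
      have "\<i> * of_real (- (\<alpha> * ln (\<sigma> / r\<^sup>2))) = \<i> * of_real (2 * \<alpha> * ln \<bar>r\<bar>) + \<i> * of_real (- (\<alpha> * ln \<sigma>))"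
        unfolding L by (simp add: algebra_simps)
      hence "iexp (- (\<alpha> * ln (\<sigma> / r\<^sup>2))) = ph * iexp (- (\<alpha> * ln \<sigma>))"
        by (simp only: ph_def exp_add)
      thus ?thesis by (simp only: H_def F1_def F2_def) (simp add: algebra_simps)
    qed (auto simp: H_def F1_def F2_def)
    have o: "osc_rem r = of_real (\<bar>r\<bar> ^ 3) * (LINT \<sigma>|lborel. F1 \<sigma>)"
    proof -
      have "osc_rem r = \<bar>1 / r\<^sup>2\<bar> *\<^sub>R (LINT \<sigma>|lborel. indicator {1..} (0 + 1 / r\<^sup>2 * \<sigma>) *\<^sub>R
              (iexp_rem1 ((0 + 1 / r\<^sup>2 * \<sigma>) * r\<^sup>2) * g (0 + 1 / r\<^sup>2 * \<sigma>)))"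
        unfolding osc_rem_def set_lebesgue_integral_def
        using r by (intro lborel_integral_real_affine) auto
      also have "\<dots> = (LINT \<sigma>|lborel. of_real (1 / r\<^sup>2) * (indicator {1..} (\<sigma> / r\<^sup>2) *\<^sub>R
              (iexp_rem1 \<sigma> * g (\<sigma> / r\<^sup>2))))"
        using r by (simp add: scaleR_conv_of_real)
      also have "\<dots> = (LINT \<sigma>|lborel. of_real (\<bar>r\<bar> ^ 3) * F1 \<sigma>)"
      proof (rule Bochner_Integration.integral_cong[OF refl])
        fix \<sigma> :: real
        show "of_real (1 / r\<^sup>2) * (indicator {1..} (\<sigma> / r\<^sup>2) *\<^sub>R (iexp_rem1 \<sigma> * g (\<sigma> / r\<^sup>2)))
                = of_real (\<bar>r\<bar> ^ 3) * F1 \<sigma>"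
        proof (cases "\<sigma> / r\<^sup>2 \<ge> 1")
          case True
          hence \<sigma>: "\<sigma> > 0" using r by (simp add: le_divide_eq) (smt (verit) zero_less_power2)
          have "\<bar>r\<bar> ^ 3 * (\<sigma> powr (-5/2) * (\<sigma> / r\<^sup>2) powr (5/2)) = 1 / r\<^sup>2"
          proof -
            have "r\<^sup>2 = \<bar>r\<bar> powr 2" using r by simp
            hence "(r\<^sup>2) powr (5/2) = \<bar>r\<bar> powr 5" by (simp only: powr_powr) simp
            hence "(r\<^sup>2) powr (5/2) = \<bar>r\<bar> ^ 5"
              using r powr_realpow[of "\<bar>r\<bar>" 5] by simp
            moreover have "\<sigma> powr (-5/2) * \<sigma> powr (5/2) = 1" using \<sigma> by (simp add: powr_add[symmetric])
            ultimately have "\<bar>r\<bar> ^ 3 * (\<sigma> powr (-5/2) * (\<sigma> / r\<^sup>2) powr (5/2)) = \<bar>r\<bar> ^ 3 / \<bar>r\<bar> ^ 5"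
              using \<sigma> r by (simp add: powr_divide)
            also have "\<dots> = 1 / \<bar>r\<bar>\<^sup>2" using r by (simp add: eval_nat_numeral)
            finally show ?thesis by simp
          qed
          hence "of_real (1 / r\<^sup>2) = complex_of_real (\<bar>r\<bar> ^ 3) *
                    (of_real (\<sigma> powr (-5/2)) * of_real ((\<sigma> / r\<^sup>2) powr (5/2)))"
            by (metis of_real_mult)
          thus ?thesis using True \<sigma>
            by (simp only: F1_def m_def) (simp add: mult_ac)
        qed (auto simp: F1_def m_def)
      qed
      finally show ?thesis by simp
    qed
    have p: "resonant \<alpha> r = of_real (\<bar>r\<bar> ^ 3) * ph"
    proof -
      have "resonant \<alpha> r =
              exp (of_real (3 * ln \<bar>r\<bar>) + \<i> * of_real (2 * \<alpha> * ln \<bar>r\<bar>))"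
      proof -
        have "(3 + 2 * \<i> * of_real \<alpha>) * complex_of_real (ln \<bar>r\<bar>)
                = of_real (3 * ln \<bar>r\<bar>) + \<i> * of_real (2 * \<alpha> * ln \<bar>r\<bar>)"
          by (simp add: algebra_simps)
        thus ?thesis using r by (simp add: powr_def Ln_of_real)
      qed
      also have "exp (3 * ln \<bar>r\<bar>) = \<bar>r\<bar> ^ 3"
        using r by (metis exp_ln exp_of_nat_mult of_nat_numeral zero_less_abs_iff)
      hence "exp (of_real (3 * ln \<bar>r\<bar>) + \<i> * of_real (2 * \<alpha> * ln \<bar>r\<bar>)) = of_real (\<bar>r\<bar> ^ 3) * ph"
        by (simp only: exp_add exp_of_real ph_def)
      finally show ?thesis .
    qed
    have "(LINT \<sigma>|lborel. H r \<sigma>) = (LINT \<sigma>|lborel. F1 \<sigma>) - g0 * ph * C_res \<alpha>"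
    proof -
      have "C_res \<alpha> = (LINT \<sigma>|lborel. F2 \<sigma>)" by (simp only: C_res_kernel F2_def)
      thus ?thesis unfolding Hsplit using i1 i2 by simp
    qed
    note eq = this
    show ?thesis unfolding eq o p using r by (simp add: field_simps)
  qed
  show ?thesis
    by (rule Lim_transform_eventually[OF H_lim[simplified]])
       (auto simp: eventually_at_filter H_int)
qed

lemma cubic_peano_osc:
  assumes "((\<lambda>s. of_real (s powr (5/2)) * g s - g0 * iexp (- (\<alpha> * ln s))) \<longlongrightarrow> 0) at_top"
  shows "cubic_peano (\<lambda>r. osc r - g0 * C_res \<alpha> * resonant \<alpha> r)"
proof (rule cubic_peano_transfer)
  let ?c = "LINT s:{1..}|lborel. g s" and ?d = "\<i> * (LINT s:{1..}|lborel. of_real s * g s)"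
  show "cubic_peano (\<lambda>r. ?c + of_real r ^ 2 * ?d)"
    by (rule cubic_peano_poly[of _ "[:?c:] + monom ?d 2"]) (simp add: poly_monom)
  show "((\<lambda>r. (osc r - g0 * C_res \<alpha> * resonant \<alpha> r
             - (?c + of_real r ^ 2 * ?d)) / of_real (\<bar>r\<bar> ^ 3)) \<longlongrightarrow> 0) (at 0)"
    using osc_rem_asymp[OF assms] by (simp add: osc_split algebra_simps)
qed

end

lemma (in decaying_amplitude) osc_bound:
  "cmod (osc r) \<le> K * (LINT s|lborel. indicator {1..} s * s powr (-5/2))"
proof -
  have int: "integrable lborel (\<lambda>s::real. indicator {1..} s * s powr (-5/2))"
    by (rule integrable_powr_at_top) auto
  have "cmod (osc r) \<le> (LINT s|lborel. cmod (indicator {1..} s *\<^sub>R (iexp (s * r\<^sup>2) * g s)))"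
    unfolding osc_def set_lebesgue_integral_def by (rule integral_norm_bound)
  also have "\<dots> \<le> (LINT s|lborel. K * (indicator {1..} s * s powr (-5/2)))"
  proof (rule integral_mono')
    show "integrable lborel (\<lambda>s. K * (indicator {1..} s * s powr (-5/2)))"
      using int by (rule integrable_mult_right)
    show "cmod (indicator {1..} s *\<^sub>R (iexp (s * r\<^sup>2) * g s)) \<le> K * (indicator {1..} s * s powr (-5/2))" for s
    proof (cases "s \<ge> 1")
      case True
      have "cmod (iexp (s * r\<^sup>2) * g s) = cmod (g s)" by (simp only: norm_mult norm_exp_i_times mult_1_left)
      thus ?thesis using decay[OF True] True by simp
    qed auto
    show "0 \<le> K * (indicator {1..} s * s powr (-5/2))" for s using K_nonneg by simp
  qed
  finally show ?thesis by simp
qed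

lemma (in decaying_amplitude) integrable_osc:
  "set_integrable lborel {1..} (\<lambda>s. iexp (s * r\<^sup>2) * g s)"
  by (rule integrable_weighted[of _ 1]) (auto simp del: of_real_mult)

lemma power4_split: "x ^ 4 = x * x ^ 3" "(x\<^sup>2)\<^sup>2 = x * x ^ 3" for x :: real
  by (simp_all add: eval_nat_numeral)

lemma cubic_peano_iexp_linear: "cubic_peano (\<lambda>r. iexp (c * r))"
proof (rule cubic_peano_transfer)
  define q where "q = (\<Sum>k\<le>3. monom ((\<i> * of_real c) ^ k / fact k) k :: complex poly)"
  have q: "poly q (of_real r) = (\<Sum>k\<le>3. (\<i> * of_real (c * r)) ^ k / fact k)" for r
    by (simp add: q_def poly_sum poly_monom power_mult_distrib mult_ac)
  show "cubic_peano (\<lambda>r. poly q (of_real r))" by (rule cubic_peano_poly) simp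
  show "((\<lambda>r. (iexp (c * r) - poly q (of_real r)) / of_real (\<bar>r\<bar> ^ 3)) \<longlongrightarrow> 0) (at 0)"
  proof (rule Lim_null_comparison)
    show "((\<lambda>r. \<bar>c\<bar> ^ 4 * \<bar>r\<bar>) \<longlongrightarrow> 0) (at 0)" by (auto intro!: tendsto_eq_intros)
    show "\<forall>\<^sub>F r in at 0. norm ((iexp (c * r) - poly q (of_real r)) / of_real (\<bar>r\<bar> ^ 3)) \<le> \<bar>c\<bar> ^ 4 * \<bar>r\<bar>"
    proof (unfold eventually_at_filter, intro always_eventually allI impI)
      fix r :: real assume r: "r \<noteq> 0"
      have "cmod (iexp (c * r) - poly q (of_real r)) \<le> \<bar>c * r\<bar> ^ 4"
        using iexp_rem_bound1[of "c * r"] by (simp only: q iexp_rem_def)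
      also have "\<dots> = (\<bar>c\<bar> ^ 4 * \<bar>r\<bar>) * \<bar>r\<bar> ^ 3"
        by (simp only: abs_mult power_mult_distrib power4_split(1)[of "\<bar>r\<bar>"] mult_ac)
      finally show "norm ((iexp (c * r) - poly q (of_real r)) / of_real (\<bar>r\<bar> ^ 3)) \<le> \<bar>c\<bar> ^ 4 * \<bar>r\<bar>"
        using r unfolding norm_divide by (subst pos_divide_le_eq) (auto simp: norm_power)
    qed
  qed
qed

lemma cubic_peano_iexp_square: "cubic_peano (\<lambda>r. iexp (r\<^sup>2))"
proof (rule cubic_peano_transfer)
  show "cubic_peano (\<lambda>r. 1 + \<i> * of_real (r\<^sup>2))"
    by (rule cubic_peano_poly[where q = "1 + monom \<i> 2"]) (simp add: poly_monom)
  show "((\<lambda>r. (iexp (r\<^sup>2) - (1 + \<i> * of_real (r\<^sup>2))) / of_real (\<bar>r\<bar> ^ 3)) \<longlongrightarrow> 0) (at 0)"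
  proof (rule Lim_null_comparison)
    show "((\<lambda>r::real. \<bar>r\<bar>) \<longlongrightarrow> 0) (at 0)" by (auto intro!: tendsto_eq_intros)
    show "\<forall>\<^sub>F r in at 0. norm ((iexp (r\<^sup>2) - (1 + \<i> * of_real (r\<^sup>2))) / of_real (\<bar>r\<bar> ^ 3)) \<le> \<bar>r\<bar>"
    proof (unfold eventually_at_filter, intro always_eventually allI impI)
      fix r :: real assume r: "r \<noteq> 0"
      have "cmod (iexp (r\<^sup>2) - (1 + \<i> * of_real (r\<^sup>2))) \<le> (r\<^sup>2)\<^sup>2"
        using iexp_rem1_sq[of "r\<^sup>2"] by (simp only: iexp_rem1_def diff_diff_eq)
      also have "\<dots> = (\<bar>r\<bar>\<^sup>2)\<^sup>2" by simp
      also have "\<dots> = \<bar>r\<bar> * \<bar>r\<bar> ^ 3" by (simp only: power4_split(2))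
      finally show "norm ((iexp (r\<^sup>2) - (1 + \<i> * of_real (r\<^sup>2))) / of_real (\<bar>r\<bar> ^ 3)) \<le> \<bar>r\<bar>"
        using r unfolding norm_divide by (subst pos_divide_le_eq) (auto simp: norm_power)
    qed
  qed
qed

section \<open>The resonance coefficient does not vanish\<close>

text \<open>
The two powers make the primitive vanish at both ends. They are the ones that occur for integrands of size
\<open>x powr (-1/2)\<close> near \<open>0\<close> and \<open>x powr (-3/2)\<close> near infinity.
\<close>

lemma improper_FTC:
  fixes f F :: "real \<Rightarrow> complex"
  assumes F: "\<And>x. x > 0 \<Longrightarrow> (F has_vector_derivative f x) (at x)"
    and f: "\<And>x. x > 0 \<Longrightarrow> isCont f x"
    and int: "set_integrable lborel {0<..} f"
    and small: "\<And>x. 0 < x \<Longrightarrow> x < 1 \<Longrightarrow> cmod (F x) \<le> c * x powr (1/2)"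
    and large: "\<And>x. x \<ge> 1 \<Longrightarrow> cmod (F x) \<le> c * x powr (-1/2)"
  shows "(LINT x:{0<..}|lborel. f x) = 0"
proof -
  have lim0: "(F \<longlongrightarrow> 0) (at_right 0)"
  proof (rule Lim_null_comparison)
    have "((\<lambda>x::real. x powr (1/2)) \<longlongrightarrow> 0 powr (1/2)) (at_right 0)"
      by (intro tendsto_powr') (auto intro!: tendsto_eq_intros eventually_mono[OF eventually_at_right_less])
    from tendsto_mult_right_zero[OF this[simplified], of c]
    show "((\<lambda>x. c * x powr (1/2)) \<longlongrightarrow> 0) (at_right 0)" .
    have "\<forall>\<^sub>F x::real in at_right 0. x \<in> {0<..<1}" by (rule eventually_at_right_real) simp
    thus "\<forall>\<^sub>F x in at_right 0. cmod (F x) \<le> c * x powr (1/2)"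
      by (rule eventually_mono) (use small in auto)
  qed
  have lim1: "(F \<longlongrightarrow> 0) at_top"
  proof (rule Lim_null_comparison)
    have "((\<lambda>x::real. x powr (-1/2)) \<longlongrightarrow> 0) at_top"
      by (intro tendsto_neg_powr filterlim_ident) auto
    from tendsto_mult_right_zero[OF this, of c]
    show "((\<lambda>x. c * x powr (-1/2)) \<longlongrightarrow> 0) at_top" .
    show "\<forall>\<^sub>F x in at_top. cmod (F x) \<le> c * x powr (-1/2)"
      by (rule eventually_mono[OF eventually_ge_at_top[of 1] large])
  qed
  have e: "einterval 0 \<infinity> = {0<..}" by (auto simp: einterval_def)
  have "(LBINT x=(0::ereal)..\<infinity>. f x) = 0 - 0"
  proof (rule interval_integral_FTC_integrable[where F = F])
    show "((F \<circ> real_of_ereal) \<longlongrightarrow> 0) (at_right 0)"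
      using lim0 ereal_tendsto_simps1(2)[of F 0 0] by (simp add: zero_ereal_def)
    show "((F \<circ> real_of_ereal) \<longlongrightarrow> 0) (at_left \<infinity>)"
      using lim1 by (simp add: ereal_tendsto_simps1)
    show "set_integrable lborel (einterval 0 \<infinity>) f" using int by (simp add: e)
  qed (use F f in auto)
  thus ?thesis
    using interval_integral_to_infinity_eq[of lborel 0 f] by (simp add: zero_ereal_def)
qed

definition laplace_rem :: "complex \<Rightarrow> complex" where
  "laplace_rem w = exp (- w) - 1 + w"

lemma laplace_rem_small:
  assumes "cmod w \<le> 1"
  shows "cmod (laplace_rem w) \<le> 3 * cmod w ^ 2"
proof -
  have "cmod (laplace_rem w) \<le> exp (cmod w) * cmod w ^ 2"
    using Taylor_exp_field[of "- w" 1] by (simp add: laplace_rem_def algebra_simps numeral_2_eq_2)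
  also have "\<dots> \<le> 3 * cmod w ^ 2"
    using assms exp_le order_trans[of "exp (cmod w)" "exp 1" 3] by (intro mult_right_mono) auto
  finally show ?thesis .
qed

lemma laplace_rem_large:
  assumes "cmod w \<ge> 1" "Re w \<ge> 0"
  shows "cmod (laplace_rem w) \<le> 3 * cmod w"
proof -
  have "cmod (laplace_rem w) \<le> cmod (exp (- w)) + cmod 1 + cmod w"
    unfolding laplace_rem_def
    by (intro order_trans[OF norm_triangle_ineq] add_mono norm_triangle_ineq4) auto
  moreover have "cmod (exp (- w)) \<le> 1" using assms by (simp add: norm_exp_eq_Re)
  ultimately show ?thesis using assms by (simp only: norm_one)
qed

text \<open>
On the negative imaginary axis this is, up to a constant factor, the integrand of \<open>C_res\<close>; on the positive axis
it is the integrand of the regularised Gamma integral at \<open>- 3/2 - \<i> \<alpha>\<close>.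
\<close>

definition mellin_integrand :: "real \<Rightarrow> complex \<Rightarrow> complex" where
  "mellin_integrand \<alpha> w = w powr (- 5/2 - \<i> * of_real \<alpha>) * laplace_rem w"

lemma mellin_integrand_bound:
  assumes "w \<noteq> 0" "Re w \<ge> 0"
  shows "cmod w \<le> 1 \<Longrightarrow> cmod (mellin_integrand \<alpha> w) \<le> 3 * exp (\<bar>\<alpha>\<bar> * pi) * cmod w powr (-1/2)"
    and "cmod w \<ge> 1 \<Longrightarrow> cmod (mellin_integrand \<alpha> w) \<le> 3 * exp (\<bar>\<alpha>\<bar> * pi) * cmod w powr (-3/2)"
proof -
  have "\<alpha> * Arg w \<le> \<bar>\<alpha>\<bar> * pi"
  proof -
    have "\<bar>Arg w\<bar> \<le> pi" using Arg_bounded[of w] by (simp add: abs_le_iff)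
    hence "\<bar>\<alpha> * Arg w\<bar> \<le> \<bar>\<alpha>\<bar> * pi" unfolding abs_mult by (intro mult_left_mono) simp_all
    thus ?thesis by (rule order_trans[OF abs_ge_self])
  qed
  hence p: "cmod (w powr (- 5/2 - \<i> * of_real \<alpha>)) \<le> cmod w powr (-5/2) * exp (\<bar>\<alpha>\<bar> * pi)"
    by (simp add: norm_powr_complex mult_left_mono)
  have k: "cmod (mellin_integrand \<alpha> w) \<le> (cmod w powr (-5/2) * exp (\<bar>\<alpha>\<bar> * pi)) * (3 * cmod w powr b)"
    if "cmod (laplace_rem w) \<le> 3 * cmod w powr b" for b
    unfolding mellin_integrand_def norm_mult by (intro mult_mono p that) auto
  have e: "(cmod w powr (-5/2) * exp (\<bar>\<alpha>\<bar> * pi)) * (3 * cmod w powr b)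
              = 3 * exp (\<bar>\<alpha>\<bar> * pi) * cmod w powr (-5/2 + b)" for b
    by (simp only: powr_add mult_ac)
  show "cmod (mellin_integrand \<alpha> w) \<le> 3 * exp (\<bar>\<alpha>\<bar> * pi) * cmod w powr (-1/2)" if "cmod w \<le> 1"
    using k[of 2] laplace_rem_small[OF that] assms unfolding e by simp
  show "cmod (mellin_integrand \<alpha> w) \<le> 3 * exp (\<bar>\<alpha>\<bar> * pi) * cmod w powr (-3/2)" if "cmod w \<ge> 1"
    using k[of 1] laplace_rem_large[OF that assms(2)] assms unfolding e by simp
qed

lemma slit_iff: "w \<in> - (complex_of_real ` {..0}) \<longleftrightarrow> w \<notin> \<real>\<^sub>\<le>\<^sub>0"
  by (auto simp: complex_nonpos_Reals_iff image_iff complex_eq_iff intro: exI[of _ "Re w"])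

lemma mellin_integrand_differentiable:
  assumes "w \<notin> \<real>\<^sub>\<le>\<^sub>0"
  shows "mellin_integrand \<alpha> field_differentiable at w"
  unfolding mellin_integrand_def laplace_rem_def field_differentiable_def
  by (rule exI) (use assms in \<open>auto intro!: derivative_eq_intros\<close>)

lemma mellin_primitive:
  "\<exists>\<Phi>. \<forall>w. w \<notin> \<real>\<^sub>\<le>\<^sub>0 \<longrightarrow> (\<Phi> has_field_derivative mellin_integrand \<alpha> w) (at w)"
proof -
  let ?S = "- (complex_of_real ` {..0})"
  have "\<exists>\<Phi>. \<forall>w\<in>?S. (\<Phi> has_field_derivative mellin_integrand \<alpha> w) (at w)"
  proof (rule holomorphic_starlike_primitive[where k = "{}"])
    show "continuous_on ?S (mellin_integrand \<alpha>)"
      by (intro continuous_at_imp_continuous_on ballI)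
         (auto simp: slit_iff simp del: Compl_iff intro!: field_differentiable_imp_continuous_at mellin_integrand_differentiable)
    show "starlike ?S" by (rule starlike_slotted_complex_plane_left)
    show "open ?S" by (intro open_Compl closed_slot_left)
  qed (auto simp: slit_iff simp del: Compl_iff intro!: mellin_integrand_differentiable)
  thus ?thesis unfolding Ball_def slit_iff .
qed

lemma mellin_ray_integrable:
  assumes "cmod w0 = 1" "Re w0 \<ge> 0" "w0 \<noteq> 0"
  shows "set_integrable lborel {0<..} (\<lambda>t. mellin_integrand \<alpha> (of_real t * w0))"
  unfolding set_integrable_def
proof (rule Bochner_Integration.integrable_bound)
  show "integrable lborel (\<lambda>t. 3 * exp (\<bar>\<alpha>\<bar> * pi) * kernel_majorant t)"
    by (intro integrable_mult_right integrable_kernel_majorant)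
  have np: "of_real t * w0 \<notin> \<real>\<^sub>\<le>\<^sub>0" if "t > 0" for t
  proof
    assume "of_real t * w0 \<in> \<real>\<^sub>\<le>\<^sub>0"
    hence "t * Re w0 \<le> 0" "t * Im w0 = 0" by (auto simp: complex_nonpos_Reals_iff)
    thus False using that assms by (auto simp: mult_le_0_iff complex_eq_iff)
  qed
  show "(\<lambda>t. indicator {0<..} t *\<^sub>R mellin_integrand \<alpha> (of_real t * w0)) \<in> borel_measurable lborel"
  proof -
    have "continuous_on {0<..} (\<lambda>t. mellin_integrand \<alpha> (of_real t * w0))"
    proof (intro continuous_at_imp_continuous_on ballI)
      fix t :: real assume "t \<in> {0<..}"
      hence "isCont (mellin_integrand \<alpha>) (of_real t * w0)"
        by (intro field_differentiable_imp_continuous_at mellin_integrand_differentiable np) auto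
      moreover have "isCont (\<lambda>t. of_real t * w0) t" by (intro continuous_intros)
      ultimately show "isCont (\<lambda>t. mellin_integrand \<alpha> (of_real t * w0)) t"
        by (rule isCont_o2[rotated])
    qed
    hence "(\<lambda>t. indicator {0<..} t *\<^sub>R mellin_integrand \<alpha> (of_real t * w0)) \<in> borel_measurable borel"
      by (intro borel_measurable_continuous_on_indicator) auto
    thus ?thesis by simp
  qed
  show "AE t in lborel. norm (indicator {0<..} t *\<^sub>R mellin_integrand \<alpha> (of_real t * w0))
          \<le> norm (3 * exp (\<bar>\<alpha>\<bar> * pi) * kernel_majorant t)"
  proof (rule AE_I2)
    fix t :: real
    show "norm (indicator {0<..} t *\<^sub>R mellin_integrand \<alpha> (of_real t * w0))
          \<le> norm (3 * exp (\<bar>\<alpha>\<bar> * pi) * kernel_majorant t)"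
    proof (cases "t > 0")
      case True
      have n: "cmod (of_real t * w0) = t" using True assms by (simp add: norm_mult)
      have "cmod (mellin_integrand \<alpha> (of_real t * w0)) \<le> 3 * exp (\<bar>\<alpha>\<bar> * pi) * kernel_majorant t"
      proof (cases "t \<le> 1")
        case le: True
        have "cmod (mellin_integrand \<alpha> (of_real t * w0)) \<le> 3 * exp (\<bar>\<alpha>\<bar> * pi) * t powr (-1/2)"
          using mellin_integrand_bound(1)[of "of_real t * w0" \<alpha>] n True assms le by simp
        also have "\<dots> \<le> 3 * exp (\<bar>\<alpha>\<bar> * pi) * kernel_majorant t"
          using True le by (intro mult_left_mono) (auto simp: kernel_majorant_def indicator_def)
        finally show ?thesis .
      next
        case gt: False
        have "cmod (mellin_integrand \<alpha> (of_real t * w0)) \<le> 3 * exp (\<bar>\<alpha>\<bar> * pi) * t powr (-3/2)"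
          using mellin_integrand_bound(2)[of "of_real t * w0" \<alpha>] n True assms gt by simp
        also have "\<dots> \<le> 3 * exp (\<bar>\<alpha>\<bar> * pi) * kernel_majorant t"
          using True gt by (intro mult_left_mono) (auto simp: kernel_majorant_def indicator_def)
        finally show ?thesis .
      qed
      thus ?thesis using True kernel_majorant_nonneg[of t] by simp
    qed auto
  qed
qed

text \<open>
A primitive \<open>\<Phi>\<close> exists on the slit plane, since it is starlike. The difference of \<open>\<Phi>\<close> at the points
\<open>t\<close> and \<open>- \<i> t\<close> is an integral over a quarter circle of radius \<open>t\<close>, which tends to \<open>0\<close> both for
\<open>t \<rightarrow> 0\<close> and for \<open>t \<rightarrow> \<infinity>\<close> because the integrand is \<open>O(t powr (-1/2))\<close>, respectively
\<open>O(t powr (-3/2))\<close>, on the closed right half plane. The integrals along the two rays therefore agree.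
\<close>

lemma mellin_rotate:
  "(LINT t:{0<..}|lborel. mellin_integrand \<alpha> (of_real t)) =
   - \<i> * (LINT t:{0<..}|lborel. mellin_integrand \<alpha> (- \<i> * of_real t))"
proof -
  obtain \<Phi> where \<Phi>: "\<And>w. w \<notin> \<real>\<^sub>\<le>\<^sub>0 \<Longrightarrow> (\<Phi> has_field_derivative mellin_integrand \<alpha> w) (at w)"
    using mellin_primitive by blast
  define M where "M = 3 * exp (\<bar>\<alpha>\<bar> * pi)"
  have M: "M \<ge> 0" by (simp add: M_def)
  define F where "F t = \<Phi> (of_real t) - \<Phi> (- \<i> * of_real t)" for t :: real
  have arc: "cmod (F t) \<le> (t * B) * (pi / 2)"
    if t: "t > 0" and B: "\<And>w. cmod w = t \<Longrightarrow> Re w \<ge> 0 \<Longrightarrow> cmod (mellin_integrand \<alpha> w) \<le> B" for t B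
  proof -
    define c where "c \<phi> = of_real t * exp (- (\<i> * of_real \<phi>))" for \<phi> :: real
    have c_Re: "Re (c \<phi>) = t * cos \<phi>" "Im (c \<phi>) = - t * sin \<phi>" for \<phi>
      by (simp_all add: c_def Re_exp Im_exp)
    have c_norm: "cmod (c \<phi>) = t" for \<phi>
      using t by (simp add: c_def norm_mult norm_exp_eq_Re)
    have c_cos: "cos \<phi> \<ge> 0" if "\<phi> \<in> {0..pi/2}" for \<phi>
      using that by (intro cos_ge_zero) auto
    have "((\<lambda>\<phi>. mellin_integrand \<alpha> (c \<phi>) * (- \<i> * c \<phi>)) has_integral \<Phi> (c (pi/2)) - \<Phi> (c 0)) {0..pi/2}"
    proof (rule fundamental_theorem_of_calculus)
      fix \<phi> :: real assume \<phi>: "\<phi> \<in> {0..pi/2}"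
      have "c \<phi> \<notin> \<real>\<^sub>\<le>\<^sub>0"
      proof
        assume "c \<phi> \<in> \<real>\<^sub>\<le>\<^sub>0"
        hence "cos \<phi> \<le> 0" "sin \<phi> = 0" using t by (auto simp: complex_nonpos_Reals_iff c_Re mult_le_0_iff)
        with c_cos[OF \<phi>] have "cos \<phi> = 0" "sin \<phi> = 0" by auto
        thus False using sin_cos_squared_add[of \<phi>] by simp
      qed
      note \<Phi>' = \<Phi>[OF this]
      have "(c has_vector_derivative (- \<i> * c \<phi>)) (at \<phi> within {0..pi/2})"
        unfolding c_def
        by (rule has_vector_derivative_real_field[where f = "\<lambda>w. of_real t * exp (- (\<i> * w))"])
           (auto intro!: derivative_eq_intros)
      from field_vector_diff_chain_within[OF this has_field_derivative_at_within[OF \<Phi>']]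
      show "((\<lambda>\<phi>. \<Phi> (c \<phi>)) has_vector_derivative mellin_integrand \<alpha> (c \<phi>) * (- \<i> * c \<phi>)) (at \<phi> within {0..pi/2})"
        by (simp add: o_def mult.commute)
    qed auto
    note int = this
    have "cmod (\<Phi> (c (pi/2)) - \<Phi> (c 0)) \<le> (t * B) * measure lborel {0..pi/2}"
    proof (rule has_integral_bound_real[OF _ finite.emptyI int])
      fix \<phi> assume "\<phi> \<in> {0..pi/2} - {}"
      hence "cmod (mellin_integrand \<alpha> (c \<phi>)) \<le> B"
        using c_cos t by (intro B) (auto simp: c_norm c_Re)
      thus "cmod (mellin_integrand \<alpha> (c \<phi>) * (- \<i> * c \<phi>)) \<le> t * B"
        using t by (simp add: norm_mult c_norm mult.commute)
    next
      show "0 \<le> t * B" using t order_trans[OF norm_ge_zero B[of "of_real t"]] by simp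
    qed
    moreover have "c (pi/2) = - \<i> * of_real t" "c 0 = of_real t"
      by (auto simp: complex_eq_iff c_Re)
    ultimately show ?thesis by (simp add: F_def norm_minus_commute)
  qed
  have "(LINT t:{0<..}|lborel. mellin_integrand \<alpha> (of_real t) + \<i> * mellin_integrand \<alpha> (- \<i> * of_real t)) = 0"
  proof (rule improper_FTC[where F = F])
    fix t :: real assume t: "t > 0"
    have n1: "complex_of_real t \<notin> \<real>\<^sub>\<le>\<^sub>0" and n2: "- \<i> * complex_of_real t \<notin> \<real>\<^sub>\<le>\<^sub>0"
      using t by (auto simp: complex_nonpos_Reals_iff)
    have "(complex_of_real has_vector_derivative 1) (at t)"
      by (auto intro!: derivative_eq_intros simp: has_vector_derivative_complex_iff)
    from field_vector_diff_chain_at[OF this \<Phi>[OF n1]]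
    have 1: "((\<lambda>t. \<Phi> (of_real t)) has_vector_derivative mellin_integrand \<alpha> (of_real t)) (at t)"
      by (simp add: o_def)
    have "((\<lambda>t. - \<i> * complex_of_real t) has_vector_derivative - \<i>) (at t)"
      by (auto intro!: derivative_eq_intros simp: has_vector_derivative_complex_iff)
    from field_vector_diff_chain_at[OF this \<Phi>[OF n2]]
    have 2: "((\<lambda>t. \<Phi> (- \<i> * of_real t)) has_vector_derivative - \<i> * mellin_integrand \<alpha> (- \<i> * of_real t)) (at t)"
      by (simp add: o_def)
    show "(F has_vector_derivative mellin_integrand \<alpha> (of_real t) + \<i> * mellin_integrand \<alpha> (- \<i> * of_real t)) (at t)"
      unfolding F_def using has_vector_derivative_diff[OF 1 2] by simp
    have "isCont complex_of_real t" "isCont (\<lambda>t. - \<i> * complex_of_real t) t"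
      by (intro continuous_intros)+
    from isCont_o2[OF this(1), of "mellin_integrand \<alpha>"] isCont_o2[OF this(2), of "mellin_integrand \<alpha>"]
    have "isCont (\<lambda>t. mellin_integrand \<alpha> (of_real t)) t"
      "isCont (\<lambda>t. mellin_integrand \<alpha> (- \<i> * of_real t)) t"
      using n1 n2 by (blast intro: field_differentiable_imp_continuous_at mellin_integrand_differentiable)+
    thus "isCont (\<lambda>t. mellin_integrand \<alpha> (of_real t) + \<i> * mellin_integrand \<alpha> (- \<i> * of_real t)) t"
      by (intro continuous_intros)
  next
    show "set_integrable lborel {0<..} (\<lambda>t. mellin_integrand \<alpha> (of_real t) + \<i> * mellin_integrand \<alpha> (- \<i> * of_real t))"
      using mellin_ray_integrable[of 1 \<alpha>] mellin_ray_integrable[of "- \<i>" \<alpha>]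
      by (intro set_integral_add set_integrable_mult_right) (auto simp: mult.commute)
    show "cmod (F t) \<le> M * (pi/2) * t powr (1/2)" if t: "0 < t" "t < 1" for t
    proof -
      have "cmod (F t) \<le> (t * (M * t powr (-1/2))) * (pi / 2)"
      proof (rule arc)
        fix w :: complex assume "cmod w = t" "Re w \<ge> 0"
        thus "cmod (mellin_integrand \<alpha> w) \<le> M * t powr (-1/2)"
          using mellin_integrand_bound(1)[of w \<alpha>] t by (auto simp: M_def)
      qed (use t in auto)
      also have "\<dots> = M * (pi/2) * (t powr 1 * t powr (-1/2))" using t by simp
      also have "t powr 1 * t powr (-1/2) = t powr (1/2)"
        by (simp only: powr_add[symmetric]) simp
      finally show ?thesis .
    qed
    show "cmod (F t) \<le> M * (pi/2) * t powr (-1/2)" if t: "t \<ge> 1" for t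
    proof -
      have "cmod (F t) \<le> (t * (M * t powr (-3/2))) * (pi / 2)"
      proof (rule arc)
        fix w :: complex assume "cmod w = t" "Re w \<ge> 0"
        thus "cmod (mellin_integrand \<alpha> w) \<le> M * t powr (-3/2)"
          using mellin_integrand_bound(2)[of w \<alpha>] t by (cases "w = 0") (auto simp: M_def)
      qed (use t in auto)
      also have "\<dots> = M * (pi/2) * (t powr 1 * t powr (-3/2))" using t by simp
      also have "t powr 1 * t powr (-3/2) = t powr (-1/2)"
        by (simp only: powr_add[symmetric]) simp
      finally show ?thesis .
    qed
  qed
  moreover have "(LINT t:{0<..}|lborel. mellin_integrand \<alpha> (of_real t) + \<i> * mellin_integrand \<alpha> (- \<i> * of_real t))
      = (LINT t:{0<..}|lborel. mellin_integrand \<alpha> (of_real t))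
         + \<i> * (LINT t:{0<..}|lborel. mellin_integrand \<alpha> (- \<i> * of_real t))"
    using mellin_ray_integrable[of 1 \<alpha>] mellin_ray_integrable[of "- \<i>" \<alpha>]
    by (subst set_integral_add) (auto simp: mult.commute intro!: set_integrable_mult_right)
  ultimately show ?thesis by (simp add: add_eq_0_iff2)
qed

text \<open>
On this ray the argument is constant, so the complex power only contributes the constant \<open>c\<close>.
\<close>

lemma mellin_imaginary_axis:
  "\<exists>c. (LINT t:{0<..}|lborel. mellin_integrand \<alpha> (- \<i> * of_real t)) = c * C_res \<alpha>"
proof -
  define c where "c = exp (- (- 5/2 - \<i> * of_real \<alpha>) * \<i> * of_real (pi/2))"
  have "(LINT t:{0<..}|lborel. mellin_integrand \<alpha> (- \<i> * of_real t)) =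
      (LINT t:{0<..}|lborel. c * (complex_of_real t powr (- 5/2 - \<i> * of_real \<alpha>) *
          (exp (\<i> * of_real t) - 1 - \<i> * of_real t)))"
    unfolding set_lebesgue_integral_def
  proof (rule Bochner_Integration.integral_cong[OF refl])
    fix t :: real
    show "indicator {0<..} t *\<^sub>R mellin_integrand \<alpha> (- \<i> * of_real t) =
          indicator {0<..} t *\<^sub>R (c * (complex_of_real t powr (- 5/2 - \<i> * of_real \<alpha>) *
            (exp (\<i> * of_real t) - 1 - \<i> * of_real t)))"
    proof (cases "t > 0")
      case True
      have "Ln (of_real t * - \<i>) = of_real (ln t) + Ln (- \<i>)"
        using True by (subst Ln_times_of_real) (auto simp: Ln_of_real)
      hence "Ln (- \<i> * of_real t) = of_real (ln t) - \<i> * of_real (pi/2)"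
        by (simp add: mult.commute)
      moreover have "(- 5/2 - \<i> * of_real \<alpha>) * (of_real (ln t) - \<i> * of_real (pi/2)) =
          - (- 5/2 - \<i> * of_real \<alpha>) * \<i> * of_real (pi/2) + (- 5/2 - \<i> * of_real \<alpha>) * of_real (ln t)"
        by (simp add: algebra_simps)
      moreover have "Ln (of_real t) = of_real (ln t)" using True by (rule Ln_of_real)
      ultimately have "(- \<i> * of_real t) powr (- 5/2 - \<i> * of_real \<alpha>) =
          c * complex_of_real t powr (- 5/2 - \<i> * of_real \<alpha>)"
        using True unfolding powr_def c_def by (simp add: exp_add)
      thus ?thesis using True by (simp add: mellin_integrand_def laplace_rem_def)
    qed auto
  qed
  also have "\<dots> = c * C_res \<alpha>" by (simp add: C_res_def)
  finally show ?thesis by blast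
qed

text \<open>
Two integrations by parts reduce the integral to Euler's integral at \<open>z + 2 = 1/2 - \<i> \<alpha>\<close>. They are carried
out at once: \<open>G\<close> is the sum of both boundary terms.
\<close>

lemma mellin_positive_axis:
  fixes \<alpha> :: real
  defines "z \<equiv> - 3/2 - \<i> * of_real \<alpha>"
  shows "(LINT t:{0<..}|lborel. mellin_integrand \<alpha> (of_real t)) = Gamma (z + 2) / (z * (z + 1))"
proof -
  have z: "z \<noteq> 0" "z + 1 \<noteq> 0" "Re (z + 2) > 0" by (auto simp: z_def complex_eq_iff)
  define E where "E t = of_real t powr (z + 2 - 1) / of_real (exp t)" for t :: real
  have "set_integrable lebesgue {0<..} E"
    using absolutely_integrable_Gamma_integral'[OF z(3)] by (simp add: E_def[abs_def])
  have E_cont: "isCont E t" if "t > 0" for t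
    unfolding E_def using that
    by (intro continuous_intros) (auto simp: complex_nonpos_Reals_iff)
  have E_meas: "(\<lambda>t. indicator {0<..} t *\<^sub>R E t) \<in> borel_measurable borel"
    by (rule borel_measurable_continuous_on_indicator)
       (auto intro!: continuous_at_imp_continuous_on E_cont)
  have E_int: "set_integrable lborel {0<..} E"
    using \<open>set_integrable lebesgue {0<..} E\<close> E_meas
    by (simp add: set_integrable_def integrable_completion)
  have E_val: "(LINT t:{0<..}|lborel. E t) = Gamma (z + 2)"
  proof -
    have "(LINT t:{0<..}|lborel. E t) = (LINT t:{0<..}|lebesgue. E t)"
      using E_meas by (simp add: set_lebesgue_integral_def integral_completion)
    also have "\<dots> = integral {0<..} E"
      by (rule set_lebesgue_integral_eq_integral) fact
    also have "\<dots> = Gamma (z + 2)"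
      using Gamma_integral_complex'[OF z(3)] by (intro integral_unique) (simp add: E_def[abs_def])
    finally show ?thesis .
  qed
  define G where "G w = w powr z * laplace_rem w / z - w powr (z + 1) * (1 - exp (- w)) / (z * (z + 1))" for w
  have G_norm: "cmod (G (of_real t)) \<le> (a * t powr (-3/2 + p) + b * t powr (-1/2 + q)) * (1 / cmod z + 1 / cmod (z * (z + 1)))"
    if t: "t > 0" and k: "cmod (laplace_rem (of_real t)) \<le> a * t powr p" and e: "\<bar>1 - exp (- t)\<bar> \<le> b * t powr q"
      for t a b p q
  proof -
    have a: "a * t powr p \<ge> 0" "b * t powr q \<ge> 0" using order_trans[OF norm_ge_zero k] order_trans[OF abs_ge_zero e] by auto
    have n: "cmod (of_real t powr z) = t powr (-3/2)" "cmod (of_real t powr (z + 1)) = t powr (-1/2)"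
      using t by (simp_all add: norm_powr_real_powr z_def)
    have e': "cmod (1 - exp (- of_real t)) \<le> b * t powr q"
      using e by (metis norm_of_real of_real_1 of_real_diff exp_of_real of_real_minus real_norm_def)
    have "cmod (G (of_real t)) \<le> t powr (-3/2) * cmod (laplace_rem (of_real t)) / cmod z
            + t powr (-1/2) * cmod (1 - exp (- of_real t)) / cmod (z * (z + 1))"
      unfolding G_def by (rule order_trans[OF norm_triangle_ineq4]) (simp add: norm_mult norm_divide n)
    also have "\<dots> \<le> t powr (-3/2) * (a * t powr p) / cmod z + t powr (-1/2) * (b * t powr q) / cmod (z * (z + 1))"
      by (intro add_mono divide_right_mono mult_left_mono k e') auto
    also have "\<dots> = (a * t powr (-3/2 + p)) / cmod z + (b * t powr (-1/2 + q)) / cmod (z * (z + 1))"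
      by (simp only: powr_add mult_ac)
    also have "\<dots> \<le> (a * t powr (-3/2 + p) + b * t powr (-1/2 + q)) / cmod z
        + (a * t powr (-3/2 + p) + b * t powr (-1/2 + q)) / cmod (z * (z + 1))"
    proof -
      have "0 \<le> a * t powr (-3/2 + p)" "0 \<le> b * t powr (-1/2 + q)"
        using mult_nonneg_nonneg[OF a(1), of "t powr (-3/2)"] mult_nonneg_nonneg[OF a(2), of "t powr (-1/2)"]
        by (simp_all only: powr_add mult_ac powr_ge_zero)
      thus ?thesis by (intro add_mono divide_right_mono) auto
    qed
    finally show ?thesis by (simp only: distrib_left times_divide_eq_right mult_1_right)
  qed
  define N where "N = 1 / cmod z + 1 / cmod (z * (z + 1))"
  have "(LINT t:{0<..}|lborel. mellin_integrand \<alpha> (of_real t) - 1 / (z * (z + 1)) * E t) = 0"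
  proof (rule improper_FTC[where F = "\<lambda>t. G (of_real t)"])
    fix t :: real assume t: "t > 0"
    have n: "complex_of_real t \<notin> \<real>\<^sub>\<le>\<^sub>0" using t by (simp add: complex_nonpos_Reals_iff)
    define T where "T = complex_of_real t"
    have T: "T \<notin> \<real>\<^sub>\<le>\<^sub>0" using n by (simp add: T_def)
    have "(G has_field_derivative
        (z * T powr (z - 1) * laplace_rem T + T powr z * (1 - exp (- T))) / z -
        ((z + 1) * T powr z * (1 - exp (- T)) + T powr (z + 1) * exp (- T)) / (z * (z + 1))) (at T)"
      unfolding G_def laplace_rem_def using T z
      by (auto intro!: derivative_eq_intros simp: mult.commute)
    also have "(z * T powr (z - 1) * laplace_rem T + T powr z * (1 - exp (- T))) / z -
        ((z + 1) * T powr z * (1 - exp (- T)) + T powr (z + 1) * exp (- T)) / (z * (z + 1))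
        = mellin_integrand \<alpha> T - 1 / (z * (z + 1)) * E t"
    proof -
      have "T powr (z - 1) * laplace_rem T = mellin_integrand \<alpha> T"
        by (simp add: mellin_integrand_def z_def)
      moreover have "T powr (z + 1) * exp (- T) = E t"
        by (simp add: E_def T_def exp_minus exp_of_real[symmetric] field_simps)
      moreover have "((z + 1) * x * y + e) / (z * (z + 1)) = x * y / z + 1 / (z * (z + 1)) * e" for x y e
        unfolding add_divide_distrib using z by (simp add: mult.commute[of z "z + 1"] mult.assoc)
      moreover have "(z * x + v) / z = x + v / z" for x v
        using z by (simp add: field_simps)
      ultimately show ?thesis by (simp add: mult.assoc)
    qed
    finally show "((\<lambda>t. G (of_real t)) has_vector_derivative
        mellin_integrand \<alpha> (of_real t) - 1 / (z * (z + 1)) * E t) (at t)"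
      unfolding T_def by (rule has_vector_derivative_real_field)
    have "isCont complex_of_real t" by (intro continuous_intros)
    from isCont_o2[OF this, of "mellin_integrand \<alpha>"]
    have "isCont (\<lambda>t. mellin_integrand \<alpha> (of_real t)) t"
      using n by (blast intro: field_differentiable_imp_continuous_at mellin_integrand_differentiable)
    thus "isCont (\<lambda>t. mellin_integrand \<alpha> (of_real t) - 1 / (z * (z + 1)) * E t) t"
      by (intro continuous_intros E_cont t)
  next
    show "set_integrable lborel {0<..} (\<lambda>t. mellin_integrand \<alpha> (of_real t) - 1 / (z * (z + 1)) * E t)"
      using mellin_ray_integrable[of 1 \<alpha>] E_int by (intro set_integral_diff set_integrable_mult_right) auto
    show "cmod (G (of_real t)) \<le> 4 * N * t powr (1/2)" if t: "0 < t" "t < 1" for t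
    proof -
      have e: "\<bar>1 - exp (- t)\<bar> \<le> 1 * t powr 1"
        using exp_ge_add_one_self[of "- t"] t by simp
      have k: "cmod (laplace_rem (of_real t)) \<le> 3 * t powr 2"
        using laplace_rem_small[of "of_real t"] t by simp
      show ?thesis using G_norm[OF _ k e, folded N_def] t by (simp add: mult_ac)
    qed
    show "cmod (G (of_real t)) \<le> 4 * N * t powr (-1/2)" if t: "t \<ge> 1" for t
    proof -
      have e: "\<bar>1 - exp (- t)\<bar> \<le> 1 * t powr 0" using t by simp
      have k: "cmod (laplace_rem (of_real t)) \<le> 3 * t powr 1"
        using laplace_rem_large[of "of_real t"] t by simp
      show ?thesis using G_norm[OF _ k e, folded N_def] t by (simp add: mult_ac)
    qed
  qed
  moreover have "(LINT t:{0<..}|lborel. mellin_integrand \<alpha> (of_real t) - 1 / (z * (z + 1)) * E t)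
      = (LINT t:{0<..}|lborel. mellin_integrand \<alpha> (of_real t)) - 1 / (z * (z + 1)) * Gamma (z + 2)"
    using mellin_ray_integrable[of 1 \<alpha>] E_int
    by (subst set_integral_diff) (auto simp: E_val simp del: times_divide_eq_left intro!: set_integrable_mult_right)
  ultimately show ?thesis by simp
qed

lemma C_res_nonzero: "C_res \<alpha> \<noteq> 0"
proof
  assume "C_res \<alpha> = 0"
  hence "(LINT t:{0<..}|lborel. mellin_integrand \<alpha> (of_real t)) = 0"
    using mellin_imaginary_axis[of \<alpha>] mellin_rotate[of \<alpha>] by auto
  moreover have "Gamma (1/2 - \<i> * of_real \<alpha>) \<noteq> 0"
  proof
    assume "Gamma (1/2 - \<i> * complex_of_real \<alpha>) = 0"
    then obtain n where "1/2 - \<i> * complex_of_real \<alpha> = of_int n" "n \<le> 0"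
      by (auto simp: Gamma_eq_zero_iff elim!: nonpos_Ints_cases)
    from arg_cong[OF this(1), of Re] this(2) show False by simp
  qed
  moreover have "- 3/2 - \<i> * complex_of_real \<alpha> + 2 = 1/2 - \<i> * of_real \<alpha>" by simp
  moreover have "- 3/2 - \<i> * complex_of_real \<alpha> \<noteq> 0" "- 3/2 - \<i> * complex_of_real \<alpha> + 1 \<noteq> 0"
    by (auto simp: complex_eq_iff)
  ultimately show False
    using mellin_positive_axis[of \<alpha>] by (simp only: divide_eq_0_iff mult_eq_0_iff) auto
qed

section \<open>Fourier inversion and Hoelder continuity\<close>

lemma integrable_gauss:
  assumes "h \<noteq> 0"
  shows "integrable lborel (\<lambda>\<zeta>::real. exp (- ((h * \<zeta>)\<^sup>2) / 2))"
proof -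
  have "integrable lborel (\<lambda>x::real. sqrt (2 * pi) * std_normal_density x)"
    by (intro integrable_mult_right) (rule integrable_normal_density, simp)
  hence "integrable lborel (\<lambda>x::real. exp (- (x\<^sup>2) / 2))"
    by (simp add: std_normal_density_def)
  from lborel_integrable_real_affine[OF this assms, of 0] show ?thesis by simp
qed

lemma gauss_fourier:
  assumes "h \<noteq> 0"
  shows "(LINT \<zeta>|lborel. iexp (a * \<zeta>) * of_real (exp (- ((h * \<zeta>)\<^sup>2) / 2)))
          = of_real (sqrt (2 * pi) / \<bar>h\<bar> * exp (- ((a / h)\<^sup>2) / 2))"
proof -
  have 1: "(LINT x|lborel. std_normal_density x *\<^sub>R iexp (a / h * x)) = of_real (exp (- ((a / h)\<^sup>2) / 2))"
  proof -
    have "char std_normal_distribution (a / h) = of_real (exp (- ((a / h)\<^sup>2) / 2))"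
      by (simp add: char_std_normal_distribution)
    thus ?thesis unfolding char_def by (subst (asm) integral_density) auto
  qed
  have 2: "(LINT x|lborel. iexp (a / h * x) * of_real (exp (- (x\<^sup>2) / 2)))
          = of_real (sqrt (2 * pi)) * of_real (exp (- ((a / h)\<^sup>2) / 2))"
    unfolding 1[symmetric] integral_mult_right_zero[symmetric]
    by (intro Bochner_Integration.integral_cong refl)
       (simp add: std_normal_density_def scaleR_conv_of_real field_simps)
  have 3: "(LINT x|lborel. iexp (a / h * x) * of_real (exp (- (x\<^sup>2) / 2))) =
         \<bar>h\<bar> *\<^sub>R (LINT \<zeta>|lborel. iexp (a / h * (0 + h * \<zeta>)) * of_real (exp (- ((0 + h * \<zeta>)\<^sup>2) / 2)))"
    by (rule lborel_integral_real_affine[OF assms])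
  have 4: "iexp (a / h * (0 + h * \<zeta>)) * of_real (exp (- ((0 + h * \<zeta>)\<^sup>2) / 2)) =
           iexp (a * \<zeta>) * of_real (exp (- ((h * \<zeta>)\<^sup>2) / 2))" for \<zeta>
    using assms by simp
  from 2 show ?thesis
    unfolding 3 4 using assms by (simp add: scaleR_conv_of_real field_simps)
qed

lemma borel_measurable_fourier [measurable]:
  assumes [measurable]: "f \<in> borel_measurable borel"
  shows "fourier f \<in> borel_measurable borel"
proof -
  have "(\<lambda>\<zeta>. LINT y|lborel. exp (- (\<i> * of_real (\<zeta> * y))) * f y) \<in> borel_measurable lborel"
    by measurable
  thus ?thesis by (simp add: fourier_def[abs_def])
qed

lemma fourier_bound:
  assumes "integrable lborel f"
  shows "cmod (fourier f \<zeta>) \<le> (LINT y|lborel. cmod (f y))"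
  using integral_norm_bound[of lborel "\<lambda>y. exp (- (\<i> * of_real (\<zeta> * y))) * f y"]
  by (simp add: fourier_def norm_mult norm_exp_eq_Re)

text \<open>
The multiplication formula. It yields both square integrability of transforms and inversion, with Gaussians as
test functions.
\<close>

lemma fourier_exchange:
  assumes f: "integrable lborel f" and g: "integrable lborel g"
  shows "(LINT \<zeta>|lborel. fourier f \<zeta> * g \<zeta>) = (LINT y|lborel. f y * fourier g y)"
proof -
  have [measurable]: "f \<in> borel_measurable borel" "g \<in> borel_measurable borel"
    using f g by (auto dest: borel_measurable_integrable)
  have i: "integrable (lborel \<Otimes>\<^sub>M lborel) (\<lambda>(\<zeta>, y). exp (- (\<i> * of_real (\<zeta> * y))) * f y * g \<zeta>)"
  proof (rule lborel_pair.Fubini_integrable)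
    show "(\<lambda>(\<zeta>, y). exp (- (\<i> * of_real (\<zeta> * y))) * f y * g \<zeta>) \<in> borel_measurable (lborel \<Otimes>\<^sub>M lborel)"
      by measurable
    show "integrable lborel (\<lambda>\<zeta>. LINT y|lborel. norm (case (\<zeta>, y) of (\<zeta>, y) \<Rightarrow> exp (- (\<i> * of_real (\<zeta> * y))) * f y * g \<zeta>))"
      using g by (simp add: norm_mult norm_exp_eq_Re)
    show "AE \<zeta> in lborel. integrable lborel (\<lambda>y. case (\<zeta>, y) of (\<zeta>, y) \<Rightarrow> exp (- (\<i> * of_real (\<zeta> * y))) * f y * g \<zeta>)"
    proof (rule AE_I2)
      fix \<zeta> :: real
      have "integrable lborel (\<lambda>y. exp (- (\<i> * of_real (\<zeta> * y))) * f y)"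
        by (rule Bochner_Integration.integrable_bound[OF f]) (auto simp: norm_mult norm_exp_eq_Re)
      thus "integrable lborel (\<lambda>y. case (\<zeta>, y) of (\<zeta>, y) \<Rightarrow> exp (- (\<i> * of_real (\<zeta> * y))) * f y * g \<zeta>)"
        by simp
    qed
  qed
  have "(LINT \<zeta>|lborel. fourier f \<zeta> * g \<zeta>) =
          (LINT \<zeta>|lborel. LINT y|lborel. exp (- (\<i> * of_real (\<zeta> * y))) * f y * g \<zeta>)"
    by (simp add: fourier_def)
  also have "\<dots> = (LINT y|lborel. LINT \<zeta>|lborel. exp (- (\<i> * of_real (\<zeta> * y))) * f y * g \<zeta>)"
    by (rule lborel_pair.Fubini_integral[OF i, symmetric])
  also have "\<dots> = (LINT y|lborel. f y * fourier g y)"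
    unfolding fourier_def
    by (intro Bochner_Integration.integral_cong refl, subst integral_mult_right_zero[symmetric])
       (simp add: mult_ac)
  finally show ?thesis .
qed

text \<open>
The modulation by \<open>x\<close> moves the centre of the transform, which is the kernel below, to the point \<open>x\<close>;
\<open>h\<close> is its width, and its mass is \<open>2 pi\<close>, the normalizing factor of Fourier inversion.
\<close>

definition gauss_wave :: "real \<Rightarrow> real \<Rightarrow> real \<Rightarrow> complex" where
  "gauss_wave h x \<zeta> = iexp (x * \<zeta>) * of_real (exp (- ((h * \<zeta>)\<^sup>2) / 2))"

definition heat_kernel :: "real \<Rightarrow> real \<Rightarrow> real" where
  "heat_kernel h v = sqrt (2 * pi) / \<bar>h\<bar> * exp (- ((v / h)\<^sup>2) / 2)"

lemma gauss_wave_measurable [measurable]: "gauss_wave h x \<in> borel_measurable borel"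
  unfolding gauss_wave_def by measurable

lemma gauss_wave_norm: "cmod (gauss_wave h x \<zeta>) = exp (- ((h * \<zeta>)\<^sup>2) / 2)"
  by (simp add: gauss_wave_def norm_mult del: of_real_mult of_real_exp)

lemma integrable_gauss_wave: "h \<noteq> 0 \<Longrightarrow> integrable lborel (gauss_wave h x)"
  by (rule Bochner_Integration.integrable_bound[OF integrable_gauss]) (auto simp: gauss_wave_norm)

lemma fourier_gauss_wave:
  assumes "h \<noteq> 0"
  shows "fourier (gauss_wave h x) y = of_real (heat_kernel h (x - y))"
proof -
  have "fourier (gauss_wave h x) y = (LINT \<zeta>|lborel. iexp ((x - y) * \<zeta>) * of_real (exp (- ((h * \<zeta>)\<^sup>2) / 2)))"
    unfolding fourier_def gauss_wave_def
  proof (intro Bochner_Integration.integral_cong refl)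
    fix \<zeta> :: real
    have "- (\<i> * of_real (y * \<zeta>)) + \<i> * of_real (x * \<zeta>) = \<i> * of_real ((x - y) * \<zeta>)"
      by (simp add: algebra_simps)
    hence "exp (- (\<i> * of_real (y * \<zeta>))) * iexp (x * \<zeta>) = iexp ((x - y) * \<zeta>)"
      by (simp only: exp_add[symmetric])
    thus "exp (- (\<i> * of_real (y * \<zeta>))) * (iexp (x * \<zeta>) * of_real (exp (- ((h * \<zeta>)\<^sup>2) / 2)))
            = iexp ((x - y) * \<zeta>) * of_real (exp (- ((h * \<zeta>)\<^sup>2) / 2))"
      by (simp only: mult.assoc[symmetric])
  qed
  thus ?thesis by (simp only: gauss_fourier[OF assms] heat_kernel_def)
qed

lemma heat_kernel_nonneg: "heat_kernel h v \<ge> 0"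
  by (simp add: heat_kernel_def)

lemma integrable_heat_kernel: "h \<noteq> 0 \<Longrightarrow> integrable lborel (\<lambda>y. heat_kernel h (x - y))"
proof -
  assume h: "h \<noteq> 0"
  have "integrable lborel (heat_kernel h)"
    unfolding heat_kernel_def using integrable_gauss[of "1/h"] h by (simp)
  from lborel_integrable_real_affine[OF this, of "-1" x] show ?thesis by simp
qed

lemma integral_heat_kernel:
  fixes f :: "real \<Rightarrow> complex"
  assumes "h \<noteq> 0"
  shows "(LINT y|lborel. f y * of_real (heat_kernel h (x - y)))
           = of_real (2 * pi) * (LINT v|lborel. f (x + h * v) * of_real (std_normal_density v))"
proof -
  have "(LINT y|lborel. f y * of_real (heat_kernel h (x - y)))
          = \<bar>h\<bar> *\<^sub>R (LINT v|lborel. f (x + h * v) * of_real (heat_kernel h (x - (x + h * v))))"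
    by (rule lborel_integral_real_affine[OF assms])
  also have "\<dots> = (LINT v|lborel. of_real (2 * pi) * (f (x + h * v) * of_real (std_normal_density v)))"
  proof (subst integral_scaleR_right[symmetric], intro Bochner_Integration.integral_cong refl)
    fix v :: real
    have "\<bar>h\<bar> * heat_kernel h (x - (x + h * v)) = sqrt (2 * pi) * exp (- v\<^sup>2 / 2)"
      using assms by (simp add: heat_kernel_def)
    also have "sqrt (2 * pi) = 2 * pi / sqrt (2 * pi)" by (rule real_div_sqrt[symmetric]) simp
    finally have "\<bar>h\<bar> * heat_kernel h (x - (x + h * v)) = 2 * pi * std_normal_density v"
      by (simp add: std_normal_density_def)
    hence "complex_of_real (\<bar>h\<bar> * heat_kernel h (x - (x + h * v))) = of_real (2 * pi * std_normal_density v)"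
      by simp
    thus "\<bar>h\<bar> *\<^sub>R (f (x + h * v) * of_real (heat_kernel h (x - (x + h * v)))) =
        of_real (2 * pi) * (f (x + h * v) * of_real (std_normal_density v))"
      unfolding scaleR_conv_of_real of_real_mult by (simp add: mult_ac)
  qed
  finally show ?thesis by simp
qed

lemma integral_heat_kernel_total:
  assumes "h \<noteq> 0"
  shows "(LINT y|lborel. heat_kernel h (x - y)) = 2 * pi"
proof -
  have "(LINT v|lborel. std_normal_density v) = 1"
    using integral_normal_density[of 1 0] by simp
  hence "complex_of_real (LINT y|lborel. heat_kernel h (x - y)) = of_real (2 * pi)"
    using integral_heat_kernel[OF assms, of "\<lambda>_. 1" x] by (simp del: of_real_mult)
  thus ?thesis by (simp only: of_real_eq_iff)
qed

text \<open>
A crude form of Plancherel's theorem. Two applications of the multiplication formula bound the integral of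
\<open>|fourier f|\<^sup>2\<close> against a Gaussian weight by \<open>2 pi\<close> times \<open>sup |f|\<close> times the \<open>L\<^sup>1\<close> norm of \<open>f\<close>,
uniformly in the width; Fatou's lemma removes the weight. The boundedness of the truncated profile is what makes
this sufficient here.
\<close>

lemma fourier_in_L2:
  assumes f: "integrable lborel f" and B: "\<And>y. cmod (f y) \<le> B"
  shows "in_L2 (fourier f)"
proof -
  have [measurable]: "f \<in> borel_measurable borel" using f by (auto dest: borel_measurable_integrable)
  define C where "C = 2 * pi * B * (LINT y|lborel. cmod (f y))"
  have B0: "B \<ge> 0" using order_trans[OF norm_ge_zero B] .
  have bd: "(LINT \<zeta>|lborel. (cmod (fourier f \<zeta>))\<^sup>2 * exp (- ((h * \<zeta>)\<^sup>2) / 2)) \<le> C"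
    and int: "integrable lborel (\<lambda>\<zeta>. (cmod (fourier f \<zeta>))\<^sup>2 * exp (- ((h * \<zeta>)\<^sup>2) / 2))" if h: "h \<noteq> 0" for h
  proof -
    define g where "g \<zeta> = cnj (fourier f \<zeta>) * of_real (exp (- ((h * \<zeta>)\<^sup>2) / 2))" for \<zeta>
    have [measurable]: "cnj \<in> borel_measurable borel"
      by (intro borel_measurable_continuous_onI continuous_intros)
    have [measurable]: "g \<in> borel_measurable borel" unfolding g_def by measurable
    have g: "integrable lborel g"
      by (rule Bochner_Integration.integrable_bound
            [OF integrable_mult_right[OF integrable_gauss[OF h]], of _ "LINT y|lborel. cmod (f y)"])
         (auto simp: g_def norm_mult intro!: mult_right_mono order_trans[OF fourier_bound[OF f]])
    show int: "integrable lborel (\<lambda>\<zeta>. (cmod (fourier f \<zeta>))\<^sup>2 * exp (- ((h * \<zeta>)\<^sup>2) / 2))"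
    proof (rule Bochner_Integration.integrable_bound)
      show "integrable lborel (\<lambda>\<zeta>. (LINT y|lborel. cmod (f y))\<^sup>2 * exp (- ((h * \<zeta>)\<^sup>2) / 2))"
        by (intro integrable_mult_right integrable_gauss h)
    qed (auto simp: norm_mult intro!: mult_right_mono power_mono fourier_bound f)
    have gh: "fourier g y = cnj (LINT w|lborel. f w * of_real (heat_kernel h (y - w)))" for y
    proof -
      have "fourier g y = (LINT \<zeta>|lborel. cnj (fourier f \<zeta> * gauss_wave h y \<zeta>))"
        unfolding fourier_def[of g] g_def gauss_wave_def
        by (intro Bochner_Integration.integral_cong refl) (simp add: exp_cnj mult_ac)
      also have "\<dots> = cnj (LINT \<zeta>|lborel. fourier f \<zeta> * gauss_wave h y \<zeta>)"
        by (rule Bochner_Integration.integral_cnj)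
      also have "(LINT \<zeta>|lborel. fourier f \<zeta> * gauss_wave h y \<zeta>) = (LINT w|lborel. f w * of_real (heat_kernel h (y - w)))"
        by (simp add: fourier_exchange[OF f integrable_gauss_wave[OF h]] fourier_gauss_wave[OF h])
      finally show ?thesis .
    qed
    have gb: "cmod (fourier g y) \<le> B * (2 * pi)" for y
    proof -
      have "cmod (fourier g y) \<le> (LINT w|lborel. cmod (f w * of_real (heat_kernel h (y - w))))"
        unfolding gh complex_mod_cnj by (rule integral_norm_bound)
      also have "\<dots> \<le> (LINT w|lborel. B * heat_kernel h (y - w))"
      proof (rule integral_mono')
        show "integrable lborel (\<lambda>w. B * heat_kernel h (y - w))"
          by (intro integrable_mult_right integrable_heat_kernel h)
      qed (use B0 in \<open>auto simp: norm_mult heat_kernel_nonneg intro!: mult_right_mono B mult_nonneg_nonneg\<close>)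
      also have "\<dots> = B * (2 * pi)" using integral_heat_kernel_total[OF h, of y] by simp
      finally show ?thesis .
    qed
    have "complex_of_real (LINT \<zeta>|lborel. (cmod (fourier f \<zeta>))\<^sup>2 * exp (- ((h * \<zeta>)\<^sup>2) / 2))
            = (LINT \<zeta>|lborel. fourier f \<zeta> * g \<zeta>)"
      unfolding integral_complex_of_real[symmetric] g_def
      by (intro Bochner_Integration.integral_cong refl)
         (simp add: complex_norm_square mult.assoc[symmetric] del: of_real_power)
    also have "\<dots> = (LINT y|lborel. f y * fourier g y)"
      by (rule fourier_exchange[OF f g])
    finally have eq: "complex_of_real (LINT \<zeta>|lborel. (cmod (fourier f \<zeta>))\<^sup>2 * exp (- ((h * \<zeta>)\<^sup>2) / 2))
            = (LINT y|lborel. f y * fourier g y)" .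
    have "(LINT \<zeta>|lborel. (cmod (fourier f \<zeta>))\<^sup>2 * exp (- ((h * \<zeta>)\<^sup>2) / 2))
        \<le> cmod (LINT y|lborel. f y * fourier g y)"
      unfolding eq[symmetric] norm_of_real by (rule abs_ge_self)
    also have "\<dots> \<le> (LINT y|lborel. cmod (f y * fourier g y))" by (rule integral_norm_bound)
    also have "\<dots> \<le> (LINT y|lborel. cmod (f y) * (B * (2 * pi)))"
      by (rule integral_mono') (use f B0 in \<open>auto simp: norm_mult intro!: mult_left_mono gb mult_nonneg_nonneg\<close>)
    finally show "(LINT \<zeta>|lborel. (cmod (fourier f \<zeta>))\<^sup>2 * exp (- ((h * \<zeta>)\<^sup>2) / 2)) \<le> C"
      by (simp add: C_def mult_ac)
  qed
  have "(\<integral>\<^sup>+\<zeta>. ennreal ((cmod (fourier f \<zeta>))\<^sup>2) \<partial>lborel)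
      = (\<integral>\<^sup>+\<zeta>. liminf (\<lambda>n. ennreal ((cmod (fourier f \<zeta>))\<^sup>2 * exp (- ((inverse (Suc n) * \<zeta>)\<^sup>2) / 2))) \<partial>lborel)"
  proof (intro nn_integral_cong lim_imp_Liminf[symmetric] trivial_limit_sequentially tendsto_ennrealI)
    fix \<zeta> :: real
    have "(\<lambda>n. (cmod (fourier f \<zeta>))\<^sup>2 * exp (- ((inverse (real (Suc n)) * \<zeta>)\<^sup>2) / 2))
            \<longlonglongrightarrow> (cmod (fourier f \<zeta>))\<^sup>2 * exp (- ((0 * \<zeta>)\<^sup>2) / 2)"
      by (intro tendsto_intros LIMSEQ_inverse_real_of_nat) auto
    thus "(\<lambda>n. (cmod (fourier f \<zeta>))\<^sup>2 * exp (- ((inverse (real (Suc n)) * \<zeta>)\<^sup>2) / 2))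
            \<longlonglongrightarrow> (cmod (fourier f \<zeta>))\<^sup>2" by simp
  qed
  also have "\<dots> \<le> liminf (\<lambda>n. \<integral>\<^sup>+\<zeta>. ennreal ((cmod (fourier f \<zeta>))\<^sup>2 * exp (- ((inverse (Suc n) * \<zeta>)\<^sup>2) / 2)) \<partial>lborel)"
    by (rule nn_integral_liminf) measurable
  also have "\<dots> \<le> ennreal C"
  proof (rule Liminf_le[OF trivial_limit_sequentially], rule always_eventually, rule allI)
    fix n
    have "inverse (real (Suc n)) \<noteq> 0" by simp
    from int[OF this] bd[OF this]
    show "(\<integral>\<^sup>+\<zeta>. ennreal ((cmod (fourier f \<zeta>))\<^sup>2 * exp (- ((inverse (Suc n) * \<zeta>)\<^sup>2) / 2)) \<partial>lborel) \<le> ennreal C"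
      by (subst nn_integral_eq_integral) (auto intro: ennreal_leI)
  qed
  finally have "(\<integral>\<^sup>+\<zeta>. ennreal ((cmod (fourier f \<zeta>))\<^sup>2) \<partial>lborel) < \<infinity>"
    by (rule le_less_trans) simp
  hence "integrable lborel (\<lambda>\<zeta>. (cmod (fourier f \<zeta>))\<^sup>2)"
    by (intro integrableI_bounded) auto
  thus ?thesis by (simp add: in_L2_def)
qed

lemma in_L2_add:
  assumes "in_L2 f" "in_L2 g"
  shows "in_L2 (\<lambda>x. f x + g x)"
proof -
  have [measurable]: "f \<in> borel_measurable borel" "g \<in> borel_measurable borel"
    using assms by (auto simp: in_L2_def)
  have "integrable lborel (\<lambda>x. (cmod (f x + g x))\<^sup>2)"
  proof (rule Bochner_Integration.integrable_bound)
    show "integrable lborel (\<lambda>x. 2 * (cmod (f x))\<^sup>2 + 2 * (cmod (g x))\<^sup>2)"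
      using assms by (intro Bochner_Integration.integrable_add integrable_mult_right) (auto simp: in_L2_def)
    have "(cmod (f x + g x))\<^sup>2 \<le> 2 * (cmod (f x))\<^sup>2 + 2 * (cmod (g x))\<^sup>2" for x
    proof -
      have "(cmod (f x + g x))\<^sup>2 \<le> (cmod (f x) + cmod (g x))\<^sup>2"
        by (intro power_mono norm_triangle_ineq) auto
      also have "\<dots> \<le> 2 * (cmod (f x))\<^sup>2 + 2 * (cmod (g x))\<^sup>2"
        using sum_squares_bound[of "cmod (f x)" "cmod (g x)"] by (simp add: power2_sum)
      finally show ?thesis .
    qed
    thus "AE x in lborel. norm ((cmod (f x + g x))\<^sup>2) \<le> norm (2 * (cmod (f x))\<^sup>2 + 2 * (cmod (g x))\<^sup>2)"
      by (intro AE_I2) (simp add: abs_of_nonneg)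
  qed measurable
  thus ?thesis by (simp add: in_L2_def)
qed

lemma in_L2_uminus: "in_L2 f \<Longrightarrow> in_L2 (\<lambda>x. - f x)"
  by (simp add: in_L2_def)

lemma in_L2_diff: "in_L2 f \<Longrightarrow> in_L2 g \<Longrightarrow> in_L2 (\<lambda>x. f x - g x)"
  using in_L2_add[OF _ in_L2_uminus, of f g] by simp

lemma L2_norm_nonneg: "L2_norm f \<ge> 0"
  by (simp add: L2_norm_def)

lemma L2_Cauchy_Schwarz:
  assumes f: "in_L2 f" and g: "in_L2 g"
  shows "integrable lborel (\<lambda>x. cmod (f x) * cmod (g x))"
    and "(LINT x|lborel. cmod (f x) * cmod (g x)) \<le> L2_norm f * L2_norm g"
proof -
  have [measurable]: "f \<in> borel_measurable borel" "g \<in> borel_measurable borel"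
    using assms by (auto simp: in_L2_def)
  show int: "integrable lborel (\<lambda>x. cmod (f x) * cmod (g x))"
  proof (rule Bochner_Integration.integrable_bound)
    show "integrable lborel (\<lambda>x. (cmod (f x))\<^sup>2 + (cmod (g x))\<^sup>2)"
      using assms by (auto simp: in_L2_def)
    have "cmod (f x) * cmod (g x) \<le> (cmod (f x))\<^sup>2 + (cmod (g x))\<^sup>2" for x
      using sum_squares_bound[of "cmod (f x)" "cmod (g x)"]
        mult_nonneg_nonneg[of "cmod (f x)" "cmod (g x)"] by (simp del: mult_nonneg_nonneg)
    thus "AE x in lborel. norm (cmod (f x) * cmod (g x)) \<le> norm ((cmod (f x))\<^sup>2 + (cmod (g x))\<^sup>2)"
      by (intro AE_I2) simp
  qed measurable
  let ?I = "LINT x|lborel. cmod (f x) * cmod (g x)"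
  have "(\<integral>\<^sup>+x. ennreal (cmod (f x)) * ennreal (cmod (g x)) \<partial>lborel)\<^sup>2
      \<le> (\<integral>\<^sup>+x. (ennreal (cmod (f x)))\<^sup>2 \<partial>lborel) * (\<integral>\<^sup>+x. (ennreal (cmod (g x)))\<^sup>2 \<partial>lborel)"
    by (rule Cauchy_Schwarz_nn_integral) measurable
  also have "(\<integral>\<^sup>+x. ennreal (cmod (f x)) * ennreal (cmod (g x)) \<partial>lborel) = ennreal ?I"
    by (subst nn_integral_eq_integral[OF int, symmetric]) (auto simp: ennreal_mult)
  also have "(\<integral>\<^sup>+x. (ennreal (cmod (f x)))\<^sup>2 \<partial>lborel) = ennreal (LINT x|lborel. (cmod (f x))\<^sup>2)"
    using f by (subst nn_integral_eq_integral[symmetric]) (auto simp: in_L2_def ennreal_power)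
  also have "(\<integral>\<^sup>+x. (ennreal (cmod (g x)))\<^sup>2 \<partial>lborel) = ennreal (LINT x|lborel. (cmod (g x))\<^sup>2)"
    using g by (subst nn_integral_eq_integral[symmetric]) (auto simp: in_L2_def ennreal_power)
  finally have "ennreal (?I\<^sup>2) \<le> ennreal ((LINT x|lborel. (cmod (f x))\<^sup>2) * (LINT x|lborel. (cmod (g x))\<^sup>2))"
    by (simp add: ennreal_power ennreal_mult)
  hence "?I\<^sup>2 \<le> (LINT x|lborel. (cmod (f x))\<^sup>2) * (LINT x|lborel. (cmod (g x))\<^sup>2)"
    by (subst (asm) ennreal_le_iff) auto
  hence "sqrt (?I\<^sup>2) \<le> sqrt ((LINT x|lborel. (cmod (f x))\<^sup>2) * (LINT x|lborel. (cmod (g x))\<^sup>2))"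
    by (rule real_sqrt_le_mono)
  thus "?I \<le> L2_norm f * L2_norm g"
    by (simp add: L2_norm_def real_sqrt_mult)
qed

lemma L2_pairing_bound:
  assumes "in_L2 f" "in_L2 g"
  shows "integrable lborel (\<lambda>x. f x * g x)"
    and "cmod (LINT x|lborel. f x * g x) \<le> L2_norm f * L2_norm g"
proof -
  have [measurable]: "f \<in> borel_measurable borel" "g \<in> borel_measurable borel"
    using assms by (auto simp: in_L2_def)
  show "integrable lborel (\<lambda>x. f x * g x)"
    by (rule Bochner_Integration.integrable_bound[OF L2_Cauchy_Schwarz(1)[OF assms]]) (auto simp: norm_mult)
  have "cmod (LINT x|lborel. f x * g x) \<le> (LINT x|lborel. cmod (f x * g x))" by (rule integral_norm_bound)
  thus "cmod (LINT x|lborel. f x * g x) \<le> L2_norm f * L2_norm g"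
    using L2_Cauchy_Schwarz(2)[OF assms] by (simp add: norm_mult)
qed

lemma gauss_wave_in_L2:
  assumes "h \<noteq> 0"
  shows "in_L2 (gauss_wave h x)"
proof -
  have "(exp (- ((h * \<zeta>)\<^sup>2) / 2))\<^sup>2 \<le> exp (- ((h * \<zeta>)\<^sup>2) / 2)" for \<zeta>
    using power_decreasing[of 1 2 "exp (- ((h * \<zeta>)\<^sup>2) / 2)"] by simp
  thus ?thesis unfolding in_L2_def gauss_wave_norm
    by (auto intro!: Bochner_Integration.integrable_bound[OF integrable_gauss[OF assms]])
qed

text \<open>
Tested against \<open>gauss_wave h x\<close>, the transforms of the truncations give the heat kernel average of the
truncated function at \<open>x\<close>. The truncation is removed by convergence in \<open>L\<^sup>2\<close> on one side and by
dominated convergence on the other, then \<open>h \<rightarrow> 0\<close>. The \<open>L\<^sup>2\<close> norm of a function outside \<open>L\<^sup>2\<close> carries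
no information, which is why the transforms of the truncations have to be known to lie in \<open>L\<^sup>2\<close>.
\<close>

lemma L2_fourier_inversion:
  assumes F: "is_L2_fourier A F" "integrable lborel F"
    and A: "continuous_on UNIV A" "\<And>x. cmod (A x) \<le> B"
  shows "of_real (2 * pi) * A x = (LINT \<zeta>|lborel. F \<zeta> * iexp (x * \<zeta>))"
proof -
  have [measurable]: "A \<in> borel_measurable borel" using A by (intro borel_measurable_continuous_onI)
  have F2: "in_L2 F" and Flim: "((\<lambda>R. L2_norm (\<lambda>\<zeta>. F \<zeta> - fourier (\<lambda>y. if \<bar>y\<bar> \<le> R then A y else 0) \<zeta>)) \<longlongrightarrow> 0) at_top"
    using F by (auto simp: is_L2_fourier_def)
  have [measurable]: "F \<in> borel_measurable borel" using F2 by (simp add: in_L2_def)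
  have B0: "B \<ge> 0" using order_trans[OF norm_ge_zero A(2)] .
  define T where "T R y = (if \<bar>y\<bar> \<le> R then A y else 0)" for R y
  have [measurable]: "T R \<in> borel_measurable borel" for R unfolding T_def by measurable
  have Tb: "cmod (T R y) \<le> B" for R y using A(2) B0 by (simp add: T_def)
  have Tint: "integrable lborel (T R)" for R
  proof (rule Bochner_Integration.integrable_bound)
    show "integrable lborel (\<lambda>y. indicator {-R..R} y * B :: real)"
      by (intro integrable_mult_left integrable_real_indicator) (auto simp: emeasure_lborel_Icc_eq)
    show "AE y in lborel. norm (T R y) \<le> norm (indicator {-R..R} y * B :: real)"
      using A(2) B0 by (intro AE_I2) (auto simp: T_def indicator_def)
  qed measurable
  have step: "(LINT \<zeta>|lborel. F \<zeta> * gauss_wave h x \<zeta>)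
      = of_real (2 * pi) * (LINT v|lborel. A (x + h * v) * of_real (std_normal_density v))"
    if h: "h \<noteq> 0" for h
  proof (rule tendsto_unique[OF trivial_limit_at_top_linorder])
    have TL2: "in_L2 (fourier (T R))" for R by (rule fourier_in_L2[OF Tint Tb])
    have diff: "(LINT \<zeta>|lborel. fourier (T R) \<zeta> * gauss_wave h x \<zeta>) - (LINT \<zeta>|lborel. F \<zeta> * gauss_wave h x \<zeta>)
        = - (LINT \<zeta>|lborel. (F \<zeta> - fourier (T R) \<zeta>) * gauss_wave h x \<zeta>)" for R
      using L2_pairing_bound(1)[OF TL2[of R] gauss_wave_in_L2[OF h, of x]]
        L2_pairing_bound(1)[OF F2 gauss_wave_in_L2[OF h, of x]]
      by (simp add: left_diff_distrib)
    show "((\<lambda>R. LINT \<zeta>|lborel. fourier (T R) \<zeta> * gauss_wave h x \<zeta>) \<longlongrightarrow> (LINT \<zeta>|lborel. F \<zeta> * gauss_wave h x \<zeta>)) at_top"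
    proof (rule LIM_zero_cancel, rule Lim_null_comparison)
      from tendsto_mult_left_zero[OF Flim, of "L2_norm (gauss_wave h x)"]
      show "((\<lambda>R. L2_norm (\<lambda>\<zeta>. F \<zeta> - fourier (T R) \<zeta>) * L2_norm (gauss_wave h x)) \<longlongrightarrow> 0) at_top"
        by (simp add: T_def[abs_def])
      show "\<forall>\<^sub>F R in at_top. norm ((LINT \<zeta>|lborel. fourier (T R) \<zeta> * gauss_wave h x \<zeta>) - (LINT \<zeta>|lborel. F \<zeta> * gauss_wave h x \<zeta>))
          \<le> L2_norm (\<lambda>\<zeta>. F \<zeta> - fourier (T R) \<zeta>) * L2_norm (gauss_wave h x)"
        unfolding diff norm_minus_cancel
        by (intro always_eventually allI L2_pairing_bound(2) in_L2_diff F2 TL2 gauss_wave_in_L2 h)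
    qed
    have ex: "(LINT \<zeta>|lborel. fourier (T R) \<zeta> * gauss_wave h x \<zeta>) = (LINT y|lborel. T R y * of_real (heat_kernel h (x - y)))" for R
      by (simp add: fourier_exchange[OF Tint integrable_gauss_wave[OF h]] fourier_gauss_wave[OF h])
    have [measurable]: "heat_kernel h \<in> borel_measurable borel" unfolding heat_kernel_def by measurable
    have "((\<lambda>R. LINT y|lborel. T R y * of_real (heat_kernel h (x - y))) \<longlongrightarrow> (LINT y|lborel. A y * of_real (heat_kernel h (x - y)))) at_top"
    proof (rule integral_dominated_convergence_at_top)
      show "integrable lborel (\<lambda>y. B * heat_kernel h (x - y))"
        by (intro integrable_mult_right integrable_heat_kernel h)
      show "AE y in lborel. ((\<lambda>R. T R y * of_real (heat_kernel h (x - y))) \<longlongrightarrow> A y * of_real (heat_kernel h (x - y))) at_top"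
      proof (rule AE_I2, rule tendsto_eventually)
        fix y :: real
        show "\<forall>\<^sub>F R in at_top. T R y * of_real (heat_kernel h (x - y)) = A y * of_real (heat_kernel h (x - y))"
          by (rule eventually_mono[OF eventually_ge_at_top[of "\<bar>y\<bar>"]]) (simp add: T_def)
      qed
      show "\<forall>\<^sub>F R in at_top. AE y in lborel. norm (T R y * of_real (heat_kernel h (x - y))) \<le> B * heat_kernel h (x - y)"
        by (intro always_eventually allI AE_I2) (auto simp: norm_mult heat_kernel_nonneg intro!: mult_right_mono Tb)
    qed measurable
    thus "((\<lambda>R. LINT \<zeta>|lborel. fourier (T R) \<zeta> * gauss_wave h x \<zeta>)
        \<longlongrightarrow> of_real (2 * pi) * (LINT v|lborel. A (x + h * v) * of_real (std_normal_density v))) at_top"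
      by (simp only: ex integral_heat_kernel[OF h])
  qed
  have lhs: "((\<lambda>h. LINT \<zeta>|lborel. F \<zeta> * gauss_wave h x \<zeta>) \<longlongrightarrow> (LINT \<zeta>|lborel. F \<zeta> * iexp (x * \<zeta>))) (at 0)"
  proof (rule dominated_convergence_at)
    show "integrable lborel (\<lambda>\<zeta>. cmod (F \<zeta>))" using F by simp
    show "AE \<zeta> in lborel. ((\<lambda>h. F \<zeta> * gauss_wave h x \<zeta>) \<longlongrightarrow> F \<zeta> * iexp (x * \<zeta>)) (at 0)"
      unfolding gauss_wave_def by (intro AE_I2) (auto intro!: tendsto_eq_intros)
    show "AE \<zeta> in lborel. norm (F \<zeta> * gauss_wave h x \<zeta>) \<le> cmod (F \<zeta>)" for h
      by (intro AE_I2) (auto simp: norm_mult gauss_wave_norm intro!: mult_right_le_one_le)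
  qed measurable
  have rhs: "((\<lambda>h. LINT v|lborel. A (x + h * v) * of_real (std_normal_density v))
      \<longlongrightarrow> (LINT v|lborel. A x * of_real (std_normal_density v))) (at 0)"
  proof (rule dominated_convergence_at)
    show "integrable lborel (\<lambda>v. B * std_normal_density v)"
      by (intro integrable_mult_right integrable_normal_density) simp
    show "AE v in lborel. ((\<lambda>h. A (x + h * v) * of_real (std_normal_density v)) \<longlongrightarrow> A x * of_real (std_normal_density v)) (at 0)"
    proof (rule AE_I2)
      fix v :: real
      have "isCont A x" using A(1) by (simp add: continuous_on_eq_continuous_at)
      moreover have "((\<lambda>h. x + h * v) \<longlongrightarrow> x) (at 0)" by (auto intro!: tendsto_eq_intros)
      ultimately have "((\<lambda>h. A (x + h * v)) \<longlongrightarrow> A x) (at 0)" by (rule isCont_tendsto_compose)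
      thus "((\<lambda>h. A (x + h * v) * of_real (std_normal_density v)) \<longlongrightarrow> A x * of_real (std_normal_density v)) (at 0)"
        by (intro tendsto_intros)
    qed
    show "AE v in lborel. norm (A (x + h * v) * of_real (std_normal_density v)) \<le> B * std_normal_density v" for h
      by (intro AE_I2) (auto simp: norm_mult intro!: mult_right_mono A)
  qed measurable
  have "(LINT v|lborel. std_normal_density v) = 1"
    using integral_normal_density[of 1 0] by simp
  hence c: "(LINT v|lborel. A x * of_real (std_normal_density v)) = A x"
    by (simp only: integral_mult_right_zero integral_complex_of_real) simp
  have "((\<lambda>h. LINT \<zeta>|lborel. F \<zeta> * gauss_wave h x \<zeta>) \<longlongrightarrow> of_real (2 * pi) * A x) (at 0)"
    by (rule Lim_transform_eventually[OF tendsto_mult_left[OF rhs[unfolded c]]])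
       (auto simp: eventually_at_filter step)
  from tendsto_unique[OF _ this lhs] show ?thesis by simp
qed

lemma iexp_diff_holder: "cmod (iexp (x * \<zeta>) - iexp (y * \<zeta>)) \<le> 2 * (\<bar>x - y\<bar> powr (1/4) * \<bar>\<zeta>\<bar> powr (1/4))"
proof -
  define d where "d = (x - y) * \<zeta>"
  have "\<i> * of_real (x * \<zeta>) = \<i> * of_real (y * \<zeta>) + \<i> * of_real d"
    by (simp add: d_def algebra_simps)
  hence "iexp (x * \<zeta>) = iexp (y * \<zeta>) * iexp d" by (simp only: exp_add)
  hence "iexp (x * \<zeta>) - iexp (y * \<zeta>) = iexp (y * \<zeta>) * (iexp d - 1)"
    by (simp only: right_diff_distrib mult_1_right)
  hence "cmod (iexp (x * \<zeta>) - iexp (y * \<zeta>)) = cmod (iexp d - 1)"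
    by (simp only: norm_mult norm_exp_i_times mult_1_left)
  also have "\<dots> \<le> 2 * \<bar>d\<bar> powr (1/4)"
  proof (cases "\<bar>d\<bar> \<le> 1")
    case True
    have "cmod (iexp d - 1) \<le> \<bar>d\<bar>" using iexp_approx1[of d 0] by simp
    also have "\<bar>d\<bar> \<le> \<bar>d\<bar> powr (1/4)"
      using True powr_mono'[of "1/4" 1 "\<bar>d\<bar>"] by simp
    also have "\<dots> \<le> 2 * \<bar>d\<bar> powr (1/4)" by simp
    finally show ?thesis .
  next
    case False
    have "cmod (iexp d - 1) \<le> 2" using iexp_approx2[of d 0] by simp
    also have "2 \<le> 2 * \<bar>d\<bar> powr (1/4)" using False by (simp add: ge_one_powr_ge_zero)
    finally show ?thesis .
  qed
  also have "\<bar>d\<bar> powr (1/4) = \<bar>x - y\<bar> powr (1/4) * \<bar>\<zeta>\<bar> powr (1/4)"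
    by (simp add: d_def abs_mult powr_mult)
  finally show ?thesis .
qed

lemma is_L2_fourier_cong_AE:
  assumes F: "is_L2_fourier A' F" and eq: "AE x in lborel. A' x = A x" and A: "A \<in> borel_measurable borel"
  shows "is_L2_fourier A F"
proof -
  have [measurable]: "A \<in> borel_measurable borel" "A' \<in> borel_measurable borel"
    using A F by (auto simp: is_L2_fourier_def in_L2_def)
  have "integrable lborel (\<lambda>x. (cmod (A' x))\<^sup>2) = integrable lborel (\<lambda>x. (cmod (A x))\<^sup>2)"
    by (rule integrable_cong_AE) (use eq in auto)
  moreover have "fourier (\<lambda>y. if \<bar>y\<bar> \<le> R then A' y else 0) = fourier (\<lambda>y. if \<bar>y\<bar> \<le> R then A y else 0)" for R
    unfolding fourier_def by (rule ext, rule integral_cong_AE) (use eq in auto)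
  ultimately show ?thesis using F by (simp add: is_L2_fourier_def in_L2_def)
qed

text \<open>
By Cauchy-Schwarz \<open>\<langle>\<zeta>\<rangle> powr (1/4) F\<close> is integrable: \<open>7/8 - 1/4 = 5/8\<close> exceeds one half. Since
\<open>|exp(\<i> x \<zeta>) - exp(\<i> y \<zeta>)|\<close> is at most \<open>2 |x - y| powr (1/4) |\<zeta>| powr (1/4)\<close>, inversion gives the modulus
of continuity.
\<close>

lemma Sobolev_holder:
  assumes Hs: "in_Hs (7/8) A'" and eq: "AE x in lborel. A' x = A x"
    and A: "continuous_on UNIV A" "\<And>x. cmod (A x) \<le> B"
  shows "\<exists>H\<ge>0. \<forall>x y. cmod (A x - A y) \<le> H * \<bar>x - y\<bar> powr (1/4)"
proof -
  obtain F where F: "is_L2_fourier A' F"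
    and F2: "in_L2 (\<lambda>\<zeta>. of_real (japanese_bracket \<zeta> powr (7/8)) * F \<zeta>)"
    using Hs by (auto simp: in_Hs_def)
  have F': "is_L2_fourier A F"
    using A(1) by (intro is_L2_fourier_cong_AE[OF F eq] borel_measurable_continuous_onI)
  have [measurable]: "F \<in> borel_measurable borel" using F by (simp add: is_L2_fourier_def in_L2_def)
  have int: "integrable lborel (\<lambda>\<zeta>. japanese_bracket \<zeta> powr (1/4) * cmod (F \<zeta>))"
  proof (rule Bochner_Integration.integrable_bound)
    show "integrable lborel (\<lambda>\<zeta>. (cmod (of_real (japanese_bracket \<zeta> powr (7/8)) * F \<zeta>))\<^sup>2 + japanese_bracket \<zeta> powr (-5/4))"
      using F2 by (intro Bochner_Integration.integrable_add integrable_japanese_bracket_powr) (auto simp: in_L2_def)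
    show "AE \<zeta> in lborel. norm (japanese_bracket \<zeta> powr (1/4) * cmod (F \<zeta>))
        \<le> norm ((cmod (of_real (japanese_bracket \<zeta> powr (7/8)) * F \<zeta>))\<^sup>2 + japanese_bracket \<zeta> powr (-5/4))"
    proof (rule AE_I2)
      fix \<zeta>
      define a b where "a = japanese_bracket \<zeta> powr (7/8) * cmod (F \<zeta>)" and "b = japanese_bracket \<zeta> powr (-5/8)"
      have ab: "a * b = japanese_bracket \<zeta> powr (1/4) * cmod (F \<zeta>)"
        unfolding a_def b_def by (simp add: mult_ac powr_add[symmetric] flip: mult.assoc)
      have "b\<^sup>2 = japanese_bracket \<zeta> powr (-5/4)"
        unfolding b_def power2_eq_square by (simp add: powr_add[symmetric])
      moreover have "a\<^sup>2 = (cmod (of_real (japanese_bracket \<zeta> powr (7/8)) * F \<zeta>))\<^sup>2"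
        by (simp add: a_def norm_mult)
      moreover have "a * b \<le> a\<^sup>2 + b\<^sup>2"
        using sum_squares_bound[of a b] zero_le_power2[of a] zero_le_power2[of b] by linarith
      ultimately show "norm (japanese_bracket \<zeta> powr (1/4) * cmod (F \<zeta>))
        \<le> norm ((cmod (of_real (japanese_bracket \<zeta> powr (7/8)) * F \<zeta>))\<^sup>2 + japanese_bracket \<zeta> powr (-5/4))"
        using ab by simp
    qed
  qed measurable
  have Fle: "cmod (F \<zeta>) \<le> japanese_bracket \<zeta> powr (1/4) * cmod (F \<zeta>)" for \<zeta>
    using japanese_bracket_ge(1)[of \<zeta>] ge_one_powr_ge_zero[of "japanese_bracket \<zeta>" "1/4"]
      mult_right_mono[of 1 "japanese_bracket \<zeta> powr (1/4)" "cmod (F \<zeta>)"] by simp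
  have Fint: "integrable lborel F"
    by (rule Bochner_Integration.integrable_bound[OF int]) (use Fle in auto)
  define J where "J = (LINT \<zeta>|lborel. japanese_bracket \<zeta> powr (1/4) * cmod (F \<zeta>))"
  have J: "J \<ge> 0" unfolding J_def by (intro integral_nonneg_AE) auto
  have "cmod (A x - A y) \<le> J / pi * \<bar>x - y\<bar> powr (1/4)" for x y
  proof -
    have Fe: "integrable lborel (\<lambda>\<zeta>. F \<zeta> * iexp (x * \<zeta>))" for x
      by (rule Bochner_Integration.integrable_bound[OF Fint]) (auto simp: norm_mult simp del: of_real_mult)
    have "of_real (2 * pi) * (A x - A y) = (LINT \<zeta>|lborel. F \<zeta> * (iexp (x * \<zeta>) - iexp (y * \<zeta>)))"
      unfolding right_diff_distrib L2_fourier_inversion[OF F' Fint A]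
      by (rule Bochner_Integration.integral_diff[OF Fe Fe, symmetric])
    hence "cmod (of_real (2 * pi) * (A x - A y)) = cmod (LINT \<zeta>|lborel. F \<zeta> * (iexp (x * \<zeta>) - iexp (y * \<zeta>)))"
      by (rule arg_cong)
    hence "2 * pi * cmod (A x - A y) = cmod (LINT \<zeta>|lborel. F \<zeta> * (iexp (x * \<zeta>) - iexp (y * \<zeta>)))"
      by (simp only: norm_mult norm_of_real) simp
    also have "\<dots> \<le> (LINT \<zeta>|lborel. cmod (F \<zeta> * (iexp (x * \<zeta>) - iexp (y * \<zeta>))))"
      by (rule integral_norm_bound)
    also have "\<dots> \<le> (LINT \<zeta>|lborel. (2 * \<bar>x - y\<bar> powr (1/4)) * (japanese_bracket \<zeta> powr (1/4) * cmod (F \<zeta>)))"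
    proof (rule integral_mono')
      fix \<zeta> :: real
      have "cmod (iexp (x * \<zeta>) - iexp (y * \<zeta>)) \<le> 2 * (\<bar>x - y\<bar> powr (1/4) * \<bar>\<zeta>\<bar> powr (1/4))"
        by (rule iexp_diff_holder)
      also have "\<dots> \<le> 2 * (\<bar>x - y\<bar> powr (1/4) * japanese_bracket \<zeta> powr (1/4))"
        using japanese_bracket_ge(2)[of \<zeta>] by (intro mult_left_mono powr_mono2) auto
      finally have "cmod (F \<zeta>) * cmod (iexp (x * \<zeta>) - iexp (y * \<zeta>))
          \<le> cmod (F \<zeta>) * (2 * (\<bar>x - y\<bar> powr (1/4) * japanese_bracket \<zeta> powr (1/4)))"
        by (intro mult_left_mono) auto
      thus "cmod (F \<zeta> * (iexp (x * \<zeta>) - iexp (y * \<zeta>))) \<le> (2 * \<bar>x - y\<bar> powr (1/4)) * (japanese_bracket \<zeta> powr (1/4) * cmod (F \<zeta>))"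
        by (simp add: norm_mult mult_ac)
    qed (use int in auto)
    also have "\<dots> = 2 * \<bar>x - y\<bar> powr (1/4) * J" by (simp add: J_def)
    finally show ?thesis by (simp add: field_simps)
  qed
  moreover have "J / pi \<ge> 0" using J by simp
  ultimately show ?thesis by blast
qed

lemma AE_bound_continuous:
  fixes A :: "real \<Rightarrow> complex"
  assumes "continuous_on UNIV A" and "AE x in lborel. cmod (A x) \<le> B"
  shows "cmod (A x) \<le> B"
proof (rule ccontr)
  assume x: "\<not> cmod (A x) \<le> B"
  let ?S = "{x. B < cmod (A x)}"
  have "open ?S" using assms(1) by (intro open_Collect_less continuous_intros)
  have "AE x in lebesgue. x \<notin> ?S" using assms(2) by (intro AE_completion) (auto simp: not_less)
  hence "negligible ?S"
    unfolding negligible_iff_null_sets using AE_iff_null_sets[of ?S lebesgue] \<open>open ?S\<close>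
    by (simp add: lmeasurable_open borel_open)
  moreover have "x \<in> ?S" using x by simp
  ultimately show False using open_not_negligible[OF \<open>open ?S\<close>] by blast
qed

section \<open>Pairing a moving observable with the solution\<close>

definition mod_power :: "nat \<Rightarrow> complex \<Rightarrow> complex" where
  "mod_power n z = of_real (cmod z ^ n) * z"

lemma mod_power_measurable [measurable]: "mod_power n \<in> borel_measurable borel"
  unfolding mod_power_def by measurable

lemma norm_mod_power: "cmod (mod_power n z) = cmod z ^ Suc n"
  by (simp add: mod_power_def norm_mult norm_power)

lemma power_Suc_diff_le:
  fixes x y M :: real
  assumes "0 \<le> x" "x \<le> M" "0 \<le> y" "y \<le> M"
  shows "\<bar>x ^ Suc m - y ^ Suc m\<bar> \<le> (1 + real m) * M ^ m * \<bar>x - y\<bar>"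
proof (induction m)
  case (Suc m)
  have "x ^ Suc (Suc m) - y ^ Suc (Suc m) = x * (x ^ Suc m - y ^ Suc m) + y ^ Suc m * (x - y)"
    by (simp add: algebra_simps)
  also have "\<bar>\<dots>\<bar> \<le> x * \<bar>x ^ Suc m - y ^ Suc m\<bar> + y ^ Suc m * \<bar>x - y\<bar>"
    using assms by (intro order_trans[OF abs_triangle_ineq]) (simp add: abs_mult)
  also have "\<dots> \<le> M * ((1 + real m) * M ^ m * \<bar>x - y\<bar>) + M ^ Suc m * \<bar>x - y\<bar>"
    using assms by (intro add_mono mult_mono Suc power_mono) auto
  also have "\<dots> = (1 + real (Suc m)) * M ^ Suc m * \<bar>x - y\<bar>" by (simp add: algebra_simps)
  finally show ?case .
qed simp

text \<open>
One factor \<open>|a| + |b|\<close> is kept on the right: by Cauchy-Schwarz it turns convergence in \<open>L\<^sup>2\<close> of bounded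
functions into convergence in \<open>L\<^sup>1\<close> of their powers.
\<close>

lemma mod_power_lipschitz:
  assumes "cmod a \<le> M" "cmod b \<le> M"
  shows "cmod (mod_power (Suc m) a - mod_power (Suc m) b)
           \<le> (2 + real m) * M ^ m * ((cmod a + cmod b) * cmod (a - b))"
proof -
  have M: "M \<ge> 0" using order_trans[OF norm_ge_zero assms(1)] .
  have "mod_power (Suc m) a - mod_power (Suc m) b =
      of_real (cmod a ^ Suc m) * (a - b) + of_real (cmod a ^ Suc m - cmod b ^ Suc m) * b"
    by (simp add: mod_power_def algebra_simps)
  also have "cmod \<dots> \<le> cmod a ^ Suc m * cmod (a - b) + \<bar>cmod a ^ Suc m - cmod b ^ Suc m\<bar> * cmod b"
    by (rule order_trans[OF norm_triangle_ineq]) (simp add: norm_mult norm_power del: of_real_diff of_real_mult power_Suc)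
  also have "\<dots> \<le> (M ^ m * cmod a) * cmod (a - b) + ((1 + real m) * M ^ m * cmod (a - b)) * cmod b"
  proof (intro add_mono mult_right_mono)
    show "cmod a ^ Suc m \<le> M ^ m * cmod a"
      using assms by (simp add: mult.commute mult_left_mono power_mono)
    have "\<bar>cmod a ^ Suc m - cmod b ^ Suc m\<bar> \<le> (1 + real m) * M ^ m * \<bar>cmod a - cmod b\<bar>"
      using assms by (intro power_Suc_diff_le) auto
    also have "\<dots> \<le> (1 + real m) * M ^ m * cmod (a - b)"
      using M by (intro mult_left_mono norm_triangle_ineq3) auto
    finally show "\<bar>cmod a ^ Suc m - cmod b ^ Suc m\<bar> \<le> (1 + real m) * M ^ m * cmod (a - b)" .
  qed auto
  also have "\<dots> \<le> (2 + real m) * M ^ m * (cmod a * cmod (a - b)) + (2 + real m) * M ^ m * (cmod b * cmod (a - b))"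
  proof (rule add_mono)
    have "1 * (M ^ m * (cmod a * cmod (a - b))) \<le> (2 + real m) * (M ^ m * (cmod a * cmod (a - b)))"
      using M by (intro mult_right_mono) auto
    thus "(M ^ m * cmod a) * cmod (a - b) \<le> (2 + real m) * M ^ m * (cmod a * cmod (a - b))" by (simp add: mult_ac)
    have "(1 + real m) * (M ^ m * (cmod b * cmod (a - b))) \<le> (2 + real m) * (M ^ m * (cmod b * cmod (a - b)))"
      using M by (intro mult_right_mono) auto
    thus "((1 + real m) * M ^ m * cmod (a - b)) * cmod b \<le> (2 + real m) * M ^ m * (cmod b * cmod (a - b))"
      by (simp add: mult_ac)
  qed
  finally show ?thesis by (simp add: algebra_simps)
qed

text \<open>
Continuity in time serves to make the time integrands measurable; joint measurability of \<open>u\<close> in space and time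
is not at hand, since \<open>u\<close> is a curve of functions.
\<close>

lemma moving_pairing_continuous:
  fixes q :: "real \<Rightarrow> real \<Rightarrow> complex" and \<Phi> :: "real \<Rightarrow> complex"
  assumes q: "\<And>t. t \<ge> 1 \<Longrightarrow> integrable lborel (q t)"
    and qc: "\<And>t. t \<ge> 1 \<Longrightarrow> ((\<lambda>s. LINT y|lborel. cmod (q s y - q t y)) \<longlongrightarrow> 0) (at t within {1..})"
    and \<Phi>: "continuous_on UNIV \<Phi>" "\<And>x. cmod (\<Phi> x) \<le> B"
  shows "continuous_on {1..} (\<lambda>s. LINT y|lborel. \<Phi> (y + \<gamma> * s) * q s y)"
proof -
  have [measurable]: "\<Phi> \<in> borel_measurable borel" using \<Phi>(1) by (rule borel_measurable_continuous_onI)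
  have int: "integrable lborel (\<lambda>y. \<Phi> (y + c) * f y)" if "integrable lborel f" for c f
  proof (rule Bochner_Integration.integrable_bound)
    show "integrable lborel (\<lambda>y. B * cmod (f y))" using that by simp
    have [measurable]: "f \<in> borel_measurable borel" using that by (auto dest: borel_measurable_integrable)
    show "(\<lambda>y. \<Phi> (y + c) * f y) \<in> borel_measurable lborel" by measurable
    show "AE y in lborel. norm (\<Phi> (y + c) * f y) \<le> norm (B * cmod (f y))"
      unfolding norm_mult by (intro AE_I2 mult_mono) (auto intro: \<Phi>(2) order_trans[OF _ abs_ge_self])
  qed
  have B: "B \<ge> 0" using order_trans[OF norm_ge_zero \<Phi>(2)] .
  show ?thesis unfolding continuous_on_def
  proof
    fix t :: real assume "t \<in> {1..}"
    hence t: "t \<ge> 1" by simp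
    have [measurable]: "q t \<in> borel_measurable borel" using q[OF t] by (auto dest: borel_measurable_integrable)
    have 1: "((\<lambda>s. LINT y|lborel. \<Phi> (y + \<gamma> * s) * (q s y - q t y)) \<longlongrightarrow> 0) (at t within {1..})"
    proof (rule Lim_null_comparison)
      show "((\<lambda>s. B * (LINT y|lborel. cmod (q s y - q t y))) \<longlongrightarrow> 0) (at t within {1..})"
        using tendsto_mult_right_zero[OF qc[OF t]] .
      have "norm (LINT y|lborel. \<Phi> (y + \<gamma> * s) * (q s y - q t y)) \<le> B * (LINT y|lborel. cmod (q s y - q t y))"
        if "s \<ge> 1" for s
      proof -
        have "norm (LINT y|lborel. \<Phi> (y + \<gamma> * s) * (q s y - q t y))
            \<le> (LINT y|lborel. cmod (\<Phi> (y + \<gamma> * s) * (q s y - q t y)))" by (rule integral_norm_bound)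
        also have "\<dots> \<le> (LINT y|lborel. B * cmod (q s y - q t y))"
          using q[OF t] q[OF that] B
          by (intro integral_mono') (auto simp: norm_mult intro!: mult_right_mono \<Phi>(2))
        finally show ?thesis by simp
      qed
      thus "\<forall>\<^sub>F s in at t within {1..}. norm (LINT y|lborel. \<Phi> (y + \<gamma> * s) * (q s y - q t y))
          \<le> B * (LINT y|lborel. cmod (q s y - q t y))"
        by (auto simp: eventually_at_filter)
    qed
    have "((\<lambda>s. LINT y|lborel. \<Phi> (y + \<gamma> * s) * q t y) \<longlongrightarrow> (LINT y|lborel. \<Phi> (y + \<gamma> * t) * q t y)) (at t)"
    proof (rule dominated_convergence_at)
      show "integrable lborel (\<lambda>y. B * cmod (q t y))" using q[OF t] by simp
      show "AE y in lborel. ((\<lambda>s. \<Phi> (y + \<gamma> * s) * q t y) \<longlongrightarrow> \<Phi> (y + \<gamma> * t) * q t y) (at t)"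
      proof (rule AE_I2)
        fix y :: real
        have "isCont \<Phi> (y + \<gamma> * t)" using \<Phi>(1) by (simp add: continuous_on_eq_continuous_at)
        moreover have "((\<lambda>s. y + \<gamma> * s) \<longlongrightarrow> y + \<gamma> * t) (at t)" by (intro tendsto_intros)
        ultimately have "((\<lambda>s. \<Phi> (y + \<gamma> * s)) \<longlongrightarrow> \<Phi> (y + \<gamma> * t)) (at t)" by (rule isCont_tendsto_compose)
        thus "((\<lambda>s. \<Phi> (y + \<gamma> * s) * q t y) \<longlongrightarrow> \<Phi> (y + \<gamma> * t) * q t y) (at t)" by (intro tendsto_intros)
      qed
      show "AE y in lborel. norm (\<Phi> (y + \<gamma> * s) * q t y) \<le> B * cmod (q t y)" for s
        by (intro AE_I2) (auto simp: norm_mult intro!: mult_right_mono \<Phi>(2))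
    qed measurable
    hence 2: "((\<lambda>s. LINT y|lborel. \<Phi> (y + \<gamma> * s) * q t y) \<longlongrightarrow> (LINT y|lborel. \<Phi> (y + \<gamma> * t) * q t y)) (at t within {1..})"
      by (rule tendsto_within_subset) simp
    show "((\<lambda>s. LINT y|lborel. \<Phi> (y + \<gamma> * s) * q s y) \<longlongrightarrow> (LINT y|lborel. \<Phi> (y + \<gamma> * t) * q t y)) (at t within {1..})"
    proof (rule Lim_transform_eventually)
      show "((\<lambda>s. (LINT y|lborel. \<Phi> (y + \<gamma> * s) * (q s y - q t y)) + (LINT y|lborel. \<Phi> (y + \<gamma> * s) * q t y))
          \<longlongrightarrow> (LINT y|lborel. \<Phi> (y + \<gamma> * t) * q t y)) (at t within {1..})"
        using tendsto_add[OF 1 2] by simp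
      have "(LINT y|lborel. \<Phi> (y + \<gamma> * s) * (q s y - q t y)) + (LINT y|lborel. \<Phi> (y + \<gamma> * s) * q t y)
          = (LINT y|lborel. \<Phi> (y + \<gamma> * s) * q s y)" if "s \<ge> 1" for s
        using int[OF q[OF that], of "\<gamma> * s"] int[OF q[OF t], of "\<gamma> * s"] by (simp add: right_diff_distrib)
      thus "\<forall>\<^sub>F s in at t within {1..}. (LINT y|lborel. \<Phi> (y + \<gamma> * s) * (q s y - q t y)) + (LINT y|lborel. \<Phi> (y + \<gamma> * s) * q t y)
          = (LINT y|lborel. \<Phi> (y + \<gamma> * s) * q s y)"
        by (auto simp: eventually_at_filter)
    qed
  qed
qed

text \<open>
The consequences of the small-data theory on which the expansion rests. The ansatz error \<open>t powr (-5/8)\<close> is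
\<open>t powr (-3/4 + 2 \<delta>)\<close> weakened by means of \<open>\<delta> < 1/16\<close>; what matters is that it decays faster than
\<open>t powr (-1/2)\<close>.
\<close>

locale scattering_solution =
  fixes \<beta> \<gamma> p CW K H :: real and W :: "real \<Rightarrow> real"
    and u :: "real \<Rightarrow> real \<Rightarrow> complex" and A :: "real \<Rightarrow> complex"
  assumes p: "p > 4"
    and W_cont: "continuous_on UNIV W"
    and W_bound: "\<And>x. \<bar>W x\<bar> \<le> CW * japanese_bracket x powr (- p)"
    and u_L2: "\<And>t. t \<ge> 1 \<Longrightarrow> in_L2 (u t)"
    and u_cont: "\<And>t. t \<ge> 1 \<Longrightarrow> ((\<lambda>s. L2_norm (\<lambda>y. u s y - u t y)) \<longlongrightarrow> 0) (at t within {1..})"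
    and u_bound: "\<And>t. t \<ge> 1 \<Longrightarrow> AE y in lborel. cmod (u t y) \<le> K * t powr (-1/2)"
    and u_asymp: "\<And>t. t \<ge> 1 \<Longrightarrow>
          AE y in lborel. cmod (u t y - asymptotic_ansatz \<beta> A t y) \<le> K * t powr (-5/8)"
    and A_cont: "continuous_on UNIV A"
    and A_bound: "\<And>x. cmod (A x) \<le> K"
    and A_holder: "\<And>x y. cmod (A x - A y) \<le> H * \<bar>x - y\<bar> powr (1/4)"
    and H: "H \<ge> 0"
    and mild: "mild_solution \<beta> \<gamma> W u"
    and u1_moments: "\<And>k. k \<le> 3 \<Longrightarrow> integrable lborel (\<lambda>x. \<bar>x\<bar> ^ k * cmod (u 1 x))"
begin

lemma K: "K \<ge> 0"
  using order_trans[OF norm_ge_zero A_bound] .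

lemma u_measurable: "t \<ge> 1 \<Longrightarrow> u t \<in> borel_measurable borel"
  using u_L2 by (auto simp: in_L2_def)

lemma u_bound': "t \<ge> 1 \<Longrightarrow> AE y in lborel. cmod (u t y) \<le> K"
proof -
  assume t: "t \<ge> 1"
  have "K * t powr (-1/2) \<le> K * 1"
    using t powr_mono[of "-1/2" 0 t] K by (intro mult_left_mono) auto
  thus ?thesis using u_bound[OF t] by (auto elim!: eventually_mono)
qed

lemma W_measurable [measurable]: "W \<in> borel_measurable borel"
  by (rule borel_measurable_continuous_onI[OF W_cont])

text \<open>
This is where \<open>p > 4\<close> enters: the third moment needs integrability of \<open>\<langle>x\<rangle> powr (3 - p)\<close>.
\<close>

lemma W_moments:
  assumes "k \<le> 3"
  shows "integrable lborel (\<lambda>x. \<bar>x\<bar> ^ k * \<bar>W x\<bar>)"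
    and "\<bar>x\<bar> ^ k * \<bar>W x\<bar> \<le> CW"
proof -
  have le: "\<bar>x\<bar> ^ k * \<bar>W x\<bar> \<le> CW * japanese_bracket x powr (3 - p)" for x
  proof -
    have "\<bar>x\<bar> ^ k \<le> japanese_bracket x ^ k" using japanese_bracket_ge by (intro power_mono) auto
    also have "\<dots> \<le> japanese_bracket x ^ 3" using japanese_bracket_ge assms by (intro power_increasing) auto
    also have "\<dots> = japanese_bracket x powr 3" using japanese_bracket_ge(1)[of x] by (simp add: powr_numeral)
    finally have "\<bar>x\<bar> ^ k * \<bar>W x\<bar> \<le> japanese_bracket x powr 3 * (CW * japanese_bracket x powr (- p))"
      using W_bound by (intro mult_mono) auto
    also have "\<dots> = CW * (japanese_bracket x powr 3 * japanese_bracket x powr (- p))" by simp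
    also have "japanese_bracket x powr 3 * japanese_bracket x powr (- p) = japanese_bracket x powr (3 - p)"
      by (simp add: powr_add[symmetric])
    finally show ?thesis .
  qed
  show "integrable lborel (\<lambda>x. \<bar>x\<bar> ^ k * \<bar>W x\<bar>)"
  proof (rule Bochner_Integration.integrable_bound)
    show "integrable lborel (\<lambda>x. CW * japanese_bracket x powr (3 - p))"
      using p by (intro integrable_mult_right integrable_japanese_bracket_powr) auto
    show "AE x in lborel. norm (\<bar>x\<bar> ^ k * \<bar>W x\<bar>) \<le> norm (CW * japanese_bracket x powr (3 - p))"
      using le by (intro AE_I2) (auto intro: order_trans[OF _ abs_ge_self])
  qed measurable
  have CW: "CW \<ge> 0" using order_trans[OF abs_ge_zero W_bound[of 0]] by (simp add: japanese_bracket_def)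
  have "japanese_bracket x powr (3 - p) \<le> japanese_bracket x powr 0"
    using japanese_bracket_ge(1)[of x] p by (intro powr_mono) auto
  hence "CW * japanese_bracket x powr (3 - p) \<le> CW * 1"
    using CW japanese_bracket_ge(1)[of x] by (intro mult_left_mono) auto
  thus "\<bar>x\<bar> ^ k * \<bar>W x\<bar> \<le> CW" using le[of x] by simp
qed

lemma W_integrable: "integrable lborel (\<lambda>x. \<bar>W x\<bar>)"
  using W_moments(1)[of 0] by simp

lemma W_bounded: "\<bar>W x\<bar> \<le> CW"
  using W_moments(2)[of 0 x] by simp

abbreviation N :: "nat \<Rightarrow> real \<Rightarrow> real \<Rightarrow> complex" where
  "N n s y \<equiv> mod_power n (u s y)"

lemma N_integrable:
  assumes t: "t \<ge> 1"
  shows "integrable lborel (N (Suc m) t)"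
proof (rule Bochner_Integration.integrable_bound)
  have [measurable]: "u t \<in> borel_measurable borel" using u_measurable[OF t] .
  show "integrable lborel (\<lambda>y. K ^ m * (cmod (u t y))\<^sup>2)"
    using u_L2[OF t] by (auto simp: in_L2_def)
  show "N (Suc m) t \<in> borel_measurable lborel" by measurable
  show "AE y in lborel. norm (N (Suc m) t y) \<le> norm (K ^ m * (cmod (u t y))\<^sup>2)"
    using u_bound'[OF t]
  proof eventually_elim
    case (elim y)
    have "cmod (u t y) ^ m * (cmod (u t y))\<^sup>2 \<le> K ^ m * (cmod (u t y))\<^sup>2"
      using elim by (intro mult_right_mono power_mono) auto
    thus ?case using K by (simp add: norm_mod_power power2_eq_square mult_ac)
  qed
qed

lemma N_continuous:
  assumes t: "t \<ge> 1"
  shows "((\<lambda>s. LINT y|lborel. cmod (N (Suc m) s y - N (Suc m) t y)) \<longlongrightarrow> 0) (at t within {1..})"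
proof (rule Lim_null_comparison)
  let ?c = "(2 + real m) * K ^ m"
  let ?d = "\<lambda>s. L2_norm (\<lambda>y. u s y - u t y)"
  have "((\<lambda>s. ?c * ((2 * L2_norm (u t) + ?d s) * ?d s)) \<longlongrightarrow> ?c * ((2 * L2_norm (u t) + 0) * 0)) (at t within {1..})"
    by (intro tendsto_intros u_cont t)
  thus "((\<lambda>s. ?c * ((2 * L2_norm (u t) + ?d s) * ?d s)) \<longlongrightarrow> 0) (at t within {1..})" by simp
  have "(LINT y|lborel. cmod (N (Suc m) s y - N (Suc m) t y)) \<le> ?c * ((2 * L2_norm (u t) + ?d s) * ?d s)"
    if s: "s \<ge> 1" for s
  proof -
    have d: "in_L2 (\<lambda>y. u s y - u t y)" by (intro in_L2_diff u_L2 s t)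
    note i1 = L2_Cauchy_Schwarz[OF u_L2[OF t] d] and i2 = L2_Cauchy_Schwarz[OF d d]
    have [measurable]: "u t \<in> borel_measurable borel" "u s \<in> borel_measurable borel"
      using u_measurable s t by auto
    have "(LINT y|lborel. cmod (N (Suc m) s y - N (Suc m) t y))
       \<le> (LINT y|lborel. ?c * (2 * (cmod (u t y) * cmod (u s y - u t y)) + cmod (u s y - u t y) * cmod (u s y - u t y)))"
    proof (rule integral_mono_AE)
      show "integrable lborel (\<lambda>y. cmod (N (Suc m) s y - N (Suc m) t y))"
        using N_integrable s t by auto
      show "integrable lborel (\<lambda>y. ?c * (2 * (cmod (u t y) * cmod (u s y - u t y)) + cmod (u s y - u t y) * cmod (u s y - u t y)))"
        using i1 i2 by auto
      show "AE y in lborel. cmod (N (Suc m) s y - N (Suc m) t y)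
          \<le> ?c * (2 * (cmod (u t y) * cmod (u s y - u t y)) + cmod (u s y - u t y) * cmod (u s y - u t y))"
        using u_bound'[OF t] u_bound'[OF s]
      proof eventually_elim
        case (elim y)
        have "cmod (N (Suc m) s y - N (Suc m) t y) \<le> ?c * ((cmod (u s y) + cmod (u t y)) * cmod (u s y - u t y))"
          using elim by (intro mod_power_lipschitz)
        also have "\<dots> \<le> ?c * ((2 * cmod (u t y) + cmod (u s y - u t y)) * cmod (u s y - u t y))"
          using K norm_triangle_sub[of "u s y" "u t y"] by (intro mult_left_mono mult_right_mono) auto
        finally show ?case by (simp add: algebra_simps)
      qed
    qed
    also have "\<dots> = ?c * (2 * (LINT y|lborel. cmod (u t y) * cmod (u s y - u t y))
         + (LINT y|lborel. cmod (u s y - u t y) * cmod (u s y - u t y)))"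
      using i1 i2 by simp
    also have "\<dots> \<le> ?c * (2 * (L2_norm (u t) * ?d s) + ?d s * ?d s)"
      using K i1 i2 by (intro mult_left_mono add_mono) auto
    finally show ?thesis by (simp add: algebra_simps)
  qed
  thus "\<forall>\<^sub>F s in at t within {1..}. norm (LINT y|lborel. cmod (N (Suc m) s y - N (Suc m) t y)) \<le> ?c * ((2 * L2_norm (u t) + ?d s) * ?d s)"
    by (auto simp: eventually_at_filter)
qed

lemma N_pairing_continuous:
  assumes "continuous_on UNIV \<Phi>" "\<And>x. cmod (\<Phi> x) \<le> B"
  shows "continuous_on {1..} (\<lambda>s. LINT y|lborel. \<Phi> (y + c * s) * N (Suc m) s y)"
  using N_integrable N_continuous assms by (rule moving_pairing_continuous)

text \<open>
  The observable is paired with the quintic power in the frame that moves with the potential;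
  the two phases are those of a Galilei transformation.
\<close>

abbreviation quintic_density :: "(real \<Rightarrow> complex) \<Rightarrow> real \<Rightarrow> real \<Rightarrow> complex" where
  "quintic_density \<Phi> s y \<equiv> iexp (\<gamma> / 2 * (y + \<gamma> * s)) * \<Phi> (y + \<gamma> * s) * N 4 s y"

definition pairing :: "(real \<Rightarrow> complex) \<Rightarrow> real \<Rightarrow> complex" where
  "pairing \<Phi> s = iexp (- (\<gamma>\<^sup>2 / 4) * s) *
     (LINT y|lborel. quintic_density \<Phi> s y)"

lemma pairing_continuous:
  assumes "continuous_on UNIV \<Phi>" "\<And>x. cmod (\<Phi> x) \<le> B"
  shows "continuous_on {1..} (pairing \<Phi>)"
  unfolding pairing_def
proof (intro continuous_intros)
  have "continuous_on {1..} (\<lambda>s. LINT y|lborel. (\<lambda>x. iexp (\<gamma> / 2 * x) * \<Phi> x) (y + \<gamma> * s) * N (Suc 3) s y)"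
    using assms by (intro N_pairing_continuous[where B = B] continuous_intros)
      (auto simp: norm_mult simp del: of_real_mult)
  thus "continuous_on {1..} (\<lambda>s. LINT y|lborel. quintic_density \<Phi> s y)"
    by (simp add: eval_nat_numeral)
qed

lemma N4_bound:
  assumes "s \<ge> 1"
  shows "AE y in lborel. cmod (N 4 s y) \<le> K ^ 5 * s powr (-5/2)"
  using u_bound[OF assms]
proof eventually_elim
  case (elim y)
  have "cmod (N 4 s y) = cmod (u s y) ^ 5" by (simp add: norm_mod_power)
  also have "\<dots> \<le> (K * s powr (-1/2)) ^ 5" using elim by (intro power_mono) auto
  also have "\<dots> = K ^ 5 * s powr (-5/2)"
    using assms by (simp add: power_mult_distrib powr_power)
  finally show ?case .
qed

lemma shift_integrable:
  fixes f :: "real \<Rightarrow> real"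
  assumes "integrable lborel f"
  shows "integrable lborel (\<lambda>y. f (y + c))" "(LINT y|lborel. f (y + c)) = (LINT y|lborel. f y)"
  using lborel_integrable_real_affine[OF assms, of 1 c] lborel_integral_real_affine[of 1 f c]
  by (simp_all add: add.commute)

lemma pairing_integrable:
  assumes [measurable]: "\<Phi> \<in> borel_measurable borel" and \<Phi>: "integrable lborel (\<lambda>x. cmod (\<Phi> x))" and s: "s \<ge> 1"
  shows "integrable lborel (\<lambda>y. quintic_density \<Phi> s y)"
    and "cmod (pairing \<Phi> s) \<le> (K ^ 5 * (LINT x|lborel. cmod (\<Phi> x))) * s powr (-5/2)"
proof -
  have [measurable]: "u s \<in> borel_measurable borel" using u_measurable[OF s] .
  let ?f = "\<lambda>y. quintic_density \<Phi> s y"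
  let ?g = "\<lambda>y. cmod (\<Phi> (y + \<gamma> * s)) * (K ^ 5 * s powr (-5/2))"
  have AE: "AE y in lborel. cmod (?f y) \<le> ?g y"
    using N4_bound[OF s]
  proof eventually_elim
    case (elim y)
    have "cmod (?f y) = cmod (\<Phi> (y + \<gamma> * s)) * cmod (N 4 s y)"
      by (simp only: norm_mult norm_exp_i_times mult_1_left)
    also have "\<dots> \<le> ?g y" using elim by (intro mult_left_mono) auto
    finally show ?case .
  qed
  have g: "integrable lborel ?g" using shift_integrable(1)[OF \<Phi>] by (rule integrable_mult_left)
  show f: "integrable lborel ?f"
  proof (rule Bochner_Integration.integrable_bound[OF g])
    show "AE y in lborel. cmod (?f y) \<le> norm (?g y)"
      using AE K by (auto elim!: eventually_mono)
  qed measurable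
  have "cmod (pairing \<Phi> s) = cmod (LINT y|lborel. ?f y)"
    by (simp only: pairing_def norm_mult norm_exp_i_times mult_1_left)
  also have "\<dots> \<le> (LINT y|lborel. cmod (?f y))" by (rule integral_norm_bound)
  also have "\<dots> \<le> (LINT y|lborel. ?g y)"
    using f g AE by (intro integral_mono_AE) auto
  also have "\<dots> = (LINT x|lborel. cmod (\<Phi> x)) * (K ^ 5 * s powr (-5/2))"
    using shift_integrable(2)[OF \<Phi>] by simp
  finally show "cmod (pairing \<Phi> s) \<le> (K ^ 5 * (LINT x|lborel. cmod (\<Phi> x))) * s powr (-5/2)"
    by (simp add: mult_ac)
qed

lemma pairing_amplitude:
  assumes "continuous_on UNIV \<Phi>" "\<And>x. cmod (\<Phi> x) \<le> B" "integrable lborel (\<lambda>x. cmod (\<Phi> x))"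
  shows "decaying_amplitude (pairing \<Phi>) (K ^ 5 * (LINT x|lborel. cmod (\<Phi> x)))"
proof
  show "set_borel_measurable lborel {1..} (pairing \<Phi>)"
    unfolding set_borel_measurable_def
    using borel_measurable_continuous_on_indicator[OF _ pairing_continuous[OF assms(1,2)]] by simp
  show "cmod (pairing \<Phi> s) \<le> K ^ 5 * (LINT x|lborel. cmod (\<Phi> x)) * s powr (-5/2)" if "s \<ge> 1" for s
    by (rule pairing_integrable(2)[OF borel_measurable_continuous_onI[OF assms(1)] assms(3) that])
qed

end

lemma integrable_unimodular:
  assumes "integrable lborel f"
  shows "integrable lborel (\<lambda>y. iexp (a * y) * f y)"
proof (rule Bochner_Integration.integrable_bound[OF assms])
  have [measurable]: "f \<in> borel_measurable borel" using assms by (auto dest: borel_measurable_integrable)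
  show "(\<lambda>y. iexp (a * y) * f y) \<in> borel_measurable lborel" by measurable
qed (simp add: norm_mult del: of_real_mult)

section \<open>The limit profile as an oscillatory integral\<close>

context scattering_solution
begin

lemma pairing_add:
  assumes "\<Phi> \<in> borel_measurable borel" "integrable lborel (\<lambda>x. cmod (\<Phi> x))"
    and "\<Psi> \<in> borel_measurable borel" "integrable lborel (\<lambda>x. cmod (\<Psi> x))" and s: "s \<ge> 1"
  shows "pairing (\<lambda>x. \<Phi> x + \<Psi> x) s = pairing \<Phi> s + pairing \<Psi> s"
proof -
  note i = pairing_integrable(1)[OF assms(1,2) s] pairing_integrable(1)[OF assms(3,4) s]
  have "(LINT y|lborel. iexp (\<gamma> / 2 * (y + \<gamma> * s)) * (\<Phi> (y + \<gamma> * s) + \<Psi> (y + \<gamma> * s)) * N 4 s y)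
     = (LINT y|lborel. quintic_density \<Phi> s y + quintic_density \<Psi> s y)"
    by (simp only: distrib_left distrib_right)
  also have "\<dots> = (LINT y|lborel. quintic_density \<Phi> s y)
      + (LINT y|lborel. quintic_density \<Psi> s y)"
    by (rule Bochner_Integration.integral_add[OF i])
  finally show ?thesis unfolding pairing_def by (simp only: distrib_left)
qed

lemma pairing_cmult: "pairing (\<lambda>x. c * \<Phi> x) s = c * pairing \<Phi> s"
proof -
  have "(LINT y|lborel. iexp (\<gamma> / 2 * (y + \<gamma> * s)) * (c * \<Phi> (y + \<gamma> * s)) * N 4 s y)
     = (LINT y|lborel. c * (quintic_density \<Phi> s y))"
    by (simp only: mult_ac)
  thus ?thesis unfolding pairing_def by (simp only: integral_mult_right_zero mult_ac)
qed

lemma pairing_sum: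
  assumes "finite S" and "\<And>k. k \<in> S \<Longrightarrow> \<Phi> k \<in> borel_measurable borel"
    and "\<And>k. k \<in> S \<Longrightarrow> integrable lborel (\<lambda>x. cmod (\<Phi> k x))" and s: "s \<ge> 1"
  shows "pairing (\<lambda>x. \<Sum>k\<in>S. \<Phi> k x) s = (\<Sum>k\<in>S. pairing (\<Phi> k) s)"
  using assms(1-3)
proof (induction S rule: finite_induct)
  case empty
  show ?case by (simp add: pairing_def)
next
  case (insert k S)
  have [measurable]: "\<And>j. j \<in> S \<Longrightarrow> \<Phi> j \<in> borel_measurable borel" using insert by auto
  have m: "(\<lambda>x. \<Sum>j\<in>S. \<Phi> j x) \<in> borel_measurable borel" by measurable
  have "integrable lborel (\<lambda>x. \<Sum>j\<in>S. \<Phi> j x)"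
  proof (rule Bochner_Integration.integrable_sum)
    fix j assume "j \<in> S"
    thus "integrable lborel (\<Phi> j)"
      using insert.prems(1)[of j] insert.prems(2)[of j] by (subst integrable_norm_iff[symmetric]) auto
  qed
  hence "integrable lborel (\<lambda>x. cmod (\<Sum>j\<in>S. \<Phi> j x))" by (rule integrable_norm)
  with insert m s show ?case by (simp add: pairing_add)
qed

text \<open>
\<open>wave r\<close> is the potential seen at the frequency \<open>- \<gamma> / 2 + r\<close>; \<open>moment k\<close> are the coefficients and
\<open>wave_rem r\<close> is the remainder of its Taylor expansion in \<open>r\<close>.
\<close>

definition wave :: "real \<Rightarrow> real \<Rightarrow> complex" where
  "wave r x = iexp (- (r * x)) * of_real (W x)"

definition moment :: "nat \<Rightarrow> real \<Rightarrow> complex" where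
  "moment k x = (- (\<i> * of_real x)) ^ k / fact k * of_real (W x)"

definition wave_rem :: "real \<Rightarrow> real \<Rightarrow> complex" where
  "wave_rem r x = iexp_rem (- (r * x)) * of_real (W x)"

lemma wave_expand: "wave r x = (\<Sum>k\<le>3. of_real r ^ k * moment k x) + wave_rem r x"
  unfolding wave_def moment_def wave_rem_def iexp_expand[of r x]
  by (simp only: distrib_right sum_distrib_right mult.assoc add.commute)

lemma wave_props:
  "continuous_on UNIV (wave r)" "cmod (wave r x) \<le> CW" "integrable lborel (\<lambda>x. cmod (wave r x))"
proof -
  show "continuous_on UNIV (wave r)"
    unfolding wave_def by (intro continuous_intros W_cont)
  have n: "cmod (wave r x) = \<bar>W x\<bar>" for x
    by (simp only: wave_def norm_mult norm_exp_i_times norm_of_real mult_1_left)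
  show "cmod (wave r x) \<le> CW" using W_bounded by (simp add: n)
  show "integrable lborel (\<lambda>x. cmod (wave r x))" using W_integrable by (simp add: n)
qed

lemma moment_props:
  assumes "k \<le> 3"
  shows "continuous_on UNIV (moment k)" "cmod (moment k x) \<le> CW" "integrable lborel (\<lambda>x. cmod (moment k x))"
proof -
  show "continuous_on UNIV (moment k)"
    unfolding moment_def by (intro continuous_intros W_cont) auto
  have n: "cmod (moment k x) = \<bar>x\<bar> ^ k * \<bar>W x\<bar> / fact k" for x
    by (simp add: moment_def norm_mult norm_divide norm_power)
  have "cmod (moment k x) \<le> \<bar>x\<bar> ^ k * \<bar>W x\<bar> / 1"
    unfolding n by (intro divide_left_mono) auto
  thus "cmod (moment k x) \<le> CW" using W_moments(2)[OF assms, of x] by simp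
  show "integrable lborel (\<lambda>x. cmod (moment k x))" unfolding n
    using W_moments(1)[OF assms] by simp
qed

lemma wave_rem_props:
  "continuous_on UNIV (wave_rem r)" "cmod (wave_rem r x) \<le> \<bar>r\<bar> ^ 3 * CW" "integrable lborel (\<lambda>x. cmod (wave_rem r x))"
proof -
  show c: "continuous_on UNIV (wave_rem r)"
    unfolding wave_rem_def by (intro continuous_intros W_cont)
  have n: "cmod (wave_rem r x) \<le> \<bar>r\<bar> ^ 3 * (\<bar>x\<bar> ^ 3 * \<bar>W x\<bar>)" for x
  proof -
    have "cmod (iexp_rem (- (r * x))) * \<bar>W x\<bar> \<le> \<bar>- (r * x)\<bar> ^ 3 * \<bar>W x\<bar>"
      by (intro mult_right_mono iexp_rem_bound2) auto
    thus ?thesis by (simp add: wave_rem_def norm_mult abs_mult power_mult_distrib mult_ac)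
  qed
  have "\<bar>r\<bar> ^ 3 * (\<bar>x\<bar> ^ 3 * \<bar>W x\<bar>) \<le> \<bar>r\<bar> ^ 3 * CW"
    by (intro mult_left_mono W_moments(2)) auto
  thus "cmod (wave_rem r x) \<le> \<bar>r\<bar> ^ 3 * CW" using n[of x] by linarith
  have [measurable]: "wave_rem r \<in> borel_measurable borel" by (rule borel_measurable_continuous_onI[OF c])
  show "integrable lborel (\<lambda>x. cmod (wave_rem r x))"
    by (rule Bochner_Integration.integrable_bound[OF integrable_mult_right[OF W_moments(1)[of 3], of "\<bar>r\<bar> ^ 3"]])
       (use n in auto)
qed

lemma meas_props:
  "wave r \<in> borel_measurable borel" "k \<le> 3 \<Longrightarrow> moment k \<in> borel_measurable borel" "wave_rem r \<in> borel_measurable borel"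
  using wave_props(1) moment_props(1) wave_rem_props(1) by (auto intro: borel_measurable_continuous_onI)

definition potential_term :: "real \<Rightarrow> real \<Rightarrow> complex" where
  "potential_term \<zeta> s = fourier (\<lambda>y. of_real (W (y + \<gamma> * s)) * N 4 s y) \<zeta>"

text \<open>
Completing the square, \<open>s \<zeta>\<^sup>2 + s \<gamma> \<zeta> = s r\<^sup>2 - s \<gamma>\<^sup>2 / 4\<close> for \<open>\<zeta> = - \<gamma> / 2 + r\<close>; the last term
is part of the definition of \<open>pairing\<close>.
\<close>

lemma galilei:
  "iexp (s * (- \<gamma> / 2 + r)\<^sup>2) * potential_term (- \<gamma> / 2 + r) s = iexp (s * r\<^sup>2) * pairing (wave r) s"
proof -
  have e: "iexp (s * (- \<gamma> / 2 + r)\<^sup>2) * exp (- (\<i> * of_real ((- \<gamma> / 2 + r) * y)))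
      = iexp (s * r\<^sup>2) * iexp (- (\<gamma>\<^sup>2 / 4) * s) * (iexp (\<gamma> / 2 * (y + \<gamma> * s)) * iexp (- (r * (y + \<gamma> * s))))" for y
  proof -
    have "s * (- \<gamma> / 2 + r)\<^sup>2 + - ((- \<gamma> / 2 + r) * y)
      = s * r\<^sup>2 + (- (\<gamma>\<^sup>2 / 4) * s) + (\<gamma> / 2 * (y + \<gamma> * s) + (- (r * (y + \<gamma> * s))))"
      by (simp add: power2_eq_square algebra_simps)
    hence "iexp (s * (- \<gamma> / 2 + r)\<^sup>2 + - ((- \<gamma> / 2 + r) * y))
      = iexp (s * r\<^sup>2 + (- (\<gamma>\<^sup>2 / 4) * s) + (\<gamma> / 2 * (y + \<gamma> * s) + (- (r * (y + \<gamma> * s)))))"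
      by (simp only:)
    thus ?thesis by (simp only: of_real_add distrib_left exp_add of_real_minus mult_minus_right)
  qed
  have "iexp (s * (- \<gamma> / 2 + r)\<^sup>2) * potential_term (- \<gamma> / 2 + r) s =
      (LINT y|lborel. (iexp (s * (- \<gamma> / 2 + r)\<^sup>2) * exp (- (\<i> * of_real ((- \<gamma> / 2 + r) * y)))) *
          (of_real (W (y + \<gamma> * s)) * N 4 s y))"
    unfolding potential_term_def fourier_def by (simp only: integral_mult_right_zero[symmetric] mult.assoc)
  also have "\<dots> = (LINT y|lborel. (iexp (s * r\<^sup>2) * iexp (- (\<gamma>\<^sup>2 / 4) * s)) *
        (iexp (\<gamma> / 2 * (y + \<gamma> * s)) * wave r (y + \<gamma> * s) * N 4 s y))"
    unfolding e wave_def by (simp only: mult.assoc)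
  finally show ?thesis
    unfolding pairing_def by (simp only: integral_mult_right_zero mult.assoc)
qed

lemma potential_term_integrable:
  assumes s: "s \<ge> 1"
  shows "integrable lborel (\<lambda>y. of_real (W (y + \<gamma> * s)) * N 4 s y)"
proof (rule Bochner_Integration.integrable_bound)
  have [measurable]: "u s \<in> borel_measurable borel" using u_measurable[OF s] .
  have "integrable lborel (N (Suc 3) s)" by (rule N_integrable[OF s])
  thus "integrable lborel (\<lambda>y. CW * cmod (N 4 s y))" by (simp add: eval_nat_numeral)
  show "(\<lambda>y. of_real (W (y + \<gamma> * s)) * N 4 s y) \<in> borel_measurable lborel" by measurable
  have "cmod (of_real (W (y + \<gamma> * s)) * N 4 s y) \<le> CW * cmod (N 4 s y)" for y
    unfolding norm_mult norm_of_real by (intro mult_right_mono W_bounded) auto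
  thus "AE y in lborel. norm (of_real (W (y + \<gamma> * s)) * N 4 s y) \<le> norm (CW * cmod (N 4 s y))"
    by (intro AE_I2) (auto intro: order_trans[OF _ abs_ge_self])
qed

lemma fourier_nonlinearity:
  assumes s: "s \<ge> 1"
  shows "fourier (nonlinearity \<beta> \<gamma> W u s) \<zeta> = of_real \<beta> * fourier (N 2 s) \<zeta> - potential_term \<zeta> s"
proof -
  have i2: "integrable lborel (N 2 s)" using N_integrable[OF s, of 1] by (simp add: numeral_2_eq_2)
  have n: "nonlinearity \<beta> \<gamma> W u s y = of_real \<beta> * N 2 s y - of_real (W (y + \<gamma> * s)) * N 4 s y" for y
    by (simp add: nonlinearity_def mod_power_def)
  have "fourier (nonlinearity \<beta> \<gamma> W u s) \<zeta> = (LINT y|lborel. of_real \<beta> * (iexp (- \<zeta> * y) * N 2 s y)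
      - iexp (- \<zeta> * y) * (of_real (W (y + \<gamma> * s)) * N 4 s y))"
    unfolding fourier_def n by (intro Bochner_Integration.integral_cong refl) (simp add: algebra_simps)
  also have "\<dots> = of_real \<beta> * (LINT y|lborel. iexp (- \<zeta> * y) * N 2 s y)
      - (LINT y|lborel. iexp (- \<zeta> * y) * (of_real (W (y + \<gamma> * s)) * N 4 s y))"
    using integrable_unimodular[OF i2, of "- \<zeta>"]
      integrable_unimodular[OF potential_term_integrable[OF s], of "- \<zeta>"]
    by (subst Bochner_Integration.integral_diff) auto
  finally show ?thesis by (simp add: potential_term_def fourier_def)
qed

text \<open>
The cubic part of Duhamel's formula is precisely what the renormalization adds back.
\<close>

lemma renormalized_profile_eq:
  assumes t: "t \<ge> 1"
  shows "renormalized_profile \<beta> u t \<zeta> = iexp (\<zeta>\<^sup>2) * fourier (u 1) \<zeta> +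
      \<i> * (LINT s:{1..t}|lborel. iexp (s * \<zeta>\<^sup>2) * potential_term \<zeta> s)"
proof -
  define r where "r = \<zeta> + \<gamma> / 2"
  have \<zeta>: "\<zeta> = - \<gamma> / 2 + r" by (simp add: r_def)
  define a b where "a s = iexp (s * \<zeta>\<^sup>2) * fourier (N 2 s) \<zeta>" and "b s = iexp (s * \<zeta>\<^sup>2) * potential_term \<zeta> s" for s
  have "continuous_on {1..} (\<lambda>s. LINT y|lborel. iexp (- \<zeta> * (y + 0 * s)) * N (Suc 1) s y)"
    by (rule N_pairing_continuous[where B = 1 and \<Phi> = "\<lambda>x. iexp (- \<zeta> * x)"])
       (auto intro!: continuous_intros simp del: of_real_mult)
  hence "continuous_on {1..} (\<lambda>s. fourier (N 2 s) \<zeta>)" by (simp add: fourier_def numeral_2_eq_2)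
  hence "continuous_on {1..} a" unfolding a_def by (intro continuous_intros)
  from continuous_on_subset[OF this, of "{1..t}"]
  have ia: "set_integrable lborel {1..t} a" by (intro borel_integrable_atLeastAtMost') simp
  have "b = (\<lambda>s. iexp (s * r\<^sup>2) * pairing (wave r) s)"
    unfolding b_def \<zeta> galilei ..
  hence "continuous_on {1..} b"
    by (simp only:) (intro continuous_intros pairing_continuous[OF wave_props(1,2)])
  from continuous_on_subset[OF this, of "{1..t}"]
  have ib: "set_integrable lborel {1..t} b" by (intro borel_integrable_atLeastAtMost') simp
  let ?E = "iexp (t * \<zeta>\<^sup>2)"
  have E1: "?E * exp (- (\<i> * of_real ((t - s) * \<zeta>\<^sup>2))) = iexp (s * \<zeta>\<^sup>2)" for s
    unfolding exp_add[symmetric] by (rule arg_cong[where f = exp]) (simp add: algebra_simps)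
  have "?E * (LINT s:{1..t}|lborel. exp (- (\<i> * of_real ((t - s) * \<zeta>\<^sup>2))) * fourier (nonlinearity \<beta> \<gamma> W u s) \<zeta>)
      = (LINT s:{1..t}|lborel. iexp (s * \<zeta>\<^sup>2) * fourier (nonlinearity \<beta> \<gamma> W u s) \<zeta>)"
    by (simp only: set_integral_mult_right[symmetric] mult.assoc[symmetric] E1)
  also have "\<dots> = (LINT s:{1..t}|lborel. of_real \<beta> * a s - b s)"
    by (intro set_lebesgue_integral_cong)
       (auto simp: fourier_nonlinearity a_def b_def right_diff_distrib mult_ac)
  also have "\<dots> = of_real \<beta> * (LINT s:{1..t}|lborel. a s) - (LINT s:{1..t}|lborel. b s)"
    using ia ib by (subst set_integral_diff) auto
  finally have D: "?E * (LINT s:{1..t}|lborel. exp (- (\<i> * of_real ((t - s) * \<zeta>\<^sup>2))) * fourier (nonlinearity \<beta> \<gamma> W u s) \<zeta>)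
      = of_real \<beta> * (LINT s:{1..t}|lborel. a s) - (LINT s:{1..t}|lborel. b s)" .
  have U: "fourier (u t) \<zeta> = exp (- (\<i> * of_real ((t - 1) * \<zeta>\<^sup>2))) * fourier (u 1) \<zeta> -
          \<i> * (LINT s:{1..t}|lborel. exp (- (\<i> * of_real ((t - s) * \<zeta>\<^sup>2))) * fourier (nonlinearity \<beta> \<gamma> W u s) \<zeta>)"
    using mild t unfolding mild_solution_def by blast
  have "?E * fourier (u t) \<zeta> = (?E * exp (- (\<i> * of_real ((t - 1) * \<zeta>\<^sup>2)))) * fourier (u 1) \<zeta>
      - \<i> * (?E * (LINT s:{1..t}|lborel. exp (- (\<i> * of_real ((t - s) * \<zeta>\<^sup>2))) * fourier (nonlinearity \<beta> \<gamma> W u s) \<zeta>))"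
    unfolding U by (simp only: right_diff_distrib mult_ac)
  also have "\<dots> = iexp (\<zeta>\<^sup>2) * fourier (u 1) \<zeta> - \<i> * (of_real \<beta> * (LINT s:{1..t}|lborel. a s) - (LINT s:{1..t}|lborel. b s))"
    unfolding D E1 by simp
  finally have F: "?E * fourier (u t) \<zeta> = iexp (\<zeta>\<^sup>2) * fourier (u 1) \<zeta>
      - \<i> * (of_real \<beta> * (LINT s:{1..t}|lborel. a s) - (LINT s:{1..t}|lborel. b s))" .
  have "renormalized_profile \<beta> u t \<zeta> = ?E * fourier (u t) \<zeta> + \<i> * of_real \<beta> * (LINT s:{1..t}|lborel. a s)"
    by (simp add: renormalized_profile_def a_def mod_power_def)
  thus ?thesis unfolding F b_def by (simp add: algebra_simps)
qed

sublocale wave: decaying_amplitude "pairing (wave r)" "K ^ 5 * (LINT x|lborel. cmod (wave r x))" for r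
  by (rule pairing_amplitude[OF wave_props])

sublocale wave_rem: decaying_amplitude "pairing (wave_rem r)" "K ^ 5 * (LINT x|lborel. cmod (wave_rem r x))" for r
  by (rule pairing_amplitude[OF wave_rem_props])

lemma moment_amplitude:
  "k \<le> 3 \<Longrightarrow> decaying_amplitude (pairing (moment k)) (K ^ 5 * (LINT x|lborel. cmod (moment k x)))"
  by (rule pairing_amplitude[OF moment_props])

text \<open>
The time integral converges absolutely, because the pairing decays like \<open>s powr (-5/2)\<close>.
\<close>

lemma limit_formula:
  assumes P: "((\<lambda>t. renormalized_profile \<beta> u t (- \<gamma> / 2 + r)) \<longlongrightarrow> P) at_top"
  shows "P = iexp ((- \<gamma> / 2 + r)\<^sup>2) * fourier (u 1) (- \<gamma> / 2 + r) + \<i> * wave.osc r r"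
proof (rule tendsto_unique[OF trivial_limit_at_top_linorder P])
  let ?a = "iexp ((- \<gamma> / 2 + r)\<^sup>2) * fourier (u 1) (- \<gamma> / 2 + r)"
  have "((\<lambda>t. LINT s:{1..t}|lborel. iexp (s * r\<^sup>2) * pairing (wave r) s) \<longlongrightarrow> wave.osc r r) at_top"
    unfolding wave.osc_def by (rule tendsto_set_lebesgue_integral_at_top[OF _ wave.integrable_osc]) auto
  hence "((\<lambda>t. ?a + \<i> * (LINT s:{1..t}|lborel. iexp (s * r\<^sup>2) * pairing (wave r) s)) \<longlongrightarrow> ?a + \<i> * wave.osc r r) at_top"
    by (intro tendsto_intros)
  thus "((\<lambda>t. renormalized_profile \<beta> u t (- \<gamma> / 2 + r)) \<longlongrightarrow> ?a + \<i> * wave.osc r r) at_top"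
  proof (rule Lim_transform_eventually)
    show "\<forall>\<^sub>F t in at_top. ?a + \<i> * (LINT s:{1..t}|lborel. iexp (s * r\<^sup>2) * pairing (wave r) s)
        = renormalized_profile \<beta> u t (- \<gamma> / 2 + r)"
      by (rule eventually_mono[OF eventually_ge_at_top[of 1]])
         (simp only: renormalized_profile_eq galilei)
  qed
qed

lemma wave_osc_expand:
  "wave.osc r r = (\<Sum>k\<le>3. of_real r ^ k * decaying_amplitude.osc (pairing (moment k)) r) + wave_rem.osc r r"
proof -
  have p: "pairing (wave r) s = (\<Sum>k\<le>3. of_real r ^ k * pairing (moment k) s) + pairing (wave_rem r) s"
    if s: "s \<ge> 1" for s
  proof -
    define \<Phi> where "\<Phi> k x = of_real r ^ k * moment k x" for k x
    have m: "\<Phi> k \<in> borel_measurable borel" "integrable lborel (\<lambda>x. cmod (\<Phi> k x))" if "k \<le> 3" for k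
    proof -
      have [measurable]: "moment k \<in> borel_measurable borel" using that by (rule meas_props(2))
      show "\<Phi> k \<in> borel_measurable borel" unfolding \<Phi>_def by measurable
      show "integrable lborel (\<lambda>x. cmod (\<Phi> k x))"
        unfolding \<Phi>_def norm_mult using moment_props(3)[OF that] by simp
    qed
    have [measurable]: "(\<lambda>x. \<Sum>k\<le>3. \<Phi> k x) \<in> borel_measurable borel"
      using m by (intro borel_measurable_sum) auto
    have "integrable lborel (\<lambda>x. \<Sum>k\<le>3. \<Phi> k x)"
      using m by (intro Bochner_Integration.integrable_sum, subst integrable_norm_iff[symmetric]) auto
    hence i: "integrable lborel (\<lambda>x. cmod (\<Sum>k\<le>3. \<Phi> k x))" by (rule integrable_norm)
    have "pairing (wave r) s = pairing (\<lambda>x. (\<Sum>k\<le>3. \<Phi> k x) + wave_rem r x) s"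
      by (rule arg_cong[where f = "\<lambda>f. pairing f s"]) (simp add: fun_eq_iff wave_expand \<Phi>_def)
    also have "\<dots> = pairing (\<lambda>x. \<Sum>k\<le>3. \<Phi> k x) s + pairing (wave_rem r) s"
      by (rule pairing_add[OF _ i meas_props(3) wave_rem_props(3) s]) measurable
    also have "pairing (\<lambda>x. \<Sum>k\<le>3. \<Phi> k x) s = (\<Sum>k\<le>3. pairing (\<Phi> k) s)"
      using m s by (intro pairing_sum) auto
    finally show ?thesis by (simp add: \<Phi>_def[abs_def] pairing_cmult)
  qed
  have i: "set_integrable lborel {1..} (\<lambda>s. of_real r ^ k * (iexp (s * r\<^sup>2) * pairing (moment k) s))" if "k \<le> 3" for k
    by (rule set_integrable_mult_right) (use decaying_amplitude.integrable_osc[OF moment_amplitude[OF that]] in auto)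
  have "wave.osc r r = (LINT s:{1..}|lborel. (\<Sum>k\<le>3. of_real r ^ k * (iexp (s * r\<^sup>2) * pairing (moment k) s))
      + iexp (s * r\<^sup>2) * pairing (wave_rem r) s)"
    unfolding wave.osc_def
  proof (rule set_lebesgue_integral_cong)
    show "\<forall>s. s \<in> {1..} \<longrightarrow> iexp (s * r\<^sup>2) * pairing (wave r) s = (\<Sum>k\<le>3. of_real r ^ k * (iexp (s * r\<^sup>2) * pairing (moment k) s))
      + iexp (s * r\<^sup>2) * pairing (wave_rem r) s"
    proof (intro allI impI)
      fix s :: real assume "s \<in> {1..}"
      hence s: "s \<ge> 1" by simp
      show "iexp (s * r\<^sup>2) * pairing (wave r) s = (\<Sum>k\<le>3. of_real r ^ k * (iexp (s * r\<^sup>2) * pairing (moment k) s))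
      + iexp (s * r\<^sup>2) * pairing (wave_rem r) s"
        unfolding p[OF s] by (simp only: distrib_left sum_distrib_left mult.left_commute)
    qed
  qed simp
  also have "\<dots> = (LINT s:{1..}|lborel. (\<Sum>k\<le>3. of_real r ^ k * (iexp (s * r\<^sup>2) * pairing (moment k) s))) + wave_rem.osc r r"
    unfolding wave_rem.osc_def
  proof (rule set_integral_add(2)[OF _ wave_rem.integrable_osc])
    show "set_integrable lborel {1..} (\<lambda>s. \<Sum>k\<le>3. of_real r ^ k * (iexp (s * r\<^sup>2) * pairing (moment k) s))"
      using i unfolding set_integrable_def scaleR_sum_right by (intro Bochner_Integration.integrable_sum) auto
  qed
  also have "(LINT s:{1..}|lborel. (\<Sum>k\<le>3. of_real r ^ k * (iexp (s * r\<^sup>2) * pairing (moment k) s)))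
      = (\<Sum>k\<le>3. (LINT s:{1..}|lborel. of_real r ^ k * (iexp (s * r\<^sup>2) * pairing (moment k) s)))"
    using i unfolding set_integrable_def set_lebesgue_integral_def scaleR_sum_right
    by (intro Bochner_Integration.integral_sum) auto
  also have "\<dots> = (\<Sum>k\<le>3. of_real r ^ k * decaying_amplitude.osc (pairing (moment k)) r)"
    by (intro sum.cong refl) (simp add: decaying_amplitude.osc_def[OF moment_amplitude])
  finally show ?thesis .
qed

lemma wave_rem_osc_small: "((\<lambda>r. wave_rem.osc r r / of_real (\<bar>r\<bar> ^ 3)) \<longlongrightarrow> 0) (at 0)"
proof (rule Lim_null_comparison)
  define J where "J = (LINT s|lborel. indicator {1..} s * s powr (-5/2) :: real)"
  have "((\<lambda>r. (LINT x|lborel. cmod (iexp_rem (- (r * x))) * \<bar>W x\<bar>) / \<bar>r\<bar> ^ 3) \<longlongrightarrow> 0) (at 0)"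
    using W_moments(1)[of 3] by (intro iexp_rem_moment) auto
  from tendsto_mult_right_zero[OF this, of "K ^ 5 * J"]
  show "((\<lambda>r. (K ^ 5 * J) * ((LINT x|lborel. cmod (iexp_rem (- (r * x))) * \<bar>W x\<bar>) / \<bar>r\<bar> ^ 3)) \<longlongrightarrow> 0) (at 0)" .
  have w: "cmod (wave_rem r x) = cmod (iexp_rem (- (r * x))) * \<bar>W x\<bar>" for r x
    by (simp add: wave_rem_def norm_mult)
  have "cmod (wave_rem.osc r r) \<le> (K ^ 5 * J) * (LINT x|lborel. cmod (iexp_rem (- (r * x))) * \<bar>W x\<bar>)" for r
    using wave_rem.osc_bound[of r r] by (simp add: w J_def mult_ac)
  hence "cmod (wave_rem.osc r r) / \<bar>r\<bar> ^ 3 \<le> (K ^ 5 * J) * (LINT x|lborel. cmod (iexp_rem (- (r * x))) * \<bar>W x\<bar>) / \<bar>r\<bar> ^ 3" for r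
    by (intro divide_right_mono) auto
  thus "\<forall>\<^sub>F r in at 0. norm (wave_rem.osc r r / of_real (\<bar>r\<bar> ^ 3))
      \<le> (K ^ 5 * J) * ((LINT x|lborel. cmod (iexp_rem (- (r * x))) * \<bar>W x\<bar>) / \<bar>r\<bar> ^ 3)"
    by (intro always_eventually) (simp add: norm_divide norm_power)
qed

end

section \<open>Asymptotics of the leading amplitude\<close>

context scattering_solution
begin

definition A0 :: complex where "A0 = A (- \<gamma>)"
definition \<alpha> :: real where "\<alpha> = \<beta> * (cmod A0)\<^sup>2"

text \<open>
In the frame of the potential the solution, multiplied by \<open>s powr (1/2)\<close> and by unimodular factors (\<open>frame\<close>),
is close to \<open>model\<close>, which is the ansatz in the new coordinates. On bounded sets of \<open>x\<close> the latter is close to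
\<open>model0\<close>, as \<open>x / s - \<gamma>\<close> tends to \<open>- \<gamma>\<close>.
\<close>

definition model :: "real \<Rightarrow> real \<Rightarrow> complex" where
  "model s x = iexp (x\<^sup>2 / (4 * s)) * (A (x / s - \<gamma>) * iexp (- (\<beta> * (cmod (A (x / s - \<gamma>)))\<^sup>2 * ln s)))"

definition model0 :: "real \<Rightarrow> complex" where
  "model0 s = A0 * iexp (- (\<alpha> * ln s))"

definition frame :: "real \<Rightarrow> real \<Rightarrow> complex" where
  "frame s x = (of_real (s powr (1/2)) * (iexp (- (\<gamma>\<^sup>2 / 4) * s) * iexp (\<gamma> / 2 * x))) * u s (x - \<gamma> * s)"

lemma A_measurable [measurable]: "A \<in> borel_measurable borel"
  by (rule borel_measurable_continuous_onI[OF A_cont])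

lemma AE_shift:
  fixes P :: "real \<Rightarrow> bool"
  assumes "Measurable.pred borel P" "AE y in lborel. P y"
  shows "AE x in lborel. P (x - c)"
  using AE_borel_affine[of 1 P "- c"] assms by simp

lemma frame_bound:
  assumes s: "s \<ge> 1"
  shows "AE x in lborel. cmod (frame s x) \<le> K"
proof -
  have [measurable]: "u s \<in> borel_measurable borel" using u_measurable[OF s] .
  have "AE x in lborel. cmod (u s (x - \<gamma> * s)) \<le> K * s powr (-1/2)"
    by (rule AE_shift[OF _ u_bound[OF s]]) measurable
  thus ?thesis
  proof eventually_elim
    case (elim x)
    have "cmod (frame s x) = s powr (1/2) * cmod (u s (x - \<gamma> * s))"
      by (simp only: frame_def norm_mult norm_exp_i_times mult_1_left mult_1_right norm_of_real abs_of_nonneg powr_ge_zero)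
    also have "\<dots> \<le> s powr (1/2) * (K * s powr (-1/2))" using elim by (intro mult_left_mono) auto
    also have "\<dots> = K * (s powr (1/2) * s powr (-1/2))" by simp
    also have "s powr (1/2) * s powr (-1/2) = 1" using s by (simp add: powr_add[symmetric])
    finally show ?case by simp
  qed
qed

lemma frame_asymp:
  assumes s: "s \<ge> 1"
  shows "AE x in lborel. cmod (frame s x - model s x) \<le> K * s powr (-1/8)"
proof -
  have [measurable]: "u s \<in> borel_measurable borel" using u_measurable[OF s] .
  have [measurable]: "asymptotic_ansatz \<beta> A s \<in> borel_measurable borel"
    unfolding asymptotic_ansatz_def by measurable
  have "AE x in lborel. cmod (u s (x - \<gamma> * s) - asymptotic_ansatz \<beta> A s (x - \<gamma> * s)) \<le> K * s powr (-5/8)"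
    by (rule AE_shift[OF _ u_asymp[OF s]]) measurable
  thus ?thesis
  proof eventually_elim
    case (elim x)
    let ?e = "iexp (- (\<gamma>\<^sup>2 / 4) * s) * iexp (\<gamma> / 2 * x)"
    have d: "(x - \<gamma> * s) / s = x / s - \<gamma>" using s by (simp add: field_simps)
    have "- (\<gamma>\<^sup>2 / 4) * s + \<gamma> / 2 * x + (x - \<gamma> * s)\<^sup>2 / (4 * s) = x\<^sup>2 / (4 * s)"
      using s by (simp add: field_simps power2_eq_square)
    hence "iexp (- (\<gamma>\<^sup>2 / 4) * s + \<gamma> / 2 * x + (x - \<gamma> * s)\<^sup>2 / (4 * s)) = iexp (x\<^sup>2 / (4 * s))"
      by (simp only:)
    hence e: "?e * iexp ((x - \<gamma> * s)\<^sup>2 / (4 * s)) = iexp (x\<^sup>2 / (4 * s))"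
      by (simp only: of_real_add distrib_left exp_add)
    have h: "complex_of_real (s powr (1/2)) * of_real (s powr (-1/2)) = 1"
      using s by (simp add: powr_add[symmetric] flip: of_real_mult)
    have "(of_real (s powr (1/2)) * ?e) * asymptotic_ansatz \<beta> A s (x - \<gamma> * s) =
        (complex_of_real (s powr (1/2)) * of_real (s powr (-1/2))) *
        (?e * iexp ((x - \<gamma> * s)\<^sup>2 / (4 * s))) * (A (x / s - \<gamma>) * iexp (- (\<beta> * (cmod (A (x / s - \<gamma>)))\<^sup>2 * ln s)))"
      unfolding asymptotic_ansatz_def d of_real_minus mult_minus_right by (simp only: mult_ac)
    also have "\<dots> = model s x" unfolding e h model_def by simp
    finally have "frame s x - model s x = (of_real (s powr (1/2)) * ?e) *
        (u s (x - \<gamma> * s) - asymptotic_ansatz \<beta> A s (x - \<gamma> * s))"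
      by (simp only: frame_def right_diff_distrib)
    hence "cmod (frame s x - model s x) = s powr (1/2) * cmod (u s (x - \<gamma> * s) - asymptotic_ansatz \<beta> A s (x - \<gamma> * s))"
      by (simp only: norm_mult norm_exp_i_times mult_1_left mult_1_right norm_of_real abs_of_nonneg powr_ge_zero)
    also have "\<dots> \<le> s powr (1/2) * (K * s powr (-5/8))" using elim by (intro mult_left_mono) auto
    also have "\<dots> = K * (s powr (1/2) * s powr (-5/8))" by simp
    also have "s powr (1/2) * s powr (-5/8) = s powr (-1/8)" by (simp add: powr_add[symmetric])
    finally show ?case .
  qed
qed

text \<open>
The modified phase costs a factor \<open>ln s\<close>, against which Hoelder continuity provides \<open>s powr (-1/4)\<close>.
\<close>

lemma model_lim: "((\<lambda>s. model s x - model0 s) \<longlongrightarrow> 0) at_top"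
proof (rule Lim_null_comparison)
  let ?b = "\<lambda>s. K * (x\<^sup>2 / (4 * s)) + (1 + K * (\<bar>\<beta>\<bar> * (2 * K)) * ln s) * (H * (\<bar>x\<bar> powr (1/4) * s powr (-1/4)))"
  show "(?b \<longlongrightarrow> 0) at_top"
  proof -
    have "((\<lambda>s. K * (x\<^sup>2 / (4 * s)) + (1 + C * ln s) * (H * (y * s powr (-1/4)))) \<longlongrightarrow> 0) at_top" for C y :: real
    proof -
      have 1: "((\<lambda>s::real. 1 / s) \<longlongrightarrow> 0) at_top" by real_asymp
      have 2: "((\<lambda>s::real. s powr (-1/4)) \<longlongrightarrow> 0) at_top" by real_asymp
      have 3: "((\<lambda>s::real. ln s * s powr (-1/4)) \<longlongrightarrow> 0) at_top" by real_asymp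
      have "((\<lambda>s. (K * x\<^sup>2 / 4) * (1 / s) + (H * y) * s powr (-1/4) + (C * H * y) * (ln s * s powr (-1/4)))
          \<longlongrightarrow> (K * x\<^sup>2 / 4) * 0 + (H * y) * 0 + (C * H * y) * 0) at_top"
        by (intro tendsto_intros 1 2 3)
      thus ?thesis by (simp add: algebra_simps)
    qed
    thus ?thesis .
  qed
  have "cmod (model s x - model0 s) \<le> ?b s" if s: "s \<ge> 1" for s
  proof -
    define a where "a = A (x / s - \<gamma>)"
    have ln: "ln s \<ge> 0" using s by simp
    have aK: "cmod a \<le> K" "cmod A0 \<le> K" using A_bound by (auto simp: a_def A0_def)
    have ad: "cmod (a - A0) \<le> H * (\<bar>x\<bar> powr (1/4) * s powr (-1/4))"
    proof -
      have "\<bar>x / s - \<gamma> - (- \<gamma>)\<bar> powr (1/4) = \<bar>x\<bar> powr (1/4) * s powr (-1/4)"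
        using s by (simp add: powr_divide powr_minus field_simps)
      thus ?thesis using A_holder[of "x / s - \<gamma>" "- \<gamma>"] by (simp only: a_def A0_def)
    qed
    define \<theta> where "\<theta> = - (\<beta> * (cmod a)\<^sup>2 * ln s)"
    define \<theta>0 where "\<theta>0 = - (\<alpha> * ln s)"
    have lip: "cmod (iexp t - iexp t') \<le> \<bar>t - t'\<bar>" for t t'
    proof -
      have "iexp t - iexp t' = iexp t' * (iexp (t - t') - 1)"
        by (simp add: right_diff_distrib exp_add[symmetric] algebra_simps)
      hence "cmod (iexp t - iexp t') = cmod (iexp (t - t') - 1)"
        by (simp only: norm_mult norm_exp_i_times mult_1_left)
      thus ?thesis using iexp_approx1[of "t - t'" 0] by simp
    qed
    have th: "\<bar>\<theta> - \<theta>0\<bar> \<le> (\<bar>\<beta>\<bar> * (2 * K)) * ln s * cmod (a - A0)"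
    proof -
      have "\<bar>(cmod a)\<^sup>2 - (cmod A0)\<^sup>2\<bar> = \<bar>cmod a - cmod A0\<bar> * (cmod a + cmod A0)"
        by (simp add: power2_eq_square square_diff_square_factored abs_mult)
      also have "\<dots> \<le> cmod (a - A0) * (2 * K)"
        using aK by (intro mult_mono norm_triangle_ineq3) auto
      finally have q: "\<bar>(cmod a)\<^sup>2 - (cmod A0)\<^sup>2\<bar> \<le> cmod (a - A0) * (2 * K)" .
      have "\<theta> - \<theta>0 = - (\<beta> * ln s) * ((cmod a)\<^sup>2 - (cmod A0)\<^sup>2)"
        by (simp add: \<theta>_def \<theta>0_def \<alpha>_def algebra_simps)
      hence "\<bar>\<theta> - \<theta>0\<bar> = (\<bar>\<beta>\<bar> * ln s) * \<bar>(cmod a)\<^sup>2 - (cmod A0)\<^sup>2\<bar>"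
        using ln by (simp add: abs_mult)
      also have "\<dots> \<le> (\<bar>\<beta>\<bar> * ln s) * (cmod (a - A0) * (2 * K))"
        using ln by (intro mult_left_mono q) auto
      finally show ?thesis by (simp add: mult_ac)
    qed
    have "model s x - model0 s = (iexp (x\<^sup>2 / (4 * s)) - iexp 0) * (a * iexp \<theta>)
        + (a - A0) * iexp \<theta> + A0 * (iexp \<theta> - iexp \<theta>0)"
    proof -
      have "model s x = iexp (x\<^sup>2 / (4 * s)) * (a * iexp \<theta>)" "model0 s = A0 * iexp \<theta>0"
        by (simp_all only: model_def model0_def a_def \<theta>_def \<theta>0_def)
      thus ?thesis by (simp add: algebra_simps)
    qed
    also have "cmod \<dots> \<le> cmod (iexp (x\<^sup>2 / (4 * s)) - iexp 0) * cmod a + cmod (a - A0) + cmod A0 * cmod (iexp \<theta> - iexp \<theta>0)"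
      by (intro order_trans[OF norm_triangle_ineq] add_mono)
         (simp_all only: norm_mult norm_exp_i_times mult_1_right order_refl)
    also have "\<dots> \<le> (x\<^sup>2 / (4 * s)) * K + cmod (a - A0) + K * ((\<bar>\<beta>\<bar> * (2 * K)) * ln s * cmod (a - A0))"
    proof (intro add_mono mult_mono order_refl)
      show "cmod (iexp (x\<^sup>2 / (4 * s)) - iexp 0) \<le> x\<^sup>2 / (4 * s)"
        using lip[of "x\<^sup>2 / (4 * s)" 0] s by simp
      show "cmod (iexp \<theta> - iexp \<theta>0) \<le> (\<bar>\<beta>\<bar> * (2 * K)) * ln s * cmod (a - A0)"
        using lip[of \<theta> \<theta>0] th by linarith
    qed (use aK K s in auto)
    also have "\<dots> = K * (x\<^sup>2 / (4 * s)) + (1 + K * (\<bar>\<beta>\<bar> * (2 * K)) * ln s) * cmod (a - A0)"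
      by (simp add: algebra_simps)
    also have "\<dots> \<le> ?b s"
      using K ln by (intro add_mono mult_left_mono ad order_refl) auto
    finally show ?thesis .
  qed
  thus "\<forall>\<^sub>F s in at_top. norm (model s x - model0 s) \<le> ?b s"
    by (rule eventually_mono[OF eventually_ge_at_top[of 1]])
qed

lemma model_bound: "cmod (model s x) \<le> K" "cmod (model0 s) \<le> K"
  unfolding model_def model0_def norm_mult norm_exp_i_times
  using A_bound by (auto simp: A0_def)

definition g0 :: complex where
  "g0 = of_real (LINT x|lborel. W x) * of_real ((cmod A0) ^ 4) * A0"

text \<open>
The quintic power commutes with unimodular factors, so the weighted pairing is the integral of \<open>W\<close> against the
quintic power of \<open>frame\<close>. The latter is bounded and locally Lipschitz in \<open>frame\<close>, which is within
\<open>K s powr (-1/8)\<close> of \<open>model\<close> almost everywhere. The exceptional set depends on \<open>s\<close>; passing to \<open>model\<close>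
before the limit avoids it, as \<open>model\<close> converges at every \<open>x\<close>.
\<close>

lemma leading_amplitude:
  "((\<lambda>s. of_real (s powr (5/2)) * pairing (moment 0) s - g0 * iexp (- (\<alpha> * ln s))) \<longlongrightarrow> 0) at_top"
proof (rule Lim_null_comparison)
  have m0: "moment 0 x = of_real (W x)" for x by (simp add: moment_def)
  let ?D = "\<lambda>s. LINT x|lborel. \<bar>W x\<bar> * cmod (model s x - model0 s)"
  let ?B = "\<lambda>s. 10 * K ^ 4 * (K * s powr (-1/8) * (LINT x|lborel. \<bar>W x\<bar>) + ?D s)"
  have [measurable]: "model s \<in> borel_measurable borel" for s unfolding model_def by measurable
  have Wm: "integrable lborel (\<lambda>x. \<bar>W x\<bar> * cmod (model s x - model0 s))" for s
  proof (rule Bochner_Integration.integrable_bound[OF integrable_mult_left[OF W_integrable, of "2 * K"]])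
    have "cmod (model s x - model0 s) \<le> 2 * K" for x
      using order_trans[OF norm_triangle_ineq4 add_mono[OF model_bound]] by simp
    thus "AE x in lborel. norm (\<bar>W x\<bar> * cmod (model s x - model0 s)) \<le> norm (\<bar>W x\<bar> * (2 * K))"
      using K by (intro AE_I2) (auto simp: abs_mult intro!: mult_left_mono)
  qed measurable
  have D: "(?D \<longlongrightarrow> 0) at_top"
  proof -
    have "(?D \<longlongrightarrow> (LINT x::real|lborel. (0::real))) at_top"
    proof (rule integral_dominated_convergence_at_top)
      show "integrable lborel (\<lambda>x. \<bar>W x\<bar> * (2 * K))" by (intro integrable_mult_left W_integrable)
      show "AE x in lborel. ((\<lambda>s. \<bar>W x\<bar> * cmod (model s x - model0 s)) \<longlongrightarrow> 0) at_top"
        by (intro AE_I2 tendsto_mult_right_zero tendsto_norm_zero model_lim)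
      have "cmod (model s x - model0 s) \<le> 2 * K" for s x
        using order_trans[OF norm_triangle_ineq4 add_mono[OF model_bound]] by simp
      thus "\<forall>\<^sub>F s in at_top. AE x in lborel. norm (\<bar>W x\<bar> * cmod (model s x - model0 s)) \<le> \<bar>W x\<bar> * (2 * K)"
        by (intro always_eventually allI AE_I2) (auto simp: abs_mult intro!: mult_left_mono)
    qed measurable
    thus ?thesis by simp
  qed
  have "((\<lambda>s::real. s powr (-1/8)) \<longlongrightarrow> 0) at_top" by real_asymp
  hence "(?B \<longlongrightarrow> 10 * K ^ 4 * (K * 0 * (LINT x|lborel. \<bar>W x\<bar>) + 0)) at_top"
    by (intro tendsto_intros D)
  thus "(?B \<longlongrightarrow> 0) at_top" by simp
  have "cmod (of_real (s powr (5/2)) * pairing (moment 0) s - g0 * iexp (- (\<alpha> * ln s))) \<le> ?B s" if s: "s \<ge> 1" for s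
  proof -
    have [measurable]: "u s \<in> borel_measurable borel" using u_measurable[OF s] .
    have [measurable]: "frame s \<in> borel_measurable borel" unfolding frame_def by measurable
    let ?e = "iexp (- (\<gamma>\<^sup>2 / 4) * s)"
    have fr: "mod_power 4 (frame s x) = of_real (s powr (5/2)) * (?e * (iexp (\<gamma> / 2 * x) * N 4 s (x - \<gamma> * s)))" for x
    proof -
      have n: "cmod (frame s x) = s powr (1/2) * cmod (u s (x - \<gamma> * s))"
        by (simp only: frame_def norm_mult norm_exp_i_times mult_1_left mult_1_right norm_of_real abs_of_nonneg powr_ge_zero)
      have "(s powr (1/2)) ^ 4 * s powr (1/2) = (s powr (1/2)) ^ 5"
        using power_Suc2[of "s powr (1/2)" 4] by simp
      also have "\<dots> = s powr (5/2)" using s by (simp add: powr_power)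
      finally have "(s powr (1/2)) ^ 4 * s powr (1/2) = s powr (5/2)" .
      hence "complex_of_real (s powr (5/2)) = of_real ((s powr (1/2)) ^ 4) * of_real (s powr (1/2))"
        by (metis of_real_mult)
      thus ?thesis
        unfolding mod_power_def n power_mult_distrib
          of_real_mult[of "(s powr (1/2)) ^ 4" "cmod (u s (x - \<gamma> * s)) ^ 4"]
        by (simp only: frame_def mult_ac)
    qed
    have i1: "integrable lborel (\<lambda>x. of_real (W x) * mod_power 4 (frame s x))"
    proof (rule Bochner_Integration.integrable_bound[OF integrable_mult_left[OF W_integrable, of "K ^ 5"]])
      show "AE x in lborel. norm (of_real (W x) * mod_power 4 (frame s x)) \<le> norm (\<bar>W x\<bar> * K ^ 5)"
        using frame_bound[OF s]
      proof eventually_elim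
        case (elim x)
        have "cmod (frame s x) ^ 5 \<le> K ^ 5" using elim by (intro power_mono) auto
        thus ?case using K by (simp add: norm_mult norm_mod_power abs_mult mult_left_mono)
      qed
    qed measurable
    have Wc: "integrable lborel (\<lambda>x. complex_of_real (W x))"
      using W_integrable by (subst integrable_norm_iff[symmetric]) auto
    have i2: "integrable lborel (\<lambda>x. of_real (W x) * mod_power 4 (model0 s))"
      using Wc by (rule integrable_mult_left)
    have "of_real (s powr (5/2)) * pairing (moment 0) s = of_real (s powr (5/2)) * (?e *
        (LINT x|lborel. iexp (\<gamma> / 2 * x) * of_real (W x) * N 4 s (x - \<gamma> * s)))"
      unfolding pairing_def m0
      by (subst lborel_integral_real_affine[where c = 1 and t = "- \<gamma> * s"]) simp_all
    also have "\<dots> = (LINT x|lborel. of_real (W x) * mod_power 4 (frame s x))"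
      unfolding fr integral_mult_right_zero[symmetric] by (simp only: mult_ac)
    finally have e1: "of_real (s powr (5/2)) * pairing (moment 0) s = (LINT x|lborel. of_real (W x) * mod_power 4 (frame s x))" .
    have "cmod (model0 s) = cmod A0" by (simp only: model0_def norm_mult norm_exp_i_times mult_1_right)
    hence "mod_power 4 (model0 s) = of_real (cmod A0 ^ 4) * A0 * iexp (- (\<alpha> * ln s))"
      by (simp add: mod_power_def model0_def)
    hence e2: "g0 * iexp (- (\<alpha> * ln s)) = (LINT x|lborel. of_real (W x) * mod_power 4 (model0 s))"
      by (simp add: g0_def mult_ac)
    have "cmod (of_real (s powr (5/2)) * pairing (moment 0) s - g0 * iexp (- (\<alpha> * ln s)))
        = cmod (LINT x|lborel. of_real (W x) * mod_power 4 (frame s x) - of_real (W x) * mod_power 4 (model0 s))"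
      unfolding e1 e2 using i1 i2 by (subst Bochner_Integration.integral_diff) auto
    also have "\<dots> \<le> (LINT x|lborel. cmod (of_real (W x) * mod_power 4 (frame s x) - of_real (W x) * mod_power 4 (model0 s)))"
      by (rule integral_norm_bound)
    also have "\<dots> \<le> (LINT x|lborel. 10 * K ^ 4 * (K * s powr (-1/8) * \<bar>W x\<bar> + \<bar>W x\<bar> * cmod (model s x - model0 s)))"
    proof (rule integral_mono_AE)
      show "integrable lborel (\<lambda>x. cmod (of_real (W x) * mod_power 4 (frame s x) - of_real (W x) * mod_power 4 (model0 s)))"
        using i1 i2 by (intro integrable_norm Bochner_Integration.integrable_diff)
      show "integrable lborel (\<lambda>x. 10 * K ^ 4 * (K * s powr (-1/8) * \<bar>W x\<bar> + \<bar>W x\<bar> * cmod (model s x - model0 s)))"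
        by (intro integrable_mult_right Bochner_Integration.integrable_add W_integrable Wm)
      show "AE x in lborel. cmod (of_real (W x) * mod_power 4 (frame s x) - of_real (W x) * mod_power 4 (model0 s))
          \<le> 10 * K ^ 4 * (K * s powr (-1/8) * \<bar>W x\<bar> + \<bar>W x\<bar> * cmod (model s x - model0 s))"
        using frame_bound[OF s] frame_asymp[OF s]
      proof eventually_elim
        case (elim x)
        have "cmod (mod_power 4 (frame s x) - mod_power 4 (model0 s))
            \<le> 5 * K ^ 3 * ((cmod (frame s x) + cmod (model0 s)) * cmod (frame s x - model0 s))"
          using mod_power_lipschitz[OF elim(1) model_bound(2), of 3] by (simp add: eval_nat_numeral)
        also have "\<dots> \<le> 5 * K ^ 3 * ((K + K) * (K * s powr (-1/8) + cmod (model s x - model0 s)))"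
        proof (intro mult_left_mono mult_mono add_mono elim(1) model_bound(2))
          have "frame s x - model0 s = (frame s x - model s x) + (model s x - model0 s)" by simp
          thus "cmod (frame s x - model0 s) \<le> K * s powr (-1/8) + cmod (model s x - model0 s)"
            using elim(2) norm_triangle_ineq[of "frame s x - model s x" "model s x - model0 s"] by simp
        qed (use K in auto)
        also have "\<dots> = 10 * K ^ 4 * (K * s powr (-1/8) + cmod (model s x - model0 s))"
          by (simp add: eval_nat_numeral algebra_simps)
        finally have "\<bar>W x\<bar> * cmod (mod_power 4 (frame s x) - mod_power 4 (model0 s))
            \<le> \<bar>W x\<bar> * (10 * K ^ 4 * (K * s powr (-1/8) + cmod (model s x - model0 s)))"
          by (intro mult_left_mono) auto
        moreover have "cmod (of_real (W x) * mod_power 4 (frame s x) - of_real (W x) * mod_power 4 (model0 s))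
            = \<bar>W x\<bar> * cmod (mod_power 4 (frame s x) - mod_power 4 (model0 s))"
          by (simp only: right_diff_distrib[symmetric] norm_mult norm_of_real)
        ultimately show ?case by (simp add: algebra_simps)
      qed
    qed
    also have "\<dots> = ?B s"
      using W_integrable Wm by simp
    finally show ?thesis .
  qed
  thus "\<forall>\<^sub>F s in at_top. norm (of_real (s powr (5/2)) * pairing (moment 0) s - g0 * iexp (- (\<alpha> * ln s))) \<le> ?B s"
    by (rule eventually_mono[OF eventually_ge_at_top[of 1]])
qed

lemma initial_datum_expansion:
  "cubic_peano (\<lambda>r. iexp ((- \<gamma> / 2 + r)\<^sup>2) * fourier (u 1) (- \<gamma> / 2 + r))"
proof (rule cubic_peano_mult)
  have "iexp ((- \<gamma> / 2 + r)\<^sup>2) = iexp ((\<gamma> / 2)\<^sup>2) * (iexp (- \<gamma> * r) * iexp (r\<^sup>2))" for r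
  proof -
    have "(- \<gamma> / 2 + r)\<^sup>2 = (\<gamma> / 2)\<^sup>2 + (- \<gamma> * r + r\<^sup>2)" by (simp add: power2_eq_square field_simps)
    hence "iexp ((- \<gamma> / 2 + r)\<^sup>2) = iexp ((\<gamma> / 2)\<^sup>2 + (- \<gamma> * r + r\<^sup>2))" by (simp only:)
    thus ?thesis by (simp only: of_real_add distrib_left exp_add)
  qed
  thus "cubic_peano (\<lambda>r. iexp ((- \<gamma> / 2 + r)\<^sup>2))"
    by (simp only:) (intro cubic_peano_mult cubic_peano_const cubic_peano_iexp_linear cubic_peano_iexp_square)
  have [measurable]: "u 1 \<in> borel_measurable borel" by (rule u_measurable) simp
  have n: "cmod (iexp (\<gamma> / 2 * x) * u 1 x) = cmod (u 1 x)" for x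
    by (simp only: norm_mult norm_exp_i_times mult_1_left)
  have "cubic_peano (\<lambda>r. LINT x|lborel. iexp (- (r * x)) * (iexp (\<gamma> / 2 * x) * u 1 x))"
    by (rule cubic_peano_fourier) (measurable, simp only: n u1_moments)
  moreover have "fourier (u 1) (- \<gamma> / 2 + r) = (LINT x|lborel. iexp (- (r * x)) * (iexp (\<gamma> / 2 * x) * u 1 x))" for r
    unfolding fourier_def
  proof (intro Bochner_Integration.integral_cong refl)
    fix x :: real
    have "- (\<i> * of_real ((- \<gamma> / 2 + r) * x)) = \<i> * of_real (- (r * x)) + \<i> * of_real (\<gamma> / 2 * x)"
      by (simp add: algebra_simps)
    thus "exp (- (\<i> * of_real ((- \<gamma> / 2 + r) * x))) * u 1 x = iexp (- (r * x)) * (iexp (\<gamma> / 2 * x) * u 1 x)"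
      by (simp only: exp_add mult.assoc)
  qed
  ultimately show "cubic_peano (\<lambda>r. fourier (u 1) (- \<gamma> / 2 + r))" by (simp only:)
qed

section \<open>The expansion at the resonant frequency\<close>

theorem profile_expansion:
  assumes P: "\<And>\<zeta>. ((\<lambda>t. renormalized_profile \<beta> u t \<zeta>) \<longlongrightarrow> P \<zeta>) at_top"
  shows "cubic_peano (\<lambda>r. P (- \<gamma> / 2 + r) -
           \<i> * (g0 * C_res \<alpha> * resonant \<alpha> r))"
proof -
  let ?S = "\<lambda>r. g0 * C_res \<alpha> * resonant \<alpha> r"
  let ?o = "\<lambda>k. decaying_amplitude.osc (pairing (moment k))"
  have rem: "cubic_peano (\<lambda>r. wave_rem.osc r r)"
    by (rule cubic_peano_transfer[OF cubic_peano_const[of 0]]) (use wave_rem_osc_small in simp)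
  have o0: "cubic_peano (\<lambda>r. ?o 0 r - ?S r)"
    by (rule decaying_amplitude.cubic_peano_osc[OF moment_amplitude leading_amplitude]) simp
  have ok: "cubic_peano (\<lambda>r. \<Sum>k=1..3. of_real r ^ k * ?o k r)"
    by (intro cubic_peano_sum decaying_amplitude.cubic_peano_power_osc[OF moment_amplitude]) auto
  have "cubic_peano (\<lambda>r. iexp ((- \<gamma> / 2 + r)\<^sup>2) * fourier (u 1) (- \<gamma> / 2 + r) +
      \<i> * ((?o 0 r - ?S r) + (\<Sum>k=1..3. of_real r ^ k * ?o k r) + wave_rem.osc r r))"
    by (intro cubic_peano_add initial_datum_expansion cubic_peano_mult cubic_peano_const o0 ok rem)
  moreover have "P (- \<gamma> / 2 + r) - \<i> * ?S r = iexp ((- \<gamma> / 2 + r)\<^sup>2) * fourier (u 1) (- \<gamma> / 2 + r) +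
      \<i> * ((?o 0 r - ?S r) + (\<Sum>k=1..3. of_real r ^ k * ?o k r) + wave_rem.osc r r)" for r
  proof -
    have "(\<Sum>k\<le>3. of_real r ^ k * ?o k r) = ?o 0 r + (\<Sum>k=1..3. of_real r ^ k * ?o k r)"
      by (simp add: atMost_atLeast0 sum.atLeast_Suc_atMost)
    thus ?thesis unfolding limit_formula[OF P] wave_osc_expand by (simp only: right_diff_distrib distrib_left) simp
  qed
  ultimately show ?thesis by (simp only:)
qed

end

section \<open>Uniqueness of the resonant term and Taylor polynomials\<close>

lemma cmod_powr_cubic: "r \<noteq> 0 \<Longrightarrow> cmod (resonant \<alpha> r) = \<bar>r\<bar> ^ 3"
proof -
  assume "r \<noteq> 0"
  hence "cmod (resonant \<alpha> r) = \<bar>r\<bar> powr 3"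
    by (subst norm_powr_real_powr) auto
  also have "\<dots> = \<bar>r\<bar> ^ 3" using \<open>r \<noteq> 0\<close> powr_realpow[of "\<bar>r\<bar>" 3] by simp
  finally show ?thesis .
qed

text \<open>
The sum \<open>E\<close> of the values at \<open>r\<close> and \<open>- r\<close> is an even polynomial while the resonant term is even. As \<open>E\<close>
is then \<open>O(r\<^sup>3)\<close>, its coefficients of order \<open>0\<close> and \<open>2\<close> vanish, so that \<open>E = O(r\<^sup>4)\<close> and the resonant
term, whose modulus is \<open>|c| |r|\<^sup>3\<close>, would be \<open>o(r\<^sup>3)\<close>.
\<close>

lemma polynomial_not_resonant:
  fixes q :: "complex poly"
  assumes small: "(\<lambda>r. poly q (of_real r) - c * resonant \<alpha> r)
             \<in> o_cube"
  shows "c = 0"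
proof -
  define S where "S r = resonant \<alpha> r" for r
  define D where "D r = (poly q (of_real r) - c * S r) / of_real (\<bar>r\<bar> ^ 3)" for r
  have D: "(D \<longlongrightarrow> 0) (at 0)"
    using small unfolding smallo_cube_iff D_def S_def .
  have "filterlim (\<lambda>r::real. - r) (at 0) (at 0)"
    by (auto simp: filterlim_at eventually_at_filter intro!: tendsto_eq_intros)
  from filterlim_compose[OF D this] have D': "((\<lambda>r. D (- r)) \<longlongrightarrow> 0) (at 0)" .
  obtain a0 a1 a2 a3 s where q: "q = pCons a0 (pCons a1 (pCons a2 (pCons a3 s)))"
    by (metis pCons_cases)
  define E where "E r = 2 * a0 + 2 * a2 * of_real r ^ 2 + of_real r ^ 4 * (poly s (of_real r) + poly s (- of_real r))" for r :: real
  have E: "poly q (of_real r) + poly q (of_real (- r)) = E r" for r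
    by (simp add: q E_def algebra_simps power_numeral_reduce eval_nat_numeral)
  have sum: "((\<lambda>r. (E r - 2 * c * S r) / of_real (\<bar>r\<bar> ^ 3)) \<longlongrightarrow> 0) (at 0)"
  proof -
    have "D r + D (- r) = (E r - 2 * c * S r) / of_real (\<bar>r\<bar> ^ 3)" for r
      unfolding D_def E[symmetric] by (simp add: S_def add_divide_distrib diff_divide_distrib)
    thus ?thesis using tendsto_add[OF D D'] by simp
  qed
  have S0: "((\<lambda>r. S r / of_real (\<bar>r\<bar> ^ 2)) \<longlongrightarrow> 0) (at 0)"
  proof (rule Lim_null_comparison)
    show "((\<lambda>r::real. \<bar>r\<bar>) \<longlongrightarrow> 0) (at 0)" by (auto intro!: tendsto_eq_intros)
    show "\<forall>\<^sub>F r in at 0. norm (S r / of_real (\<bar>r\<bar> ^ 2)) \<le> \<bar>r\<bar>"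
      by (auto simp: eventually_at_filter S_def norm_divide norm_mult cmod_powr_cubic eval_nat_numeral)
  qed
  have r1: "((\<lambda>r. complex_of_real \<bar>r\<bar>) \<longlongrightarrow> 0) (at 0)" by (auto intro!: tendsto_eq_intros)
  have E2: "((\<lambda>r. E r / of_real (\<bar>r\<bar> ^ 2)) \<longlongrightarrow> 0) (at 0)"
  proof (rule Lim_transform_eventually)
    show "((\<lambda>r. (E r - 2 * c * S r) / of_real (\<bar>r\<bar> ^ 3) * of_real \<bar>r\<bar> + 2 * c * (S r / of_real (\<bar>r\<bar> ^ 2))) \<longlongrightarrow> 0) (at 0)"
      using tendsto_add[OF tendsto_mult[OF sum r1] tendsto_mult_right_zero[OF S0, of "2 * c"]] by simp
    show "\<forall>\<^sub>F r in at 0. (E r - 2 * c * S r) / of_real (\<bar>r\<bar> ^ 3) * of_real \<bar>r\<bar> + 2 * c * (S r / of_real (\<bar>r\<bar> ^ 2)) = E r / of_real (\<bar>r\<bar> ^ 2)"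
      by (auto simp: eventually_at_filter field_simps eval_nat_numeral)
  qed
  have "((\<lambda>r. E r) \<longlongrightarrow> 2 * a0) (at 0)"
    unfolding E_def by (auto intro!: tendsto_eq_intros)
  moreover have "((\<lambda>r. E r) \<longlongrightarrow> 0) (at 0)"
  proof (rule Lim_transform_eventually)
    show "((\<lambda>r. E r / of_real (\<bar>r\<bar> ^ 2) * (of_real \<bar>r\<bar>) ^ 2) \<longlongrightarrow> 0) (at 0)"
      using tendsto_mult[OF E2 tendsto_power[OF r1, of 2]] by simp
    show "\<forall>\<^sub>F r in at 0. E r / of_real (\<bar>r\<bar> ^ 2) * (of_real \<bar>r\<bar>) ^ 2 = E r"
      unfolding eventually_at_filter of_real_power[symmetric]
      by (intro always_eventually) simp
  qed
  ultimately have a0: "a0 = 0" using tendsto_unique[of "at (0::real)" E "2 * a0" 0] by simp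
  have "((\<lambda>r. 2 * a2 + of_real r ^ 2 * (poly s (of_real r) + poly s (- of_real r))) \<longlongrightarrow> 2 * a2) (at 0)"
    by (auto intro!: tendsto_eq_intros)
  hence "((\<lambda>r. E r / of_real (\<bar>r\<bar> ^ 2)) \<longlongrightarrow> 2 * a2) (at 0)"
    by (rule Lim_transform_eventually)
       (auto simp: eventually_at_filter E_def a0 field_simps eval_nat_numeral)
  hence a2: "a2 = 0" using tendsto_unique[OF _ E2, of "2 * a2"] by simp
  have "((\<lambda>r. of_real \<bar>r\<bar> * (poly s (of_real r) + poly s (- of_real r))) \<longlongrightarrow> 0) (at 0)"
    by (auto intro!: tendsto_eq_intros)
  hence E3: "((\<lambda>r. E r / of_real (\<bar>r\<bar> ^ 3)) \<longlongrightarrow> 0) (at 0)"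
  proof (rule Lim_transform_eventually)
    show "\<forall>\<^sub>F r in at 0. of_real \<bar>r\<bar> * (poly s (of_real r) + poly s (- of_real r)) = E r / of_real (\<bar>r\<bar> ^ 3)"
    proof (unfold eventually_at_filter, intro always_eventually allI impI)
      fix r :: real assume "r \<noteq> 0"
      moreover have "complex_of_real r ^ 4 = of_real \<bar>r\<bar> * of_real (\<bar>r\<bar> ^ 3)"
        using power4_split(1)[of "\<bar>r\<bar>"] by (simp flip: of_real_mult of_real_power)
      ultimately show "of_real \<bar>r\<bar> * (poly s (of_real r) + poly s (- of_real r)) = E r / of_real (\<bar>r\<bar> ^ 3)"
        by (simp add: E_def a0 a2)
    qed
  qed
  have "((\<lambda>r. 2 * c * (S r / of_real (\<bar>r\<bar> ^ 3))) \<longlongrightarrow> 0) (at 0)"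
    using tendsto_diff[OF E3 sum] by (simp add: diff_divide_distrib)
  from tendsto_norm_zero[OF this]
  have n1: "((\<lambda>r. cmod (2 * c * (S r / of_real (\<bar>r\<bar> ^ 3)))) \<longlongrightarrow> 0) (at 0)" .
  have n2: "((\<lambda>r::real. cmod (2 * c * (S r / of_real (\<bar>r\<bar> ^ 3)))) \<longlongrightarrow> cmod (2 * c)) (at 0)"
    by (rule tendsto_eventually) (auto simp: eventually_at_filter norm_mult norm_divide norm_power S_def cmod_powr_cubic)
  have "cmod (2 * c) = 0" by (rule tendsto_unique[OF _ n2 n1]) simp
  thus "c = 0" by simp
qed

text \<open>
By the mean value inequality, an estimate \<open>o(r\<^sup>n)\<close> for the derivative gains one power.
\<close>

lemma peano_integrate:
  fixes G g :: "real \<Rightarrow> complex"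
  assumes e: "e > 0" and G: "\<And>r. \<bar>r\<bar> < e \<Longrightarrow> (G has_vector_derivative g r) (at r)"
    and G0: "G 0 = 0" and g0: "g 0 = 0"
    and g: "((\<lambda>r. g r / of_real (\<bar>r\<bar> ^ n)) \<longlongrightarrow> 0) (at 0)"
  shows "((\<lambda>r. G r / of_real (\<bar>r\<bar> ^ Suc n)) \<longlongrightarrow> 0) (at 0)"
  unfolding tendsto_iff
proof (intro allI impI)
  fix c :: real assume c: "c > 0"
  have "\<forall>\<^sub>F r in at 0. dist (g r / of_real (\<bar>r\<bar> ^ n)) 0 < c / 2"
    using g c by (intro tendstoD) auto
  then obtain d where d: "d > 0" and gd: "\<And>r. r \<noteq> 0 \<Longrightarrow> \<bar>r\<bar> < d \<Longrightarrow> cmod (g r) / \<bar>r\<bar> ^ n < c / 2"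
    by (auto simp: eventually_at dist_norm norm_divide norm_power)
  have gb: "cmod (g x) \<le> c / 2 * \<bar>r\<bar> ^ n" if "\<bar>x\<bar> \<le> \<bar>r\<bar>" "\<bar>r\<bar> < d" for x r
  proof (cases "x = 0")
    case False
    have "cmod (g x) \<le> c / 2 * \<bar>x\<bar> ^ n"
      using gd[OF False] that False by (simp add: divide_less_eq mult.commute)
    also have "\<dots> \<le> c / 2 * \<bar>r\<bar> ^ n" using that c by (intro mult_left_mono power_mono) auto
    finally show ?thesis .
  qed (use g0 c in auto)
  have "dist (G r / of_real (\<bar>r\<bar> ^ Suc n)) 0 < c" if r: "r \<noteq> 0" "\<bar>r\<bar> < min d e" for r
  proof -
    have "norm (G r - G 0) \<le> (c / 2 * \<bar>r\<bar> ^ n) * norm (r - 0)"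
    proof (rule differentiable_bound[where S = "{- \<bar>r\<bar>..\<bar>r\<bar>}" and f' = "\<lambda>x h. h *\<^sub>R g x"])
      fix x assume x: "x \<in> {- \<bar>r\<bar>..\<bar>r\<bar>}"
      hence xr: "\<bar>x\<bar> \<le> \<bar>r\<bar>" by auto
      show "(G has_derivative (\<lambda>h. h *\<^sub>R g x)) (at x within {- \<bar>r\<bar>..\<bar>r\<bar>})"
        using G[of x] xr r unfolding has_vector_derivative_def by (auto intro: has_derivative_at_withinI)
      show "onorm (\<lambda>h. h *\<^sub>R g x) \<le> c / 2 * \<bar>r\<bar> ^ n"
      proof (rule onorm_le)
        show "norm (h *\<^sub>R g x) \<le> c / 2 * \<bar>r\<bar> ^ n * norm h" for h :: real
          using mult_right_mono[OF gb[OF xr], of "norm h"] r by (simp add: mult.commute)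
      qed
    qed (use r in auto)
    hence "cmod (G r) \<le> c / 2 * \<bar>r\<bar> ^ Suc n" by (simp add: G0 mult_ac)
    also have "\<dots> < c * \<bar>r\<bar> ^ Suc n" using c r by (intro mult_strict_right_mono) auto
    finally show ?thesis using r by (simp add: dist_norm norm_divide norm_mult norm_power divide_less_eq)
  qed
  thus "\<forall>\<^sub>F r in at 0. dist (G r / of_real (\<bar>r\<bar> ^ Suc n)) 0 < c"
    using d e by (auto simp: eventually_at dist_norm intro!: exI[of _ "min d e"])
qed

text \<open>
The definition of the third derivative gives a first-order expansion of the second one, which is integrated twice.
\<close>

lemma C3_Taylor:
  assumes U: "open U" "\<zeta> \<in> U" and C: "C_k_on 3 P U"
  shows "\<exists>q :: complex poly. degree q \<le> 3 \<and>
           (\<lambda>r. P (\<zeta> + r) - poly q (of_real r)) \<in> o_cube"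
proof -
  obtain e where e: "e > 0" "\<And>x. \<bar>x - \<zeta>\<bar> < e \<Longrightarrow> x \<in> U"
    using U by (auto simp: open_dist dist_real_def)
  define d where "d j = nth_deriv j P" for j
  have d0: "d 0 = P" by (simp add: d_def nth_deriv_def)
  have der: "(d j has_vector_derivative d (Suc j) x) (at x)" if "j < 3" "x \<in> U" for j x
  proof -
    have "d j differentiable (at x)" using C that by (auto simp: C_k_on_def d_def)
    hence "(d j has_vector_derivative vector_derivative (d j) (at x)) (at x)"
      by (simp add: vector_derivative_works)
    thus ?thesis by (simp add: d_def nth_deriv_def)
  qed
  have sh: "((\<lambda>r. d j (\<zeta> + r)) has_vector_derivative d (Suc j) (\<zeta> + r)) (at r)" if "j < 3" "\<bar>r\<bar> < e" for j r
  proof -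
    have "((\<lambda>r. \<zeta> + r) has_vector_derivative 1) (at r)" by (auto intro!: derivative_eq_intros)
    from vector_diff_chain_at[OF this der[OF that(1) e(2)]] that(2)
    show ?thesis by (simp add: o_def)
  qed
  define G2 where "G2 r = d 2 (\<zeta> + r) - (d 2 \<zeta> + of_real r * d 3 \<zeta>)" for r
  define G1 where "G1 r = d 1 (\<zeta> + r) - (d 1 \<zeta> + of_real r * d 2 \<zeta> + of_real r ^ 2 / 2 * d 3 \<zeta>)" for r
  define G0 where "G0 r = d 0 (\<zeta> + r) - (d 0 \<zeta> + of_real r * d 1 \<zeta> + of_real r ^ 2 / 2 * d 2 \<zeta> + of_real r ^ 3 / 6 * d 3 \<zeta>)" for r
  have pw: "((\<lambda>r. complex_of_real r ^ Suc n) has_vector_derivative of_nat (Suc n) * of_real r ^ n) (at r)" for n r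
    by (rule has_vector_derivative_real_field[where f = "\<lambda>w. w ^ Suc n"],
        rule DERIV_power_Suc[OF DERIV_ident, THEN DERIV_cong]) simp
  have lin: "(complex_of_real has_vector_derivative 1) (at r)" for r
    using pw[of 0 r] by simp
  have G2: "((\<lambda>r. G2 r / of_real (\<bar>r\<bar> ^ 1)) \<longlongrightarrow> 0) (at 0)"
  proof (rule tendsto_norm_zero_cancel)
    have "(d 2 has_derivative (\<lambda>h. h *\<^sub>R d 3 \<zeta>)) (at \<zeta>)"
      using der[of 2 \<zeta>] U by (simp add: has_vector_derivative_def eval_nat_numeral)
    hence "((\<lambda>h. norm (d 2 (\<zeta> + h) - d 2 \<zeta> - h *\<^sub>R d 3 \<zeta>) / norm h) \<longlongrightarrow> 0) (at 0)"
      unfolding has_derivative_at by simp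
    thus "((\<lambda>r. norm (G2 r / of_real (\<bar>r\<bar> ^ 1))) \<longlongrightarrow> 0) (at 0)"
      by (simp add: G2_def norm_divide scaleR_conv_of_real diff_diff_eq)
  qed
  have "((\<lambda>r. G1 r / of_real (\<bar>r\<bar> ^ Suc 1)) \<longlongrightarrow> 0) (at 0)"
  proof (rule peano_integrate[OF e(1) _ _ _ G2])
    fix r :: real assume r: "\<bar>r\<bar> < e"
    show "(G1 has_vector_derivative G2 r) (at r)"
      unfolding G1_def G2_def
      by (rule derivative_eq_intros sh[OF _ r] lin pw[of 1, simplified] refl | simp add: eval_nat_numeral)+
  qed (auto simp: G1_def G2_def)
  hence "((\<lambda>r. G0 r / of_real (\<bar>r\<bar> ^ Suc (Suc 1))) \<longlongrightarrow> 0) (at 0)"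
  proof (rule peano_integrate[OF e(1), rotated 3])
    fix r :: real assume r: "\<bar>r\<bar> < e"
    show "(G0 has_vector_derivative G1 r) (at r)"
      unfolding G0_def G1_def
      by (rule derivative_eq_intros sh[OF _ r] lin pw[of 1, simplified] pw[of 2, simplified] refl | simp add: eval_nat_numeral)+
  qed (auto simp: G0_def G1_def)
  hence lim: "((\<lambda>r. G0 r / of_real (\<bar>r\<bar> ^ 3)) \<longlongrightarrow> 0) (at 0)" by (simp add: eval_nat_numeral)
  define q where "q = [: d 0 \<zeta>, d 1 \<zeta>, d 2 \<zeta> / 2, d 3 \<zeta> / 6 :]"
  have "P (\<zeta> + r) - poly q (of_real r) = G0 r" for r
    by (simp add: q_def G0_def d0 field_simps eval_nat_numeral)
  moreover have "degree q \<le> 3" by (simp add: q_def)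
  ultimately show ?thesis using lim by (auto simp only: smallo_cube_iff)
qed

section \<open>From the small-data theory to the hypotheses of the expansion\<close>

lemma Linf_norm_bound:
  assumes "in_Linf f"
  shows "AE x in lborel. cmod (f x) \<le> Linf_norm f" and "Linf_norm f \<ge> 0"
proof -
  let ?B = "{B. 0 \<le> B \<and> (AE x in lborel. cmod (f x) \<le> B)}"
  obtain B where "AE x in lborel. cmod (f x) \<le> B" using assms by (auto simp: in_Linf_def)
  hence "AE x in lborel. cmod (f x) \<le> \<bar>B\<bar>" by (auto elim!: eventually_mono)
  hence "\<bar>B\<bar> \<in> ?B" by simp
  hence ne: "?B \<noteq> {}" by blast
  show "Linf_norm f \<ge> 0" unfolding Linf_norm_def by (rule cInf_greatest[OF ne]) auto
  have "AE x in lborel. cmod (f x) \<le> Linf_norm f + inverse (Suc n)" for n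
  proof -
    have "Inf ?B < Linf_norm f + inverse (Suc n)" by (simp add: Linf_norm_def)
    then obtain b where "b \<in> ?B" "b < Linf_norm f + inverse (Suc n)" using cInf_lessD[OF ne] by blast
    thus ?thesis by (auto elim!: eventually_mono)
  qed
  hence "AE x in lborel. \<forall>n. cmod (f x) \<le> Linf_norm f + inverse (Suc n)" by (simp add: AE_all_countable)
  thus "AE x in lborel. cmod (f x) \<le> Linf_norm f"
  proof eventually_elim
    case (elim x)
    have "(\<lambda>n. Linf_norm f + inverse (real (Suc n))) \<longlonglongrightarrow> Linf_norm f + 0"
      by (intro tendsto_intros LIMSEQ_inverse_real_of_nat)
    thus ?case using elim by (intro LIMSEQ_le_const[of _ "Linf_norm f"]) auto
  qed
qed

lemma in_L2_cong_AE:
  assumes "AE x in lborel. f x = g x" "in_L2 f" "g \<in> borel_measurable borel"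
  shows "in_L2 g" "L2_norm g = L2_norm f"
proof -
  have [measurable]: "f \<in> borel_measurable borel" "g \<in> borel_measurable borel"
    using assms by (auto simp: in_L2_def)
  have "integrable lborel (\<lambda>x. (cmod (f x))\<^sup>2) = integrable lborel (\<lambda>x. (cmod (g x))\<^sup>2)"
    by (rule integrable_cong_AE) (use assms(1) in auto)
  thus "in_L2 g" using assms by (simp add: in_L2_def)
  have "(LINT x|lborel. (cmod (g x))\<^sup>2) = (LINT x|lborel. (cmod (f x))\<^sup>2)"
    by (rule integral_cong_AE) (use assms(1) in auto)
  thus "L2_norm g = L2_norm f" by (simp add: L2_norm_def)
qed

lemma in_Linf_cong_AE:
  assumes eq: "AE x in lborel. f x = g x" and "in_Linf f" "g \<in> borel_measurable borel"
  shows "in_Linf g" "Linf_norm g = Linf_norm f"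
proof -
  have "(AE x in lborel. cmod (g x) \<le> B) \<longleftrightarrow> (AE x in lborel. cmod (f x) \<le> B)" for B
  proof
    assume "AE x in lborel. cmod (g x) \<le> B"
    with eq show "AE x in lborel. cmod (f x) \<le> B" by eventually_elim simp
  next
    assume "AE x in lborel. cmod (f x) \<le> B"
    with eq show "AE x in lborel. cmod (g x) \<le> B" by eventually_elim simp
  qed
  thus "in_Linf g" "Linf_norm g = Linf_norm f"
    using assms by (simp_all add: in_Linf_def Linf_norm_def)
qed

text \<open>
The small-data theory speaks of some solution with the given datum. Uniqueness identifies it with \<open>u\<close> only up to
null sets, and uniqueness of its profile transfers the Sobolev regularity to \<open>A\<close>.
\<close>

lemma modified_scattering_profile_cong_AE:
  assumes A: "modified_scattering_profile \<beta> C \<epsilon> \<delta> u A"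
    and eq: "\<And>t. t \<ge> 1 \<Longrightarrow> AE y in lborel. u t y = v t y"
    and v: "\<And>t. t \<ge> 1 \<Longrightarrow> v t \<in> borel_measurable borel"
  shows "modified_scattering_profile \<beta> C \<epsilon> \<delta> v A"
proof -
  have [measurable]: "A \<in> borel_measurable borel"
    using A by (simp add: modified_scattering_profile_def in_L2_def)
  have "in_L2 (\<lambda>y. v t y - asymptotic_ansatz \<beta> A t y) \<and>
      L2_norm (\<lambda>y. v t y - asymptotic_ansatz \<beta> A t y) \<le> C * \<epsilon> * t powr (-1/2 + 2 * \<delta>) \<and>
      in_Linf (\<lambda>y. v t y - asymptotic_ansatz \<beta> A t y) \<and>
      Linf_norm (\<lambda>y. v t y - asymptotic_ansatz \<beta> A t y) \<le> C * \<epsilon> * t powr (-3/4 + 2 * \<delta>)"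
    if t: "t \<ge> 1" for t
  proof -
    have [measurable]: "v t \<in> borel_measurable borel" using v[OF t] .
    have m: "(\<lambda>y. v t y - asymptotic_ansatz \<beta> A t y) \<in> borel_measurable borel"
      unfolding asymptotic_ansatz_def by measurable
    have e: "AE y in lborel. u t y - asymptotic_ansatz \<beta> A t y = v t y - asymptotic_ansatz \<beta> A t y"
      using eq[OF t] by eventually_elim simp
    have h: "in_L2 (\<lambda>y. u t y - asymptotic_ansatz \<beta> A t y)" "in_Linf (\<lambda>y. u t y - asymptotic_ansatz \<beta> A t y)"
      "L2_norm (\<lambda>y. u t y - asymptotic_ansatz \<beta> A t y) \<le> C * \<epsilon> * t powr (-1/2 + 2 * \<delta>)"
      "Linf_norm (\<lambda>y. u t y - asymptotic_ansatz \<beta> A t y) \<le> C * \<epsilon> * t powr (-3/4 + 2 * \<delta>)"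
      using A t unfolding modified_scattering_profile_def by auto
    show ?thesis
      using in_L2_cong_AE[OF e h(1) m] in_Linf_cong_AE[OF e h(2) m] h by simp
  qed
  thus ?thesis using A unfolding modified_scattering_profile_def by blast
qed

lemma schwartz_moment_integrable:
  assumes f: "schwartz f"
  shows "integrable lborel (\<lambda>x. \<bar>x\<bar> ^ k * cmod (f x))"
proof -
  have "continuous_on UNIV f"
    using f unfolding schwartz_def smooth_def C_k_on_def by (metis nth_deriv_def funpow_0 le0)
  hence [measurable]: "f \<in> borel_measurable borel" by (rule borel_measurable_continuous_onI)
  have "\<exists>B. \<forall>x. \<bar>x\<bar> ^ j * cmod (f x) \<le> B" for j
    using f unfolding schwartz_def by (metis nth_deriv_def funpow_0)
  then obtain B where B: "\<And>j x. \<bar>x\<bar> ^ j * cmod (f x) \<le> B j" by metis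
  show ?thesis
  proof (rule Bochner_Integration.integrable_bound)
    show "integrable lborel (\<lambda>x. (B k + B (k + 2)) * japanese_bracket x powr (-2))"
      by (intro integrable_mult_right integrable_japanese_bracket_powr) simp
    show "AE x in lborel. norm (\<bar>x\<bar> ^ k * cmod (f x)) \<le> norm ((B k + B (k + 2)) * japanese_bracket x powr (-2))"
    proof (rule AE_I2)
      fix x :: real
      have j: "japanese_bracket x powr (-2) = 1 / (1 + x\<^sup>2)"
      proof -
        have "japanese_bracket x powr 2 = (japanese_bracket x)\<^sup>2"
          using japanese_bracket_ge(1)[of x] by (simp add: powr_numeral)
        also have "\<dots> = 1 + x\<^sup>2" by (simp add: japanese_bracket_def)
        finally show ?thesis by (simp add: powr_minus divide_inverse)
      qed
      have "\<bar>x\<bar> ^ k * cmod (f x) * (1 + x\<^sup>2) = \<bar>x\<bar> ^ k * cmod (f x) + \<bar>x\<bar> ^ (k + 2) * cmod (f x)"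
        by (simp add: power_add power2_eq_square algebra_simps)
      also have "\<dots> \<le> B k + B (k + 2)" by (intro add_mono B)
      finally have "\<bar>x\<bar> ^ k * cmod (f x) \<le> (B k + B (k + 2)) * japanese_bracket x powr (-2)"
        unfolding j by (simp add: pos_le_divide_eq add_pos_nonneg)
      thus "norm (\<bar>x\<bar> ^ k * cmod (f x)) \<le> norm ((B k + B (k + 2)) * japanese_bracket x powr (-2))"
        by simp
    qed
  qed measurable
qed

lemma L2_norm_le_Sigma_norm: "L2_norm f \<le> Sigma_norm f"
proof -
  have "L2_norm f = sqrt ((L2_norm f)\<^sup>2)" by (simp add: L2_norm_nonneg)
  also have "\<dots> \<le> H1_norm f" unfolding H1_norm_def by (intro real_sqrt_le_mono) simp
  also have "\<dots> \<le> Sigma_norm f" by (simp add: Sigma_norm_def L2_norm_nonneg)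
  finally show ?thesis .
qed

text \<open>
The bounds for \<open>u\<close> are recovered from the ansatz: the profile is bounded by \<open>C \<epsilon>\<close>, so \<open>K = 2 C \<epsilon>\<close> accounts
for the ansatz and for the error.
\<close>

lemma scattering_solutionI:
  assumes p: "p > 4" and W: "admissible_potential p W"
    and const: "small_data_constants \<beta> W \<epsilon>0 C\<delta> C"
    and u: "global_solution \<beta> \<gamma> W u"
    and small: "Sigma_norm (u 1) \<le> \<epsilon>" "\<epsilon> \<le> \<epsilon>0"
    and S: "schwartz (u 1)"
    and A: "modified_scattering_profile \<beta> C \<epsilon> (C\<delta> * \<bar>\<beta>\<bar> * \<epsilon>\<^sup>2) u A"
    and A_cont: "continuous_on UNIV A"
  obtains CW K H where "scattering_solution \<beta> \<gamma> p CW K H W u A"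
proof -
  define \<delta> where "\<delta> = C\<delta> * \<bar>\<beta>\<bar> * \<epsilon>\<^sup>2"
  have CS: "C_Sigma u" and mild: "mild_solution \<beta> \<gamma> W u" using u by (auto simp: global_solution_def)
  have u_Sigma: "in_Sigma (u t)" if "t \<ge> 1" for t using CS that by (simp add: C_Sigma_def)
  have L2: "in_L2 (v t)" if "global_solution \<beta> \<gamma> W v" "t \<ge> 1" for v t
    using that by (simp add: global_solution_def C_Sigma_def in_Sigma_def in_H1_def)
  note theory_consequence = const[unfolded small_data_constants_def Let_def,
      THEN conjunct2, THEN conjunct2, THEN conjunct2,
      THEN spec[of _ \<gamma>], THEN spec[of _ \<epsilon>], THEN spec[of _ "u 1"],
      THEN mp, OF conjI[OF u_Sigma[OF order_refl] conjI[OF small]], folded \<delta>_def]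
  then obtain u' A' where d: "\<delta> < 1/16" and u': "global_solution \<beta> \<gamma> W u'"
    and uniq: "\<forall>v. global_solution \<beta> \<gamma> W v \<and> (AE y in lborel. v 1 y = u 1 y) \<longrightarrow>
                 (\<forall>t\<ge>1. AE y in lborel. v t y = u' t y)"
    and uniqA: "\<forall>B. modified_scattering_profile \<beta> C \<epsilon> \<delta> u' B \<longrightarrow> (AE x in lborel. B x = A' x)"
    and Hs: "\<forall>\<sigma>. \<sigma> < 1 - 2 * \<delta> \<longrightarrow> in_Hs \<sigma> A'"
    by (elim conjE exE) (rule that)
  have uu': "AE y in lborel. u t y = u' t y" if "t \<ge> 1" for t
    using uniq[rule_format, of u t] u that by simp
  have AA: "AE x in lborel. A x = A' x"
    by (intro uniqA[rule_format] modified_scattering_profile_cong_AE[OF A[folded \<delta>_def] uu'])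
       (use L2[OF u'] in \<open>auto simp: in_L2_def\<close>)
  hence AA': "AE x in lborel. A' x = A x" by eventually_elim simp
  have \<delta>0: "\<delta> \<ge> 0" using const by (simp add: \<delta>_def small_data_constants_def)
  define K where "K = 2 * (C * \<epsilon>)"
  have AL: "in_Linf A" "L2_norm A + Linf_norm A \<le> C * \<epsilon>"
    using A by (auto simp: modified_scattering_profile_def)
  have C\<epsilon>: "0 \<le> C * \<epsilon>" "Linf_norm A \<le> C * \<epsilon>"
    using AL L2_norm_nonneg[of A] Linf_norm_bound(2)[OF AL(1)] by linarith+
  have A_b: "cmod (A x) \<le> C * \<epsilon>" for x
  proof (rule AE_bound_continuous[OF A_cont])
    show "AE x in lborel. cmod (A x) \<le> C * \<epsilon>"
      using Linf_norm_bound(1)[OF AL(1)] C\<epsilon> by (auto elim!: eventually_mono)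
  qed
  have "in_Hs (7/8) A'" using Hs d by simp
  from Sobolev_holder[OF this AA' A_cont A_b]
  obtain H where H: "H \<ge> 0" "\<And>x y. cmod (A x - A y) \<le> H * \<bar>x - y\<bar> powr (1/4)" by blast
  have asymp: "AE y in lborel. cmod (u t y - asymptotic_ansatz \<beta> A t y) \<le> C * \<epsilon> * t powr (-5/8)" if t: "t \<ge> 1" for t
  proof -
    let ?f = "\<lambda>y. u t y - asymptotic_ansatz \<beta> A t y"
    have f: "in_Linf ?f" "Linf_norm ?f \<le> C * \<epsilon> * t powr (-3/4 + 2 * \<delta>)"
      using A t by (auto simp: modified_scattering_profile_def \<delta>_def)
    have "t powr (-3/4 + 2 * \<delta>) \<le> t powr (-5/8)" using t d by (intro powr_mono) auto
    hence "C * \<epsilon> * t powr (-3/4 + 2 * \<delta>) \<le> C * \<epsilon> * t powr (-5/8)" using C\<epsilon> by (intro mult_left_mono)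
    thus ?thesis using Linf_norm_bound(1)[OF f(1)] f(2) by (auto elim!: eventually_mono)
  qed
  have ans: "cmod (asymptotic_ansatz \<beta> A t y) \<le> C * \<epsilon> * t powr (-1/2)" for t y
  proof -
    have "cmod (asymptotic_ansatz \<beta> A t y) = t powr (-1/2) * cmod (A (y / t))"
      by (simp add: asymptotic_ansatz_def norm_mult norm_exp_eq_Re)
    also have "\<dots> \<le> t powr (-1/2) * (C * \<epsilon>)" by (intro mult_left_mono A_b) auto
    finally show ?thesis by (simp add: mult.commute)
  qed
  obtain B where B: "\<And>x. \<bar>nth_deriv 0 W x\<bar> \<le> B * japanese_bracket x powr (- p - real 0)"
    using W unfolding admissible_potential_def by blast
  have "scattering_solution \<beta> \<gamma> p B K H W u A"
  proof
    show "continuous_on UNIV W"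
      using W unfolding admissible_potential_def smooth_def C_k_on_def by (metis nth_deriv_def funpow_0 le0)
    show "\<bar>W x\<bar> \<le> B * japanese_bracket x powr (- p)" for x
      using B[of x] by (simp add: nth_deriv_def)
    show "in_L2 (u t)" if "t \<ge> 1" for t by (rule L2[OF u that])
    show "((\<lambda>s. L2_norm (\<lambda>y. u s y - u t y)) \<longlongrightarrow> 0) (at t within {1..})" if "t \<ge> 1" for t
    proof (rule Lim_null_comparison)
      show "((\<lambda>s. Sigma_norm (\<lambda>y. u s y - u t y)) \<longlongrightarrow> 0) (at t within {1..})"
        using CS that by (simp add: C_Sigma_def)
      show "\<forall>\<^sub>F s in at t within {1..}. norm (L2_norm (\<lambda>y. u s y - u t y)) \<le> Sigma_norm (\<lambda>y. u s y - u t y)"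
        by (simp add: L2_norm_nonneg L2_norm_le_Sigma_norm)
    qed
    show "AE y in lborel. cmod (u t y) \<le> K * t powr (-1/2)" if t: "t \<ge> 1" for t
      using asymp[OF t]
    proof eventually_elim
      case (elim y)
      have "t powr (-5/8) \<le> t powr (-1/2)" using t by (intro powr_mono) auto
      hence "C * \<epsilon> * t powr (-5/8) \<le> C * \<epsilon> * t powr (-1/2)" using C\<epsilon> by (intro mult_left_mono)
      moreover have "cmod (u t y) \<le> cmod (u t y - asymptotic_ansatz \<beta> A t y) + cmod (asymptotic_ansatz \<beta> A t y)"
        using norm_triangle_ineq[of "u t y - asymptotic_ansatz \<beta> A t y" "asymptotic_ansatz \<beta> A t y"] by simp
      ultimately have "cmod (u t y) \<le> C * \<epsilon> * t powr (-1/2) + C * \<epsilon> * t powr (-1/2)"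
        using elim ans[of t y] by linarith
      thus ?case by (simp add: K_def)
    qed
    show "AE y in lborel. cmod (u t y - asymptotic_ansatz \<beta> A t y) \<le> K * t powr (-5/8)" if t: "t \<ge> 1" for t
      using asymp[OF t]
    proof eventually_elim
      case (elim y)
      have "C * \<epsilon> * t powr (-5/8) \<le> K * t powr (-5/8)"
        using C\<epsilon> by (intro mult_right_mono) (auto simp: K_def)
      thus ?case using elim by linarith
    qed
    show "cmod (A x) \<le> K" for x using A_b[of x] C\<epsilon> by (simp add: K_def)
    show "integrable lborel (\<lambda>x. \<bar>x\<bar> ^ k * cmod (u 1 x))" for k
      by (rule schwartz_moment_integrable[OF S])
  qed (use p A_cont H mild in auto)
  thus ?thesis by (rule that)
qed

lemma quadratic_approximation:
  assumes "(\<lambda>r. f r - ((\<Sum>j\<le>3. b j * of_real r ^ j) + c * resonant \<alpha> r))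
             \<in> o_cube"
  shows "\<exists>q :: complex poly. degree q \<le> 2 \<and> (\<lambda>r. f r - poly q (of_real r)) \<in> O[at 0](\<lambda>r. of_real (\<bar>r\<bar> ^ 3))"
proof -
  define S where "S r = resonant \<alpha> r" for r
  have S: "(\<lambda>r. c * S r) \<in> O[at 0](\<lambda>r. complex_of_real (\<bar>r\<bar> ^ 3))"
    by (rule bigoI[of _ "cmod c"]) (auto simp: eventually_at_filter S_def norm_mult norm_power cmod_powr_cubic)
  have R: "(\<lambda>r. b 3 * of_real r ^ 3) \<in> O[at 0](\<lambda>r. complex_of_real (\<bar>r\<bar> ^ 3))"
    by (rule bigoI[of _ "cmod (b 3)"]) (auto simp: norm_mult norm_power)
  define q where "q = [: b 0, b 1, b 2 :]"
  have A3: "{..3::nat} = {0,1,2,3}" by auto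
  have "f r - poly q (of_real r) = (f r - ((\<Sum>j\<le>3. b j * of_real r ^ j) + c * S r)) + (b 3 * of_real r ^ 3 + c * S r)" for r
    by (simp add: A3 q_def algebra_simps power2_eq_square)
  moreover have "(\<lambda>r. (f r - ((\<Sum>j\<le>3. b j * of_real r ^ j) + c * S r)) + (b 3 * of_real r ^ 3 + c * S r))
      \<in> O[at 0](\<lambda>r. complex_of_real (\<bar>r\<bar> ^ 3))"
    by (rule sum_in_bigo(1)[OF landau_o.small_imp_big[OF assms[folded S_def]] sum_in_bigo(1)[OF R S]])
  moreover have "degree q \<le> 2" by (simp add: q_def)
  ultimately show ?thesis by (intro exI[of _ q] conjI) (simp_all only:)
qed

lemma no_cubic_Taylor:
  assumes exp: "(\<lambda>r. f r - ((\<Sum>j\<le>3. b j * of_real r ^ j) + c * resonant \<alpha> r))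
             \<in> o_cube"
    and q: "(\<lambda>r. f r - poly q (of_real r)) \<in> o_cube"
  shows "c = 0"
proof (rule polynomial_not_resonant)
  define p where "p = q - (\<Sum>j\<le>3. monom (b j) j)"
  let ?S = "\<lambda>r. resonant \<alpha> r"
  have "poly p (of_real r) - c * ?S r =
      (f r - ((\<Sum>j\<le>3. b j * of_real r ^ j) + c * ?S r)) - (f r - poly q (of_real r))" for r :: real
    by (simp add: p_def poly_sum poly_monom)
  thus "(\<lambda>r. poly p (of_real r) - c * ?S r) \<in> o_cube"
    by (simp only: sum_in_smallo(2)[OF exp q])
qed

section \<open>The expansion of the renormalized profile\<close>

theorem theorem4p11:
  fixes \<beta> \<gamma> p \<epsilon>0 C\<delta> C \<epsilon> \<zeta>0 \<alpha> M0 :: real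
    and W :: "real \<Rightarrow> real"
    and u :: "real \<Rightarrow> real \<Rightarrow> complex"
    and A P :: "real \<Rightarrow> complex"
    and A0 :: complex
  assumes "p > 4"
    and "admissible_potential p W"
    and "small_data_constants \<beta> W \<epsilon>0 C\<delta> C"
    and "global_solution \<beta> \<gamma> W u"
    and "Sigma_norm (u 1) \<le> \<epsilon>"
    and "\<epsilon> \<le> \<epsilon>0"
    and "schwartz (u 1)"
    and "modified_scattering_profile \<beta> C \<epsilon> (C\<delta> * \<bar>\<beta>\<bar> * \<epsilon>\<^sup>2) u A"
    and "continuous_on UNIV A"
    and "renormalized_profile_limit \<beta> u P"
    and "\<zeta>0 = - \<gamma> / 2"
    and "A0 = A (- \<gamma>)"
    and "\<alpha> = \<beta> * (cmod A0)\<^sup>2"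
    and "M0 = (LINT x|lborel. W x)"
  shows "(\<exists>b :: nat \<Rightarrow> complex.
           (\<lambda>r. P (\<zeta>0 + r) -
              ((\<Sum>j\<le>3. b j * of_real r ^ j) +
               \<i> * of_real M0 * of_real ((cmod A0) ^ 4) * A0 * C_res \<alpha> *
                 complex_of_real \<bar>r\<bar> powr (3 + 2 * \<i> * of_real \<alpha>)))
           \<in> o[at 0](\<lambda>r. complex_of_real (\<bar>r\<bar> ^ 3))) \<and>
         (\<exists>q :: complex poly. degree q \<le> 2 \<and>
           (\<lambda>r. P (\<zeta>0 + r) - poly q (of_real r)) \<in> O[at 0](\<lambda>r. complex_of_real (\<bar>r\<bar> ^ 3))) \<and>
         (of_real M0 * A0 \<noteq> 0 \<longrightarrow>
           \<not> (\<exists>q :: complex poly. degree q \<le> 3 \<and>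
                (\<lambda>r. P (\<zeta>0 + r) - poly q (of_real r))
                  \<in> o[at 0](\<lambda>r. complex_of_real (\<bar>r\<bar> ^ 3))) \<and>
           (\<forall>U. open U \<and> \<zeta>0 \<in> U \<longrightarrow> \<not> C_k_on 3 P U))"
proof -
  obtain CW K H where loc: "scattering_solution \<beta> \<gamma> p CW K H W u A"
    using scattering_solutionI[OF assms(1-9)] by blast
  define c where "c = \<i> * of_real M0 * of_real ((cmod A0) ^ 4) * A0 * C_res \<alpha>"
  have "((\<lambda>t. renormalized_profile \<beta> u t \<zeta>) \<longlongrightarrow> P \<zeta>) at_top" for \<zeta>
    using assms(10) unfolding renormalized_profile_limit_def by (blast intro: tendsto_uniform_limitI)
  from scattering_solution.profile_expansion[OF loc this]
  have "cubic_peano (\<lambda>r. P (\<zeta>0 + r) - c * resonant \<alpha> r)"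
    by (simp add: c_def assms(11-14) scattering_solution.g0_def[OF loc] scattering_solution.\<alpha>_def[OF loc]
          scattering_solution.A0_def[OF loc] mult.assoc)
  then obtain q where q: "(\<lambda>r. P (\<zeta>0 + r) - c * resonant \<alpha> r - poly q (of_real r)) \<in> o_cube"
    by (auto simp: cubic_peano_def)
  obtain b where b: "(\<lambda>r. poly q (of_real r) - (\<Sum>j\<le>3. b j * of_real r ^ j)) \<in> o_cube"
    using poly_mod_cube[of q] by blast
  have exp: "(\<lambda>r. P (\<zeta>0 + r) - ((\<Sum>j\<le>3. b j * of_real r ^ j) + c * resonant \<alpha> r)) \<in> o_cube"
    using sum_in_smallo(1)[OF q b] by (simp add: algebra_simps)
  have no: "\<not> (\<exists>q :: complex poly. degree q \<le> 3 \<and>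
      (\<lambda>r. P (\<zeta>0 + r) - poly q (of_real r)) \<in> o_cube)"
    if "of_real M0 * A0 \<noteq> 0"
  proof
    assume "\<exists>q :: complex poly. degree q \<le> 3 \<and>
      (\<lambda>r. P (\<zeta>0 + r) - poly q (of_real r)) \<in> o_cube"
    hence "c = 0" using no_cubic_Taylor[OF exp] by blast
    thus False using that C_res_nonzero[of \<alpha>] by (simp add: c_def)
  qed
  show ?thesis
    using exp[unfolded c_def] quadratic_approximation[OF exp] no C3_Taylor[of _ \<zeta>0 P] by blast
qed

end
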